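(* Let $r,j\in\mathbb{N}$ with $\gcd(r,j)=1$, and let $L,M$ be real numbers with $1\leqslant L,M\leqslant r$. Let $f:[1,M]\to\mathbb{R}$ be continuously differentiable with $|f'(x)|\leqslant F$ for all $x\in[1,M]$, where $F\leqslant L^{-1}$. Let $\boldsymbol{\alpha}=(\alpha_l)_{|l|\leqslant L}$ and $\boldsymbol{\beta}=(\beta_m)_{1\leqslant m\leqslant M}$ be arbitrary finite sequences of complex numbers, and let $H\in\mathbb{N}$ satisfy $$1\leqslant H\leqslant \min\left\{\frac{1}{LF},M\right\}.$$ Then for every $\varepsilon>0$, $$\Sigma(r,j,L,M,\boldsymbol{\alpha},\boldsymbol{\beta},f)\ll \left(H^{-1/2}L^{1/2}M+H^{1/4}L^{1/4}M+H^{-1/4}L^{1/4}M^{3/4}r^{1/4}\right)\|\boldsymbol{\alpha}\|_2\|\boldsymbol{\beta}\|_\infty r^{\varepsilon},$$ where the implied constant depends only on $\varepsilon$.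
   Context: For real $x$ and $r\in\mathbb{N}$, $e(x)=e^{2\pi i x}$ and $e_r(x)=e(x/r)$. The sums over $l$ and $m$ run over integers. For $r,j\in\mathbb{N}$, a modular square root of $s$ modulo $r$ is a residue $k$ modulo $r$ with $k^2\equiv s\pmod r$. Define $$\Sigma(r,j,L,M,\boldsymbol{\alpha},\boldsymbol{\beta},f):=\sum_{|l|\leqslant L}\sum_{1\leqslant m\leqslant M}\alpha_l\beta_m\sum_{\substack{k \bmod r\\ k^2\equiv jm \bmod r}} e_r(lk)\,e(lf(m)),$$ i.e. the term $e_r(l\sqrt{jm})$ is summed over all modular square roots $k$ of $jm$ modulo $r$ (empty if none exist). Also $\|\boldsymbol{\alpha}\|_2=(\sum_{|l|\leqslant L}|\alpha_l|^2)^{1/2}$ and $\|\boldsymbol{\beta}\|_\infty=\max_{1\leqslant m\leqslant M}|\beta_m|$. If $F=0$, the quantity $1/(LF)$ is interpreted as $+\infty$. *)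

theory Defs
  imports "HOL-Analysis.Analysis" "HOL-Number_Theory.Cong"
begin

definition efun :: "real \<Rightarrow> complex" where
  "efun x = exp (2 * of_real pi * \<i> * of_real x)"

definition emod :: "nat \<Rightarrow> real \<Rightarrow> complex" where
  "emod r x = efun (x / real r)"

text \<open>Residues modulo \<open>r\<close> are represented by \<open>0, \<dots>, r - 1\<close>; for integral \<open>l\<close>, the value
  \<open>emod r (l * k)\<close> depends only on the class of \<open>k\<close> modulo \<open>r\<close>.\<close>

definition modular_sqrts :: "nat \<Rightarrow> nat \<Rightarrow> nat set" where
  "modular_sqrts r s = {k. k < r \<and> [k\<^sup>2 = s] (mod r)}"

definition l_range :: "real \<Rightarrow> int set" where
  "l_range L = {l. \<bar>real_of_int l\<bar> \<le> L}"

definition m_range :: "real \<Rightarrow> nat set" where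
  "m_range M = {m. 1 \<le> m \<and> real m \<le> M}"

text \<open>The sequences \<open>\<alpha>\<close> and \<open>\<beta>\<close> are total functions, of which only the values on
  \<open>l_range L\<close> and \<open>m_range M\<close> enter below; likewise only the values of \<open>f\<close> on \<open>{1..M}\<close> matter.\<close>

definition Sigma_sum ::
  "nat \<Rightarrow> nat \<Rightarrow> real \<Rightarrow> real \<Rightarrow> (int \<Rightarrow> complex) \<Rightarrow> (nat \<Rightarrow> complex) \<Rightarrow> (real \<Rightarrow> real) \<Rightarrow> complex" where
  "Sigma_sum r j L M \<alpha> \<beta> f =
    (\<Sum>l\<in>l_range L. \<Sum>m\<in>m_range M. \<alpha> l * \<beta> m *
      (\<Sum>k\<in>modular_sqrts r (j * m).
        emod r (real_of_int l * real k) * efun (real_of_int l * f (real m))))"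

definition norm_two :: "real \<Rightarrow> (int \<Rightarrow> complex) \<Rightarrow> real" where
  "norm_two L \<alpha> = L2_set (\<lambda>l. cmod (\<alpha> l)) (l_range L)"

text \<open>The maximum is over a finite set, which is nonempty whenever \<open>M \<ge> 1\<close>.\<close>

definition norm_max :: "real \<Rightarrow> (nat \<Rightarrow> complex) \<Rightarrow> real" where
  "norm_max M \<beta> = Max ((\<lambda>m. cmod (\<beta> m)) ` m_range M)"

text \<open>Continuous differentiability on a closed interval, with one-sided derivatives at the
  end points; \<open>f'\<close> is the derivative.  (The library's \<open>C1_differentiable_on\<close> asks for two-sided
  derivatives at the end points and is therefore too strong for a function given on \<open>{a..b}\<close>
  only.)\<close>

definition C1_on_interval :: "real \<Rightarrow> real \<Rightarrow> (real \<Rightarrow> real) \<Rightarrow> (real \<Rightarrow> real) \<Rightarrow> bool" where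
  "C1_on_interval a b f f' \<longleftrightarrow>
    (\<forall>x\<in>{a..b}. (f has_real_derivative f' x) (at x within {a..b})) \<and> continuous_on {a..b} f'"

text \<open>Division of extended reals follows the convention \<open>1 / 0 = \<infinity>\<close>, which is the intended
  meaning of \<open>1 / (L * F)\<close> for \<open>F = 0\<close>; for \<open>L, F > 0\<close> it is ordinary division.\<close>

lemma inverse_LF_zero: "1 / ereal (L * 0) = \<infinity>"
  by (simp add: divide_ereal_def zero_ereal_def[symmetric])

lemma inverse_LF_pos: "L > 0 \<Longrightarrow> F > 0 \<Longrightarrow> 1 / ereal (L * F) = ereal (1 / (L * F))"
  by (simp add: one_ereal_def)

end

(*
  By Cauchy-Schwarz and a large sieve inequality, the square of the bilinear sum is controlled by
  the number of pairs of roots (k, m), (k', m') with |m - m'| <= H and ||(k - k')/r|| <= 2/L.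
  Splitting the roots k according to the largest s with s | k and s^2 | r reduces the count to
  primitive roots. Another Cauchy-Schwarz over u = k - k' leads to the second moment of
  n(u) = #{(k, k'): k - k' = u mod r}. With h = m - m' and S = m + m', the congruences
  k^2 = j m, k'^2 = j m' force (h^2, S) into a coset of the lattice {(g, D): 2 D u^2 = j g mod r} of
  determinant r. Hence n(u) is either O(1 + H^2 M / r) up to divisor functions, or the lattice has a
  short vector (g, D) and most of the points lie on lines in its direction. On such a line h^2 is
  constant mod g, which gives n(u)^2 << (H / g) (M / D) when gcd conditions are ignored; summed over
  the O(1) many u belonging to each (g, D), this is O(H M) up to logarithms.
*)
theory Submission
  imports Defs "HOL-Computational_Algebra.Primes"
begin

section \<open>The divisor bound\<close>

text \<open>The blocks of m have length H because H <= 1/(L F) lets f move by at most 1/L inside a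
  block: within a block the phase l f(m) resolves no more than the frequency bins do, so only the
  distance of k/r and k'/r is left. The price is a factor of about M/H for the number of blocks;
  times L and the three terms of the pair count (the diagonal M and the two halves of the energy
  bound), it gives exactly the squares of the three terms of the theorem. Splitting by s is forced:
  one m can have about s roots k, which would ruin every count of fibres, while after division by s
  only divisor-many remain. The shortest vector may be (0, D), in particular when u shares a factor
  with r; pairs with m = m' are counted apart because it is h nonzero, together with gcd(u, r) | h,
  that controls this case. The bound for a line in terms of g and the one in terms of D are each too
  weak alone; their geometric mean makes the sum over (g, D) split into two logarithmic sums. All
  divisor and logarithm factors are absorbed in one number B.\<close>

lemma card_dvd_prime_power_mult:
  fixes p :: nat
  assumes "prime p" "\<not> p dvd m" "m > 0"
  shows "card {d. d dvd p ^ a * m} \<le> (a + 1) * card {d. d dvd m}"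
proof -
  have "{d. d dvd p ^ a * m} \<subseteq> (\<lambda>(i, d). p ^ i * d) ` ({..a} \<times> {d. d dvd m})"
  proof
    fix d assume "d \<in> {d. d dvd p ^ a * m}"
    then obtain x y where "d = x * y" "x dvd p ^ a" "y dvd m"
      using division_decomp by blast
    then show "d \<in> (\<lambda>(i, d). p ^ i * d) ` ({..a} \<times> {d. d dvd m})"
      using divides_primepow_nat[OF assms(1)] by (auto intro!: rev_image_eqI)
  qed
  then have "card {d. d dvd p ^ a * m} \<le> card ({..a} \<times> {d. d dvd m})"
    by (rule surj_card_le[rotated]) (use assms in auto)
  then show ?thesis by (simp add: card_cartesian_product)
qed

text \<open>The ratio d(n) / n^\<epsilon> is multiplicative. A prime p >= 2^(1/\<epsilon>)
  contributes at most 1, since a + 1 <= 2^a <= p^(a \<epsilon>); each of the fewer than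
  \<open>P\<close> smaller primes contributes at most \<open>K\<close>.\<close>

lemma divisor_bound:
  fixes \<epsilon> :: real
  assumes "\<epsilon> > 0"
  shows "\<exists>C\<ge>1. \<forall>n::nat. n > 0 \<longrightarrow> real (card {d. d dvd n}) \<le> C * real n powr \<epsilon>"
proof -
  \<comment> \<open>Chosen so that a + 1 <= K (1 + \<epsilon> a ln 2), which is at most K 2^(a
    \<epsilon>).\<close>
  define K where "K = max 1 (1 / (\<epsilon> * ln 2))"
  define P where "P = nat \<lceil>2 powr (1 / \<epsilon>)\<rceil>"
  have K1: "K \<ge> 1" by (simp add: K_def)
  have Ke: "K * (\<epsilon> * ln 2) \<ge> 1"
  proof -
    have "K * (\<epsilon> * ln 2) \<ge> (1 / (\<epsilon> * ln 2)) * (\<epsilon> * ln 2)"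
      unfolding K_def using assms by (intro mult_right_mono) auto
    then show ?thesis using assms by simp
  qed
  have small: "real (a + 1) \<le> K * (real p ^ a) powr \<epsilon>" if "p \<ge> 2" for p a :: nat
  proof -
    have "real (a + 1) \<le> K * (1 + \<epsilon> * ln 2 * a)"
    proof -
      have "1 * real a \<le> K * (\<epsilon> * ln 2) * a" by (intro mult_right_mono Ke) auto
      then show ?thesis using K1 by (simp add: algebra_simps)
    qed
    also have "1 + \<epsilon> * ln 2 * a \<le> exp (\<epsilon> * ln 2 * a)" by (rule exp_ge_add_one_self)
    also have "\<dots> \<le> exp (\<epsilon> * ln p * a)"
      using that assms by (simp add: mult_left_mono mult_right_mono)
    also have "\<dots> = (real p ^ a) powr \<epsilon>"
      using that by (simp add: powr_def ln_realpow mult_ac)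
    finally show ?thesis using K1 by (simp add: mult_left_mono)
  qed
  have large: "real (a + 1) \<le> (real p ^ a) powr \<epsilon>" if "p \<ge> P" "p \<ge> 2" for p a :: nat
  proof -
    have "2 powr (1 / \<epsilon>) \<le> real p" using that by (simp add: P_def)
    then have "(2 powr (1 / \<epsilon>)) powr \<epsilon> \<le> real p powr \<epsilon>" using assms by (intro powr_mono2) auto
    then have *: "2 \<le> real p powr \<epsilon>" using assms by (simp add: powr_powr)
    have "a < 2 ^ a" by (rule less_exp)
    then have "real (a + 1) \<le> real (2 ^ a)" unfolding of_nat_le_iff by linarith
    also have "\<dots> \<le> (real p powr \<epsilon>) ^ a" using * by (simp add: power_mono)
    also have "\<dots> = (real p ^ a) powr \<epsilon>" using that
      by (simp add: powr_power flip: powr_realpow) (simp add: powr_powr mult.commute)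
    finally show ?thesis .
  qed
  have main: "real (card {d. d dvd n}) \<le> K ^ card (prime_factors n \<inter> {..<P}) * real n powr \<epsilon>"
    if "n > 0" for n :: nat
    using that
  proof (induction n rule: less_induct)
    case (less n)
    show ?case
    proof (cases "n = 1")
      case True then show ?thesis by simp
    next
      case False
      then obtain p where p: "prime p" "p dvd n" using prime_factor_nat by blast
      define a where "a = multiplicity p n"
      obtain m where m: "n = p ^ a * m" "\<not> p dvd m"
        using multiplicity_decompose'[of n p] p less.prems a_def
        by (metis not_prime_unit less_numeral_extra(3))
      have a0: "a > 0" using p less.prems unfolding a_def by (metis not_prime_unit multiplicity_gt_zero_iff less_numeral_extra(3))
      have m0: "m > 0" using m less.prems by (cases m) auto
      have p2: "p \<ge> 2" using p by (simp add: prime_ge_2_nat)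
      have "p ^ a > 1" using a0 p2 by (intro one_less_power) auto
      then have mn: "m < n" using m m0 by simp
      note IH = less.IH[OF mn m0]
      have pf: "prime_factors n = insert p (prime_factors m)"
        using m m0 p a0 by (simp add: prime_factors_product prime_factorization_prime_power)
      have pm: "p \<notin> prime_factors m" using m by auto
      have "real (card {d. d dvd n}) \<le> real ((a + 1) * card {d. d dvd m})"
        unfolding of_nat_le_iff using card_dvd_prime_power_mult[OF p(1) m(2) m0] m(1) by simp
      also have "\<dots> = real (a + 1) * real (card {d. d dvd m})" by (rule of_nat_mult)
      also have "\<dots> \<le> real (a + 1) * (K ^ card (prime_factors m \<inter> {..<P}) * real m powr \<epsilon>)"
        by (intro mult_left_mono IH) auto
      also have "\<dots> \<le> K ^ card (prime_factors n \<inter> {..<P}) * real n powr \<epsilon>"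
      proof (cases "p < P")
        case True
        have "card (prime_factors n \<inter> {..<P}) = Suc (card (prime_factors m \<inter> {..<P}))"
          using True pm pf by (simp add: Int_insert_left)
        then show ?thesis
          using mult_right_mono[OF small[OF p2, of a], of "K ^ card (prime_factors m \<inter> {..<P}) * real m powr \<epsilon>"] K1
          by (simp add: m(1) powr_mult mult_ac)
      next
        case False
        have "card (prime_factors n \<inter> {..<P}) = card (prime_factors m \<inter> {..<P})"
          using False pm pf by (simp add: Int_insert_left)
        then show ?thesis
          using mult_right_mono[OF large[OF _ p2, of a], of "K ^ card (prime_factors m \<inter> {..<P}) * real m powr \<epsilon>"] K1 False
          by (simp add: m(1) powr_mult mult_ac)
      qed
      finally show ?thesis .
    qed
  qed
  show ?thesis
  proof (intro exI[of _ "K ^ P"] conjI allI impI)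
    show "1 \<le> K ^ P" using K1 by simp
    fix n :: nat assume n: "n > 0"
    have "card (prime_factors n \<inter> {..<P}) \<le> card {..<P}" by (intro card_mono) auto
    then have "K ^ card (prime_factors n \<inter> {..<P}) \<le> K ^ P" using K1 by (intro power_increasing) auto
    then show "real (card {d. d dvd n}) \<le> K ^ P * real n powr \<epsilon>"
      using main[OF n] by (meson mult_right_mono order_trans powr_ge_zero)
  qed
qed

section \<open>A large sieve inequality over bins\<close>

lemma cmod_efun [simp]: "cmod (efun x) = 1"
  unfolding efun_def by (simp add: norm_exp_eq_Re)

lemma efun_add: "efun (x + y) = efun x * efun y"
  by (simp add: efun_def exp_add algebra_simps)

lemma efun_0 [simp]: "efun 0 = 1"
  by (simp add: efun_def)

lemma efun_int [simp]: "efun (of_int k) = 1"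
proof -
  have "2 * of_real pi * \<i> * of_real (of_int k) = \<i> * (of_int (2 * k) * of_real pi)"
    by (simp add: mult_ac)
  then show ?thesis unfolding efun_def exp_eq_1 by auto
qed

lemma cnj_efun: "cnj (efun x) = efun (- x)"
  by (simp add: efun_def exp_cnj)

section \<open>The Dirichlet kernel\<close>

definition dirichlet :: "nat \<Rightarrow> real \<Rightarrow> complex" where
  "dirichlet n t = (\<Sum>a<n. efun (real a * t))"

lemma norm_dirichlet_le: "cmod (dirichlet n t) \<le> real n"
  unfolding dirichlet_def by (rule order_trans[OF norm_sum]) simp

lemma cmod_one_minus_efun: "cmod (1 - efun t) = 2 * \<bar>sin (pi * t)\<bar>"
proof -
  have "efun t = cis (2 * (pi * t))"
    by (simp add: efun_def cis_conv_exp mult_ac)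
  then have "(cmod (1 - efun t))\<^sup>2 = (1 - cos (2 * (pi * t)))\<^sup>2 + (sin (2 * (pi * t)))\<^sup>2"
    by (simp add: cmod_power2)
  also have "\<dots> = 2 - 2 * cos (2 * (pi * t))"
    using sin_cos_squared_add[of "2 * (pi * t)"] by (simp add: power2_eq_square algebra_simps)
  also have "\<dots> = (2 * \<bar>sin (pi * t)\<bar>)\<^sup>2"
    by (simp add: cos_double_sin power_mult_distrib)
  finally show ?thesis by (rule power2_eq_imp_eq) auto
qed

text \<open>Jordan's inequality: by concavity the sine lies above its chord from 0 to pi/2.\<close>

lemma sin_pi_ge:
  fixes t :: real
  assumes "0 \<le> t" "t \<le> 1 / 2"
  shows "2 * t \<le> sin (pi * t)"
proof -
  have "concave_on {0..pi} sin"
  proof (rule f''_le0_imp_concave[where f' = cos and f'' = "\<lambda>x. - sin x"])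
  qed (auto intro!: derivative_eq_intros sin_ge_zero)
  then have "sin ((1 - 2 * t) *\<^sub>R 0 + (2 * t) *\<^sub>R (pi / 2)) \<ge> (1 - 2 * t) * sin 0 + (2 * t) * sin (pi / 2)"
    using assms by (intro concave_onD) auto
  then show ?thesis by (simp add: mult_ac)
qed

text \<open>The geometric sum has modulus at most 2 / |1 - e(t)| = 1 / |sin (pi t)|, and t has
  distance at least \<delta> from the integers.\<close>

lemma norm_dirichlet_mult_le:
  assumes "\<delta> \<ge> 0" "\<delta> \<le> t" "t \<le> 1 - \<delta>"
  shows "cmod (dirichlet n t) * (2 * \<delta>) \<le> 1"
proof -
  have s: "2 * \<delta> \<le> sin (pi * t)"
  proof (cases "t \<le> 1 / 2")
    case True
    then show ?thesis using sin_pi_ge[of t] assms by auto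
  next
    case False
    have "sin (pi * t) = sin (pi * (1 - t))" by (simp add: algebra_simps)
    then show ?thesis using sin_pi_ge[of "1 - t"] assms False by auto
  qed
  have e: "efun (real a * t) = efun t ^ a" for a
    by (induction a) (simp_all add: efun_add distrib_right)
  have "dirichlet n t * (1 - efun t) = 1 - efun t ^ n"
    unfolding dirichlet_def e using one_diff_power_eq[of "efun t" n] by (simp add: mult.commute)
  then have "cmod (dirichlet n t) * cmod (1 - efun t) = cmod (1 - efun t ^ n)"
    by (metis norm_mult)
  also have "\<dots> \<le> 2"
    by (rule order_trans[OF norm_triangle_ineq4]) (simp add: norm_power)
  finally have "cmod (dirichlet n t) * \<bar>sin (pi * t)\<bar> \<le> 1"
    by (simp add: cmod_one_minus_efun)
  moreover have "cmod (dirichlet n t) * (2 * \<delta>) \<le> cmod (dirichlet n t) * \<bar>sin (pi * t)\<bar>"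
    using s by (intro mult_left_mono) auto
  ultimately show ?thesis by linarith
qed

lemma norm_dirichlet_minus: "cmod (dirichlet n (- t)) = cmod (dirichlet n t)"
proof -
  have "dirichlet n (- t) = cnj (dirichlet n t)"
    by (simp add: dirichlet_def cnj_efun)
  then show ?thesis by simp
qed

text \<open>Bins are half-open arcs of length 1/n of the circle R/Z. They replace the usual spacing
  hypothesis of the large sieve, since the frequencies k/r + f(m) may cluster.\<close>

definition bin :: "nat \<Rightarrow> real \<Rightarrow> nat" where
  "bin n x = nat \<lfloor>real n * frac x\<rfloor>"

lemma bin_bounds:
  assumes "n > 0"
  shows "real (bin n x) \<le> real n * frac x" "real n * frac x < real (bin n x) + 1" "bin n x < n"
proof -
  have 0: "0 \<le> real n * frac x" by simp
  then have r: "real (bin n x) = of_int \<lfloor>real n * frac x\<rfloor>" by (simp add: bin_def)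
  show 1: "real (bin n x) \<le> real n * frac x" "real n * frac x < real (bin n x) + 1"
    unfolding r by linarith+
  have "real n * frac x < real n" using assms frac_lt_1[of x] by simp
  then show "bin n x < n" using 1 by linarith
qed

text \<open>A summable majorant of |D_n|^2 / n^2 for points q bins apart. The 4 makes it at least 1
  for q <= 1, where only the trivial bound is available, and at least 1 / (2 (q - 1))^2 for q >=
  2.\<close>

definition bin_weight :: "nat \<Rightarrow> real" where
  "bin_weight q = 4 / (real q + 1)\<^sup>2"

lemma sum_bin_weight: "(\<Sum>q<n. bin_weight q) \<le> 8"
proof -
  \<comment> \<open>Telescoping: 4 / (n + 1)^2 <= 8 / ((n + 1) (n + 2)).\<close>
  have "(\<Sum>q<n. bin_weight q) \<le> 8 - 8 / (real n + 1)"
  proof (induction n)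
    case (Suc n)
    have "4 / (real n + 1)\<^sup>2 \<le> 8 / (real n + 1) - 8 / (real n + 2)"
      by (simp add: divide_simps power2_eq_square)
    then show ?case using Suc by (simp add: bin_weight_def add.commute)
  qed simp
  then show ?thesis by (smt (verit) divide_nonneg_nonneg of_nat_0_le_iff)
qed

text \<open>The bin indices fix the distance only up to one bin, and on the circle the short way may
  be the other one, of n - q bins. Adding both weights covers either case.\<close>

lemma dirichlet_bin_bound:
  assumes n: "n > 0" and le: "frac y \<le> frac x"
  shows "(cmod (dirichlet n (frac x - frac y)))\<^sup>2
    \<le> (real n)\<^sup>2 * (bin_weight (bin n x - bin n y) + bin_weight (n - (bin n x - bin n y)))"
proof -
  define q where "q = bin n x - bin n y"
  define t where "t = frac x - frac y"
  have t: "0 \<le> t" "t < 1" using le frac_lt_1[of x] frac_ge_0[of y] unfolding t_def by linarith+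
  note bx = bin_bounds[OF n, of x] and b_y = bin_bounds[OF n, of y]
  have "bin n y \<le> bin n x"
    unfolding bin_def using le by (intro nat_mono floor_mono mult_left_mono) auto
  then have q: "real q = real (bin n x) - real (bin n y)" by (simp add: q_def)
  have nt: "real n * t = real n * frac x - real n * frac y" by (simp add: t_def algebra_simps)
  have qt: "real q - 1 \<le> real n * t" "real n * t \<le> real q + 1" using nt q bx b_y by linarith+
  have qn: "q < n" using bx(3) unfolding q_def by simp
  have pos: "0 \<le> bin_weight i" for i by (simp add: bin_weight_def)
  have big: "1 \<le> bin_weight i" if "i \<le> 1" for i
  proof -
    have "i = 0 \<or> i = 1" using that by auto
    then show ?thesis by (auto simp: bin_weight_def)
  qed
  have D: "(cmod (dirichlet n t))\<^sup>2 \<le> (real n)\<^sup>2" 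
    using norm_dirichlet_le[of n t] by (intro power_mono) auto
  have key: "(cmod (dirichlet n t))\<^sup>2 \<le> (real n)\<^sup>2 * bin_weight i"
    if i: "i \<ge> 2" "real i - 1 \<le> real n * t" "real i - 1 \<le> real n * (1 - t)" for i
  proof -
    define \<delta> where "\<delta> = (real i - 1) / real n"
    have "\<delta> \<ge> 0" "\<delta> \<le> t" "t \<le> 1 - \<delta>"
      using i n by (auto simp: \<delta>_def field_simps)
    then have "cmod (dirichlet n t) * (2 * \<delta>) \<le> 1" by (rule norm_dirichlet_mult_le)
    then have "cmod (dirichlet n t) \<le> real n / (2 * (real i - 1))"
      using i n by (simp add: \<delta>_def field_simps)
    also have "\<dots> \<le> real n * (2 / (real i + 1))"
      using i n by (simp add: field_simps)
    finally have "(cmod (dirichlet n t))\<^sup>2 \<le> (real n * (2 / (real i + 1)))\<^sup>2"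
      by (intro power_mono) auto
    then show ?thesis by (simp add: bin_weight_def power_mult_distrib power_divide)
  qed
  \<comment> \<open>Close to an integer the trivial bound n^2 is used; otherwise the smaller of q
    and n - q serves as \<open>i\<close> in \<open>key\<close>.\<close>
  consider "q \<le> 1" | "n - q \<le> 1" | "2 \<le> q" "2 \<le> n - q" by linarith
  then have "(cmod (dirichlet n t))\<^sup>2 \<le> (real n)\<^sup>2 * (bin_weight q + bin_weight (n - q))"
  proof cases
    case 1
    have "(real n)\<^sup>2 * 1 \<le> (real n)\<^sup>2 * (bin_weight q + bin_weight (n - q))"
      using big[OF 1] pos[of "n - q"] by (intro mult_left_mono) auto
    then show ?thesis using D by linarith
  next
    case 2
    have "(real n)\<^sup>2 * 1 \<le> (real n)\<^sup>2 * (bin_weight q + bin_weight (n - q))"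
      using big[OF 2] pos[of q] by (intro mult_left_mono) auto
    then show ?thesis using D by linarith
  next
    case 3
    have nq: "real (n - q) = real n - real q" using qn by simp
    have e: "real n * (1 - t) = real n - real n * t" by (simp add: algebra_simps)
    have "(cmod (dirichlet n t))\<^sup>2 \<le> (real n)\<^sup>2 * bin_weight q
        \<or> (cmod (dirichlet n t))\<^sup>2 \<le> (real n)\<^sup>2 * bin_weight (n - q)"
    proof (cases "q \<le> n - q")
      case True
      then have "real q \<le> real (n - q)" by simp
      then have "(cmod (dirichlet n t))\<^sup>2 \<le> (real n)\<^sup>2 * bin_weight q"
        using 3 qt nq e by (intro key) linarith+
      then show ?thesis ..
    next
      case False
      then have "real q \<ge> real (n - q)" by simp
      then have "(cmod (dirichlet n t))\<^sup>2 \<le> (real n)\<^sup>2 * bin_weight (n - q)"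
        using 3 qt nq e by (intro key) linarith+
      then show ?thesis ..
    qed
    moreover have "0 \<le> (real n)\<^sup>2 * bin_weight q" "0 \<le> (real n)\<^sup>2 * bin_weight (n - q)"
      using pos by auto
    ultimately show ?thesis by (auto simp: distrib_left)
  qed
  then show ?thesis unfolding t_def q_def .
qed

definition absdiff :: "nat \<Rightarrow> nat \<Rightarrow> nat" where
  "absdiff a b = nat \<bar>int a - int b\<bar>"

lemma dirichlet_bin_bound_sym:
  assumes n: "n > 0"
  shows "(cmod (dirichlet n (frac x - frac y)))\<^sup>2 \<le> (real n)\<^sup>2 *
    (bin_weight (absdiff (bin n x) (bin n y)) + bin_weight (n - absdiff (bin n x) (bin n y)))"
proof -
  have mono: "bin n a \<le> bin n b" if "frac a \<le> frac b" for a b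
    unfolding bin_def using that by (intro nat_mono floor_mono mult_left_mono) auto
  show ?thesis
  proof (cases "frac y \<le> frac x")
    case True
    then have "absdiff (bin n x) (bin n y) = bin n x - bin n y"
      using mono[OF True] by (simp add: absdiff_def nat_diff_distrib flip: of_nat_diff)
    then show ?thesis using dirichlet_bin_bound[OF n True] by simp
  next
    case False
    then have F: "frac x \<le> frac y" by simp
    then have "absdiff (bin n x) (bin n y) = bin n y - bin n x"
      using mono[OF F] by (simp add: absdiff_def flip: of_nat_diff)
    then show ?thesis using dirichlet_bin_bound[OF n F] norm_dirichlet_minus[of n "frac y - frac x"]
      by simp
  qed
qed

text \<open>A bin has at most two others at any given distance, one on each side.\<close>

lemma sum_absdiff_le:
  fixes w :: "nat \<Rightarrow> real"
  assumes "\<And>q. w q \<ge> 0" "b < n"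
  shows "(\<Sum>c<n. w (absdiff b c)) \<le> 2 * (\<Sum>q<n. w q)"
proof -
  have "(\<Sum>c<n. w (absdiff b c)) = (\<Sum>c\<in>{..b} \<union> {b<..<n}. w (absdiff b c))"
    using assms(2) by (intro sum.cong) auto
  also have "\<dots> = (\<Sum>c\<le>b. w (absdiff b c)) + (\<Sum>c\<in>{b<..<n}. w (absdiff b c))"
    by (rule sum.union_disjoint) auto
  also have "(\<Sum>c\<le>b. w (absdiff b c)) = (\<Sum>q\<le>b. w q)"
    by (rule sum.reindex_bij_witness[of _ "\<lambda>q. b - q" "\<lambda>c. b - c"]) (auto simp: absdiff_def nat_diff_distrib)
  also have "\<dots> \<le> (\<Sum>q<n. w q)" using assms by (intro sum_mono2) auto
  also have "(\<Sum>c\<in>{b<..<n}. w (absdiff b c)) = (\<Sum>q\<in>{0<..<n-b}. w q)"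
    by (rule sum.reindex_bij_witness[of _ "\<lambda>q. b + q" "\<lambda>c. c - b"]) (auto simp: absdiff_def nat_diff_distrib)
  also have "\<dots> \<le> (\<Sum>q<n. w q)" using assms by (intro sum_mono2) auto
  finally show ?thesis by simp
qed

lemma absdiff_commute: "absdiff a b = absdiff b a"
  by (simp add: absdiff_def abs_minus_commute)

text \<open>32 = 2 * 2 * 8: two ways round the circle, two sides, total weight at most 8. The second
  weight runs over distances 1 to n, hence one index further than the first.\<close>

lemma sum_bin_kernel_le:
  assumes "b < n"
  shows "(\<Sum>c<n. bin_weight (absdiff b c) + bin_weight (n - absdiff b c)) \<le> 32"
proof -
  have 0: "bin_weight q \<ge> 0" for q by (simp add: bin_weight_def)
  have "(\<Sum>c<n. bin_weight (absdiff b c)) \<le> 2 * (\<Sum>q<n. bin_weight q)"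
    using 0 assms by (rule sum_absdiff_le)
  moreover have "(\<Sum>c<n. bin_weight (n - absdiff b c)) \<le> 2 * (\<Sum>q<n. bin_weight (n - q))"
    using 0 assms by (rule sum_absdiff_le)
  moreover have "(\<Sum>q<n. bin_weight (n - q)) \<le> (\<Sum>q<Suc n. bin_weight q)"
  proof -
    have "(\<Sum>q<n. bin_weight (n - q)) = (\<Sum>q\<in>{1..n}. bin_weight q)"
      by (rule sum.reindex_bij_witness[of _ "\<lambda>q. n - q" "\<lambda>q. n - q"]) auto
    also have "\<dots> \<le> (\<Sum>q<Suc n. bin_weight q)" using 0 by (intro sum_mono2) auto
    finally show ?thesis .
  qed
  ultimately show ?thesis
    using sum_bin_weight[of n] sum_bin_weight[of "Suc n"] by (simp add: sum.distrib)
qed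

lemma dirichlet_frac: "dirichlet n (frac x - frac y) = dirichlet n (x - y)"
proof -
  have "efun (real a * (frac x - frac y)) = efun (real a * (x - y))" for a
  proof -
    have "real a * (x - y) = real a * (frac x - frac y) + of_int (int a * (\<lfloor>x\<rfloor> - \<lfloor>y\<rfloor>))"
      by (simp add: frac_def algebra_simps)
    then show ?thesis by (simp only: efun_add efun_int mult_1_right)
  qed
  then show ?thesis by (simp add: dirichlet_def)
qed

lemma norm_dirichlet_sq:
  "(\<Sum>(a, b)\<in>{..<n} \<times> {..<n}. efun (of_int (int a - int b) * t)) = of_real ((cmod (dirichlet n t))\<^sup>2)"
proof -
  have "of_real ((cmod (dirichlet n t))\<^sup>2) = dirichlet n t * cnj (dirichlet n t)"
    by (simp only: complex_norm_square)
  also have "\<dots> = (\<Sum>a<n. \<Sum>b<n. efun (real a * t) * efun (- (real b * t)))"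
    by (simp add: dirichlet_def cnj_efun sum_product)
  also have "\<dots> = (\<Sum>(a, b)\<in>{..<n} \<times> {..<n}. efun (of_int (int a - int b) * t))"
    by (simp add: sum.cartesian_product algebra_simps flip: efun_add)
  finally show ?thesis by simp
qed

text \<open>Summing over all differences a - b turns the exponentials into |D_n|^2. This kernel is
  nonnegative, so passing to the moduli of the coefficients leaves it intact.\<close>

lemma fejer_expansion:
  fixes c :: "'a \<Rightarrow> complex" and x :: "'a \<Rightarrow> real"
  assumes "finite X"
  defines "G \<equiv> \<lambda>l::int. \<Sum>\<xi>\<in>X. c \<xi> * efun (of_int l * x \<xi>)"
  shows "(\<Sum>(a, b)\<in>{..<n} \<times> {..<n}. (cmod (G (int a - int b)))\<^sup>2)
    \<le> (\<Sum>\<xi>\<in>X. \<Sum>\<eta>\<in>X. cmod (c \<xi>) * cmod (c \<eta>) * (cmod (dirichlet n (x \<xi> - x \<eta>)))\<^sup>2)"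
proof -
  have G: "of_real ((cmod (G l))\<^sup>2) =
      (\<Sum>\<xi>\<in>X. \<Sum>\<eta>\<in>X. c \<xi> * cnj (c \<eta>) * efun (of_int l * (x \<xi> - x \<eta>)))" for l
  proof -
    have "of_real ((cmod (G l))\<^sup>2) = G l * cnj (G l)" by (simp only: complex_norm_square)
    also have "\<dots> = (\<Sum>\<xi>\<in>X. \<Sum>\<eta>\<in>X. c \<xi> * efun (of_int l * x \<xi>) * (cnj (c \<eta>) * efun (- (of_int l * x \<eta>))))"
      by (simp add: G_def cnj_efun sum_product)
    also have "\<dots> = (\<Sum>\<xi>\<in>X. \<Sum>\<eta>\<in>X. c \<xi> * cnj (c \<eta>) * (efun (of_int l * x \<xi>) * efun (- (of_int l * x \<eta>))))"
      by (simp add: mult_ac)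
    also have "\<dots> = (\<Sum>\<xi>\<in>X. \<Sum>\<eta>\<in>X. c \<xi> * cnj (c \<eta>) * efun (of_int l * (x \<xi> - x \<eta>)))"
      by (simp add: right_diff_distrib flip: efun_add)
    finally show ?thesis .
  qed
  have "of_real (\<Sum>(a, b)\<in>{..<n} \<times> {..<n}. (cmod (G (int a - int b)))\<^sup>2)
      = (\<Sum>p\<in>{..<n} \<times> {..<n}. \<Sum>\<xi>\<in>X. \<Sum>\<eta>\<in>X. c \<xi> * cnj (c \<eta>) * efun (of_int (int (fst p) - int (snd p)) * (x \<xi> - x \<eta>)))"
    unfolding of_real_sum by (intro sum.cong refl) (simp only: case_prod_unfold G)
  also have "\<dots> = (\<Sum>\<xi>\<in>X. \<Sum>\<eta>\<in>X. \<Sum>p\<in>{..<n} \<times> {..<n}. c \<xi> * cnj (c \<eta>) * efun (of_int (int (fst p) - int (snd p)) * (x \<xi> - x \<eta>)))"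
    by (subst sum.swap, intro sum.cong refl, rule sum.swap)
  also have "\<dots> = (\<Sum>\<xi>\<in>X. \<Sum>\<eta>\<in>X. c \<xi> * cnj (c \<eta>) * of_real ((cmod (dirichlet n (x \<xi> - x \<eta>)))\<^sup>2))"
    by (simp only: sum_distrib_left[symmetric] norm_dirichlet_sq[symmetric] case_prod_unfold)
  finally have eq: "of_real (\<Sum>(a, b)\<in>{..<n} \<times> {..<n}. (cmod (G (int a - int b)))\<^sup>2) = \<dots>" .
  have "(\<Sum>(a, b)\<in>{..<n} \<times> {..<n}. (cmod (G (int a - int b)))\<^sup>2)
      = cmod (of_real (\<Sum>(a, b)\<in>{..<n} \<times> {..<n}. (cmod (G (int a - int b)))\<^sup>2))"
    unfolding norm_of_real by (rule abs_of_nonneg[symmetric]) (auto intro!: sum_nonneg)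
  also have "\<dots> \<le> (\<Sum>\<xi>\<in>X. \<Sum>\<eta>\<in>X. cmod (c \<xi> * cnj (c \<eta>) * of_real ((cmod (dirichlet n (x \<xi> - x \<eta>)))\<^sup>2)))"
    unfolding eq by (rule sum_norm_le, rule sum_norm_le, rule order_refl)
  finally show ?thesis by (simp add: norm_mult norm_power)
qed

text \<open>Fejer weights: each l with |l| <= N is a difference of at least N + 1 pairs below 2 N +
  1, since the smaller entry may be any i <= N.\<close>

lemma sum_difference_le:
  fixes g :: "int \<Rightarrow> real"
  assumes "\<And>l. g l \<ge> 0"
  shows "real (N + 1) * (\<Sum>l\<in>{- int N..int N}. g l)
    \<le> (\<Sum>(a, b)\<in>{..<2 * N + 1} \<times> {..<2 * N + 1}. g (int a - int b))"
proof -
  define \<phi> where "\<phi> = (\<lambda>(i::nat, l::int). if l \<ge> 0 then (i + nat l, i) else (i, i + nat (- l)))"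
  have inj: "inj_on \<phi> ({..N} \<times> {- int N..int N})"
    by (auto simp: inj_on_def \<phi>_def split: if_splits)
  have "real (N + 1) * (\<Sum>l\<in>{- int N..int N}. g l) = (\<Sum>(i, l)\<in>{..N} \<times> {- int N..int N}. g l)"
    by (simp flip: sum.cartesian_product)
  also have "\<dots> = (\<Sum>p\<in>{..N} \<times> {- int N..int N}. (\<lambda>(a, b). g (int a - int b)) (\<phi> p))"
    by (intro sum.cong) (auto simp: \<phi>_def)
  also have "\<dots> = (\<Sum>(a, b)\<in>\<phi> ` ({..N} \<times> {- int N..int N}). g (int a - int b))"
    using inj by (simp add: sum.reindex)
  also have "\<dots> \<le> (\<Sum>(a, b)\<in>{..<2 * N + 1} \<times> {..<2 * N + 1}. g (int a - int b))"
    using assms by (intro sum_mono2) (auto simp: \<phi>_def split: if_splits)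
  finally show ?thesis .
qed

text \<open>After the Fejer expansion the kernel is bounded by a symmetric function of the bins with
  row sums at most 32, so Schur's test applies. As n <= 2 (N + 1), the quotient 32 n^2 / (N + 1) is
  at most 64 n.\<close>

lemma large_sieve_bins:
  fixes c :: "'a \<Rightarrow> complex" and x :: "'a \<Rightarrow> real" and N :: nat
  assumes "finite X"
  defines "n \<equiv> 2 * N + 1"
  shows "(\<Sum>l\<in>{- int N..int N}. (cmod (\<Sum>\<xi>\<in>X. c \<xi> * efun (of_int l * x \<xi>)))\<^sup>2)
    \<le> 64 * real n * (\<Sum>b<n. (\<Sum>\<xi> | \<xi> \<in> X \<and> bin n (x \<xi>) = b. cmod (c \<xi>))\<^sup>2)"
proof -
  have n: "n > 0" by (simp add: n_def)
  define A where "A = (\<lambda>b. \<Sum>\<xi> | \<xi> \<in> X \<and> bin n (x \<xi>) = b. cmod (c \<xi>))"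
  define W where "W = (\<lambda>b c. bin_weight (absdiff b c) + bin_weight (n - absdiff b c))"
  have A0: "A b \<ge> 0" for b unfolding A_def by (intro sum_nonneg) auto
  have W0: "W b d \<ge> 0" for b d by (simp add: W_def bin_weight_def)
  have Wc: "W b d = W d b" for b d by (simp add: W_def absdiff_commute)
  have gr: "(\<Sum>\<xi>\<in>X. g \<xi>) = (\<Sum>b<n. \<Sum>\<xi> | \<xi> \<in> X \<and> bin n (x \<xi>) = b. g \<xi>)" for g :: "'a \<Rightarrow> real"
    using bin_bounds(3)[OF n] assms by (intro sum.group[symmetric]) auto
  define S where "S = (\<Sum>l\<in>{- int N..int N}. (cmod (\<Sum>\<xi>\<in>X. c \<xi> * efun (of_int l * x \<xi>)))\<^sup>2)"
  have "real (N + 1) * S \<le> (\<Sum>\<xi>\<in>X. \<Sum>\<eta>\<in>X. cmod (c \<xi>) * cmod (c \<eta>) * (cmod (dirichlet n (x \<xi> - x \<eta>)))\<^sup>2)"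
    unfolding S_def n_def
    by (rule order_trans[OF sum_difference_le fejer_expansion]) (use assms in auto)
  also have "\<dots> \<le> (\<Sum>\<xi>\<in>X. \<Sum>\<eta>\<in>X. cmod (c \<xi>) * cmod (c \<eta>) * ((real n)\<^sup>2 * W (bin n (x \<xi>)) (bin n (x \<eta>))))"
    using dirichlet_bin_bound_sym[OF n] unfolding W_def dirichlet_frac
    by (intro sum_mono mult_left_mono) auto
  also have "\<dots> = (real n)\<^sup>2 * (\<Sum>\<xi>\<in>X. \<Sum>\<eta>\<in>X. cmod (c \<xi>) * cmod (c \<eta>) * W (bin n (x \<xi>)) (bin n (x \<eta>)))"
    by (simp add: sum_distrib_left mult_ac)
  also have "(\<Sum>\<xi>\<in>X. \<Sum>\<eta>\<in>X. cmod (c \<xi>) * cmod (c \<eta>) * W (bin n (x \<xi>)) (bin n (x \<eta>)))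
      = (\<Sum>b<n. \<Sum>d<n. A b * A d * W b d)"
  proof -
    have "(\<Sum>\<eta>\<in>X. cmod (c \<xi>) * cmod (c \<eta>) * W (bin n (x \<xi>)) (bin n (x \<eta>)))
       = cmod (c \<xi>) * (\<Sum>d<n. A d * W (bin n (x \<xi>)) d)" for \<xi>
      unfolding gr A_def by (simp add: sum_distrib_left sum_distrib_right mult_ac)
    then have "(\<Sum>\<xi>\<in>X. \<Sum>\<eta>\<in>X. cmod (c \<xi>) * cmod (c \<eta>) * W (bin n (x \<xi>)) (bin n (x \<eta>)))
       = (\<Sum>\<xi>\<in>X. cmod (c \<xi>) * (\<Sum>d<n. A d * W (bin n (x \<xi>)) d))" by simp
    also have "\<dots> = (\<Sum>b<n. A b * (\<Sum>d<n. A d * W b d))"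
      unfolding gr by (simp add: A_def sum_distrib_right)
    finally show ?thesis by (simp add: sum_distrib_left mult_ac)
  qed
  \<comment> \<open>Schur's test: the two halves agree by symmetry of \<open>W\<close>, and each is
    a row sum.\<close>
  also have "\<dots> \<le> (\<Sum>b<n. \<Sum>d<n. ((A b)\<^sup>2 / 2 + (A d)\<^sup>2 / 2) * W b d)"
    using W0 by (intro sum_mono mult_right_mono) (auto intro: order_trans[OF _ sum_squares_bound] simp: field_simps)
  also have "\<dots> = (\<Sum>b<n. \<Sum>d<n. (A b)\<^sup>2 / 2 * W b d) + (\<Sum>b<n. \<Sum>d<n. (A d)\<^sup>2 / 2 * W b d)"
    by (simp add: sum.distrib distrib_right)
  also have "(\<Sum>b<n. \<Sum>d<n. (A d)\<^sup>2 / 2 * W b d) = (\<Sum>b<n. \<Sum>d<n. (A b)\<^sup>2 / 2 * W b d)"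
    by (subst sum.swap) (simp add: Wc)
  also have "(\<Sum>b<n. \<Sum>d<n. (A b)\<^sup>2 / 2 * W b d) + (\<Sum>b<n. \<Sum>d<n. (A b)\<^sup>2 / 2 * W b d)
      = (\<Sum>b<n. (A b)\<^sup>2 * (\<Sum>d<n. W b d))"
    by (simp add: sum_distrib_left sum_distrib_right mult.commute flip: sum.distrib)
  finally have "real (N + 1) * S \<le> (real n)\<^sup>2 * (\<Sum>b<n. (A b)\<^sup>2 * (\<Sum>d<n. W b d))"
    by (simp add: mult_left_mono)
  also have "(\<Sum>b<n. (A b)\<^sup>2 * (\<Sum>d<n. W b d)) \<le> (\<Sum>b<n. (A b)\<^sup>2 * 32)"
    unfolding W_def by (intro sum_mono mult_left_mono sum_bin_kernel_le) auto
  also have "\<dots> = 32 * (\<Sum>b<n. (A b)\<^sup>2)" by (simp add: sum_distrib_left mult.commute)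
  finally have *: "real (N + 1) * S \<le> (real n)\<^sup>2 * (32 * (\<Sum>b<n. (A b)\<^sup>2))"
    by (simp add: mult_left_mono)
  have "real n \<le> 2 * real (N + 1)" by (simp add: n_def)
  then have "real n * S \<le> 2 * real (N + 1) * S"
    unfolding S_def by (intro mult_right_mono sum_nonneg) auto
  also have "\<dots> = 2 * (real (N + 1) * S)" by simp
  also have "\<dots> \<le> 2 * ((real n)\<^sup>2 * (32 * (\<Sum>b<n. (A b)\<^sup>2)))" using * by (rule mult_left_mono) simp
  also have "\<dots> = real n * (64 * real n * (\<Sum>b<n. (A b)\<^sup>2))"
    by (simp add: power2_eq_square[of "real n"])
  finally have "S \<le> 64 * real n * (\<Sum>b<n. (A b)\<^sup>2)" using n by simp
  then show ?thesis unfolding S_def A_def .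
qed

section \<open>Congruent squares\<close>

lemma card_residue_class_le:
  fixes X :: "int set" and q :: nat
  assumes "q > 0" "X \<subseteq> {lo..hi}" "lo \<le> hi" "\<And>x y. x \<in> X \<Longrightarrow> y \<in> X \<Longrightarrow> int q dvd x - y"
  shows "real (card X) \<le> 1 + real_of_int (hi - lo) / real q"
proof -
  have "inj_on (\<lambda>x. (x - lo) div int q) X"
  proof (rule inj_onI)
    fix x y assume xy: "x \<in> X" "y \<in> X" "(x - lo) div int q = (y - lo) div int q"
    have "int q dvd (x - lo) - (y - lo)" using assms(4)[OF xy(1,2)] by simp
    then have "(x - lo) mod int q = (y - lo) mod int q" by (simp add: mod_eq_dvd_iff)
    then have "x - lo = y - lo" using xy(3) by (metis div_mult_mod_eq)
    then show "x = y" by simp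
  qed
  moreover have "(\<lambda>x. (x - lo) div int q) ` X \<subseteq> {0..(hi - lo) div int q}"
    using assms(1) subsetD[OF assms(2)] by (auto intro!: zdiv_mono1 simp: pos_imp_zdiv_nonneg_iff)
  ultimately have "card X \<le> card {0..(hi - lo) div int q}"
    by (meson card_inj_on_le finite_atLeastAtMost_int)
  also have "\<dots> = nat ((hi - lo) div int q + 1)" by simp
  finally have A: "real (card X) \<le> real_of_int ((hi - lo) div int q + 1)"
    using assms(1,3) by (simp add: pos_imp_zdiv_nonneg_iff le_nat_iff)
  have "real_of_int ((hi - lo) div int q) \<le> real_of_int (hi - lo) / real q"
    by (metis of_int_of_nat_eq real_of_int_div4)
  then show ?thesis using A by simp
qed

text \<open>If \<open>a = gcd(x - y, g)\<close>, then \<open>x \<equiv> y\<close> modulo \<open>a\<close> and \<open>x \<equiv> - y\<close> modulo \<open>g/a\<close>, so \<open>a\<close>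
  determines \<open>x\<close> modulo \<open>lcm(a, g/a)\<close>.\<close>

lemma card_equal_squares_le:
  fixes V :: "int set" and g :: nat
  assumes g: "g > 0" and V: "V \<subseteq> {lo..hi}" "lo \<le> hi"
    and sq: "\<And>x. x \<in> V \<Longrightarrow> int g dvd x\<^sup>2 - y\<^sup>2"
  shows "real (card V) \<le> (\<Sum>a | a dvd g \<and> int (gcd a (g div a)) dvd 2 * y.
    1 + real_of_int (hi - lo) * real (gcd a (g div a)) / real g)"
proof -
  define A where "A = {a. a dvd g \<and> int (gcd a (g div a)) dvd 2 * y}"
  define W where "W = (\<lambda>a. {x \<in> V. gcd (x - y) (int g) = int a})"
  have fA: "finite A" unfolding A_def using g by simp
  have fV: "finite V" using V finite_subset by blast
  have cls: "int a dvd x - y \<and> int (g div a) dvd x + y \<and> a dvd g" if "x \<in> W a" for x a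
  proof -
    have gc: "gcd (x - y) (int g) = int a" and xV: "x \<in> V" using that by (auto simp: W_def)
    have a: "int a dvd x - y" "int a dvd int g" using gc by (metis gcd_dvd1, metis gcd_dvd2)
    then have ag: "a dvd g" by simp
    have a0: "int a \<noteq> 0" using ag g by auto
    have "int g dvd (x - y) * (x + y)"
      using sq[OF xV] by (simp add: power2_eq_square algebra_simps)
    then have "int g div int a dvd ((x - y) div int a) * (x + y)"
      using a a0 by (metis div_mult_swap dvd_div_iff_mult mult.commute dvd_mult2 div_dvd_div)
    moreover have "coprime ((x - y) div int a) (int g div int a)"
      using div_gcd_coprime[of "x - y" "int g"] g gc by simp
    ultimately have "int g div int a dvd x + y"
      by (metis coprime_commute coprime_dvd_mult_right_iff)
    then show ?thesis using a(1) ag by (simp add: zdiv_int)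
  qed
  have sub: "V \<subseteq> (\<Union>a\<in>A. W a)"
  proof
    fix x assume x: "x \<in> V"
    define a where "a = nat (gcd (x - y) (int g))"
    have xa: "x \<in> W a" using x by (simp add: W_def a_def)
    note c = cls[OF xa]
    \<comment> \<open>The gcd thus divides (x + y) - (x - y) = 2 y. This restriction on a is kept in
      the bound because it later ties the gcd to the square part of y.\<close>
    have "int (gcd a (g div a)) dvd x - y" "int (gcd a (g div a)) dvd x + y"
      using c by (meson dvd_trans gcd_dvd1 gcd_dvd2 of_nat_dvd_iff)+
    then have "int (gcd a (g div a)) dvd (x + y) - (x - y)" by (rule dvd_diff[rotated])
    then have "a \<in> A" using c by (simp add: A_def)
    then show "x \<in> (\<Union>a\<in>A. W a)" using xa by blast
  qed
  have "card V \<le> card (\<Union>a\<in>A. W a)"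
    using fA fV by (intro card_mono sub finite_UN_I) (auto simp: W_def)
  also have "\<dots> \<le> (\<Sum>a\<in>A. card (W a))" using fA by (rule card_UN_le)
  finally have "real (card V) \<le> (\<Sum>a\<in>A. real (card (W a)))" by (metis of_nat_mono of_nat_sum)
  also have "\<dots> \<le> (\<Sum>a\<in>A. 1 + real_of_int (hi - lo) * real (gcd a (g div a)) / real g)"
  proof (rule sum_mono)
    fix a assume "a \<in> A"
    then have ag: "a dvd g" by (simp add: A_def)
    \<comment> \<open>lcm(a, g/a) = g / gcd(a, g/a), the source of the gcd in the bound.\<close>
    define q where "q = lcm a (g div a)"
    have qg: "q * gcd a (g div a) = g" unfolding q_def using ag by (metis dvd_mult_div_cancel mult.commute prod_gcd_lcm_nat)
    then have q0: "q > 0" and s0: "gcd a (g div a) > 0" using g by (metis mult_0 gr0I, metis mult_0_right gr0I)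
    have "real (card (W a)) \<le> 1 + real_of_int (hi - lo) / real q"
    proof (rule card_residue_class_le[OF q0 _ V(2)])
      show "W a \<subseteq> {lo..hi}" using V by (auto simp: W_def)
      fix x x' assume x: "x \<in> W a" "x' \<in> W a"
      have "int a dvd (x - y) - (x' - y)" using cls[OF x(1)] cls[OF x(2)] dvd_diff by blast
      moreover have "int (g div a) dvd (x + y) - (x' + y)" using cls[OF x(1)] cls[OF x(2)] dvd_diff by blast
      ultimately show "int q dvd x - x'" unfolding q_def by (simp flip: lcm_int_int_eq)
    qed
    also have "real_of_int (hi - lo) / real q = real_of_int (hi - lo) * real (gcd a (g div a)) / real g"
    proof -
      have "real q * real (gcd a (g div a)) = real g" by (metis qg of_nat_mult)
      then show ?thesis using q0 g by (simp add: field_simps)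
    qed
    finally show "real (card (W a)) \<le> 1 + real_of_int (hi - lo) * real (gcd a (g div a)) / real g" .
  qed
  finally show ?thesis unfolding A_def .
qed

text \<open>If k^2 = j m modulo r with j a unit, then s | k and s^2 | r force s^2 | m, so s can be
  divided out of the whole congruence. Taking s largest leaves a root that admits no further
  division.\<close>

definition sqpart :: "nat \<Rightarrow> int \<Rightarrow> nat" where
  "sqpart r k = Max {t. t\<^sup>2 dvd r \<and> int t dvd k}"

lemma finite_square_divisors: "r > 0 \<Longrightarrow> finite {t::nat. t\<^sup>2 dvd r \<and> P t}"
proof (rule finite_subset[of _ "{..r}"])
  show "{t. t\<^sup>2 dvd r \<and> P t} \<subseteq> {..r}" if "r > 0"
    using that by (auto dest!: dvd_imp_le intro: order_trans[OF power2_nat_le_imp_le])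
qed simp

lemma sqpart_mem:
  assumes "r > 0"
  shows "(sqpart r k)\<^sup>2 dvd r" "int (sqpart r k) dvd k" "sqpart r k > 0"
proof -
  have "sqpart r k \<in> {t. t\<^sup>2 dvd r \<and> int t dvd k}"
    unfolding sqpart_def using finite_square_divisors[OF assms]
    by (intro Max_in) (auto intro!: exI[of _ 1])
  then show "(sqpart r k)\<^sup>2 dvd r" "int (sqpart r k) dvd k" by auto
  then show "sqpart r k > 0" using assms by (cases "sqpart r k = 0") auto
qed

lemma sqpart_ge:
  assumes "r > 0" "t\<^sup>2 dvd r" "int t dvd k"
  shows "t \<le> sqpart r k"
  unfolding sqpart_def using finite_square_divisors[OF assms(1)] assms by (intro Max_ge) auto

text \<open>The factor 2 pays for even s, where only s/2 is known to divide k.\<close>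

lemma le_two_sqpart:
  assumes r: "r > 0" and s: "s\<^sup>2 dvd r" "int s dvd 2 * k"
  shows "s \<le> 2 * sqpart r k"
proof (cases "even s")
  case True
  then obtain t where t: "s = 2 * t" by auto
  have "t\<^sup>2 dvd r" using s(1) t by (metis dvd_mult_right power_mult_distrib)
  moreover have "int t dvd k" using s(2) t by simp
  ultimately show ?thesis using sqpart_ge[OF r] t by simp
next
  case False
  then have "coprime (int s) 2" by simp
  then have "int s dvd k" using s(2) by (simp add: coprime_dvd_mult_right_iff)
  then show ?thesis using sqpart_ge[OF r s(1)] by fastforce
qed

text \<open>The square of gcd(a, g/a) divides r and the gcd divides 2 y, so it is at most 2 w; then
  1 + 2 e w <= 3 e w. The parameter e allows congruences modulo r/e only, which is what remains
  after cancelling a factor from modulus r.\<close>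

lemma card_equal_squares_sqpart_le:
  fixes V :: "int set"
  assumes r: "r > 0" and e: "e dvd r" and V: "V \<subseteq> {0..<int r}" and w: "w > 0"
    and sp: "\<And>x. x \<in> V \<Longrightarrow> sqpart r x \<le> w"
    and sq: "\<And>x y. x \<in> V \<Longrightarrow> y \<in> V \<Longrightarrow> int (r div e) dvd x\<^sup>2 - y\<^sup>2"
  shows "card V \<le> 3 * e * w * card {d. d dvd r}"
proof (cases "V = {}")
  case False
  then obtain y where y: "y \<in> V" by blast
  define g where "g = r div e"
  have ge: "g * e = r" using e by (simp add: g_def)
  then have g0: "g > 0" and e0: "e > 0" using r by (metis mult_0 gr0I, metis mult_0_right gr0I)
  have "V \<subseteq> {0..int r - 1}" using V by auto
  then have "real (card V) \<le> (\<Sum>a | a dvd g \<and> int (gcd a (g div a)) dvd 2 * y.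
      1 + real_of_int (int r - 1 - 0) * real (gcd a (g div a)) / real g)"
    using g0 r sq y by (intro card_equal_squares_le) (auto simp: g_def)
  also have "\<dots> \<le> (\<Sum>a | a dvd g \<and> int (gcd a (g div a)) dvd 2 * y. real (3 * e * w))"
  proof (rule sum_mono, clarify)
    fix a assume a: "a dvd g" "int (gcd a (g div a)) dvd 2 * y"
    have "(gcd a (g div a))\<^sup>2 dvd a * (g div a)" by (simp add: power2_eq_square mult_dvd_mono)
    then have "(gcd a (g div a))\<^sup>2 dvd r" using a(1) ge by (metis dvd_mult_div_cancel dvd_mult2)
    then have "gcd a (g div a) \<le> 2 * w" using le_two_sqpart[OF r _ a(2)] sp[OF y] by linarith
    then have s: "real (gcd a (g div a)) \<le> 2 * real w" by linarith
    have "real_of_int (int r - 1 - 0) * real (gcd a (g div a)) / real g \<le> real r * (2 * real w) / real g"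
      using s r by (intro divide_right_mono mult_mono) auto
    also have "\<dots> = 2 * real (e * w)" using g0 by (simp add: mult_ac flip: ge)
    finally have "real_of_int (int r - 1 - 0) * real (gcd a (g div a)) / real g \<le> 2 * real (e * w)" .
    moreover have "e * w \<ge> 1" using e0 w by (simp add: Suc_leI)
    then have "1 \<le> real (e * w)" by linarith
    moreover have "real (3 * e * w) = 3 * real (e * w)" by simp
    ultimately show "1 + real_of_int (int r - 1 - 0) * real (gcd a (g div a)) / real g \<le> real (3 * e * w)"
      by linarith
  qed
  also have "\<dots> = real (card {a. a dvd g \<and> int (gcd a (g div a)) dvd 2 * y} * (3 * e * w))" by simp
  also have "\<dots> \<le> real (card {d. d dvd r} * (3 * e * w))"
    unfolding of_nat_le_iff using r ge by (intro mult_right_mono card_mono) (auto dest: dvd_mult2)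
  finally have "card V \<le> card {d. d dvd r} * (3 * e * w)" unfolding of_nat_le_iff .
  then show ?thesis by (simp add: mult_ac)
qed simp

section \<open>Points of a lattice on a parabola\<close>

lemma card_bounded_differences_le:
  fixes X :: "int set" and B :: real
  assumes "finite X" "B \<ge> 0" "\<And>x y. x \<in> X \<Longrightarrow> y \<in> X \<Longrightarrow> real_of_int (x - y) \<le> B"
    and "q > 0" "\<And>x y. x \<in> X \<Longrightarrow> y \<in> X \<Longrightarrow> int q dvd x - y"
  shows "real (card X) \<le> 1 + B / real q"
proof (cases "X = {}")
  case False
  have m: "Min X \<in> X" "Max X \<in> X" using assms(1) False by auto
  have "real (card X) \<le> 1 + real_of_int (Max X - Min X) / real q"
    using assms False m by (intro card_residue_class_le) auto
  moreover have "real_of_int (Max X - Min X) / real q \<le> B / real q"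
    using assms m by (intro divide_right_mono) auto
  ultimately show ?thesis by linarith
qed (use assms in simp)

text \<open>The parameter t along the line takes at most 1 + B values. It determines S and h^2; the
  sign of h costs the factor 2.\<close>

lemma card_line_points_le:
  fixes Y :: "(int \<times> int) set" and B :: real
  assumes Y: "finite Y" and B: "B \<ge> 0" and nz: "(g, D) \<noteq> (0, 0)"
    and t: "\<And>h S h' S'. (h, S) \<in> Y \<Longrightarrow> (h', S') \<in> Y \<Longrightarrow>
      \<exists>t::int. h\<^sup>2 - h'\<^sup>2 = t * g \<and> S - S' = t * D \<and> \<bar>real_of_int t\<bar> \<le> B"
  shows "real (card Y) \<le> 2 * (1 + B)"
proof (cases "Y = {}")
  case False
  then obtain h0 S0 where p0: "(h0, S0) \<in> Y" by auto
  have "\<forall>p\<in>Y. \<exists>t::int. (fst p)\<^sup>2 - h0\<^sup>2 = t * g \<and> snd p - S0 = t * D"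
    using t[OF _ p0] by fastforce
  then obtain \<tau> :: "int \<times> int \<Rightarrow> int" where
    \<tau>: "\<And>p. p \<in> Y \<Longrightarrow> (fst p)\<^sup>2 - h0\<^sup>2 = \<tau> p * g \<and> snd p - S0 = \<tau> p * D"
    by metis
  have "inj_on (\<lambda>p. (\<tau> p, fst p \<ge> 0)) Y"
  proof (rule inj_onI)
    fix p q assume pq: "p \<in> Y" "q \<in> Y" "(\<tau> p, fst p \<ge> 0) = (\<tau> q, fst q \<ge> 0)"
    then have "(fst p)\<^sup>2 = (fst q)\<^sup>2" "snd p = snd q"
      using \<tau>[OF pq(1)] \<tau>[OF pq(2)] by auto
    moreover from this(1) have "fst p = fst q" using pq(3) by (auto simp: power2_eq_iff)
    ultimately show "p = q" by (simp add: prod_eq_iff)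
  qed
  then have "card Y \<le> card (\<tau> ` Y \<times> (UNIV :: bool set))"
    using Y by (intro card_inj_on_le) auto
  then have "real (card Y) \<le> 2 * real (card (\<tau> ` Y))"
    by (simp add: card_cartesian_product flip: of_nat_le_iff)
  also have "real (card (\<tau> ` Y)) \<le> 1 + B / real 1"
  proof (rule card_bounded_differences_le)
    fix x y assume "x \<in> \<tau> ` Y" "y \<in> \<tau> ` Y"
    then obtain p q where pq: "p \<in> Y" "q \<in> Y" "x = \<tau> p" "y = \<tau> q" by auto
    obtain u where u: "(fst p)\<^sup>2 - (fst q)\<^sup>2 = u * g" "snd p - snd q = u * D" "\<bar>real_of_int u\<bar> \<le> B"
      using t[of "fst p" "snd p" "fst q" "snd q"] pq by auto
    have "(x - y) * g = u * g" "(x - y) * D = u * D"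
      using u(1,2) \<tau>[OF pq(1)] \<tau>[OF pq(2)] pq by (auto simp: algebra_simps)
    then have "x - y = u" using nz by auto
    then show "real_of_int (x - y) \<le> B" using u(3) by linarith
  qed (use Y B in auto)
  finally show ?thesis by simp
qed (use B in simp)

text \<open>Subtracting the nearest integer multiple of (g, D) leaves a lattice vector of at most
  half its length, which minimality forces to vanish. The weights \<open>a\<close> and
  \<open>b\<close> define the sup norm in use.\<close>

lemma minimal_vector_generates:
  fixes \<Lambda> :: "(int \<times> int) set" and a b :: real
  assumes ab: "a > 0" "b > 0"
    and sub: "\<And>g D g' D' t. (g, D) \<in> \<Lambda> \<Longrightarrow> (g', D') \<in> \<Lambda> \<Longrightarrow> (g' - t * g, D' - t * D) \<in> \<Lambda>"
    and gD: "(g, D) \<in> \<Lambda>" "(g, D) \<noteq> (0, 0)"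
    and min: "\<And>g' D'. (g', D') \<in> \<Lambda> \<Longrightarrow> (g', D') \<noteq> (0, 0) \<Longrightarrow>
      max (\<bar>of_int g\<bar> * a) (\<bar>of_int D\<bar> * b) \<le> max (\<bar>of_int g'\<bar> * a) (\<bar>of_int D'\<bar> * b)"
    and par: "(g', D') \<in> \<Lambda>" "g * D' = g' * D"
  shows "\<exists>t. g' = t * g \<and> D' = t * D"
proof -
  have "\<exists>x::real. of_int g' = x * of_int g \<and> of_int D' = x * of_int D"
  proof (cases "D = 0")
    case True
    then have "D' = 0" "g \<noteq> 0" using gD par by auto
    then show ?thesis using True by (intro exI[of _ "of_int g' / of_int g"]) auto
  next
    case False
    have "real_of_int g * of_int D' = of_int g' * of_int D" using par(2) by (metis of_int_mult)
    then show ?thesis using False by (intro exI[of _ "of_int D' / of_int D"]) (auto simp: field_simps)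
  qed
  then obtain x :: real where x: "of_int g' = x * of_int g" "of_int D' = x * of_int D" by auto
  define t where "t = round x"
  have "\<bar>x - of_int t\<bar> \<le> 1 / 2"
    using of_int_round_abs_le[of x] unfolding t_def by (simp add: abs_minus_commute)
  then have h: "\<bar>x - of_int t\<bar> * \<bar>y\<bar> \<le> \<bar>y\<bar> / 2" for y :: real
    using mult_right_mono[of "\<bar>x - of_int t\<bar>" "1/2" "\<bar>y\<bar>"] by simp
  have 1: "\<bar>real_of_int (g' - t * g)\<bar> \<le> \<bar>of_int g\<bar> / 2" "\<bar>real_of_int (D' - t * D)\<bar> \<le> \<bar>of_int D\<bar> / 2"
    using h[of "of_int g"] h[of "of_int D"] x by (simp_all flip: abs_mult add: left_diff_distrib)
  define \<nu> where "\<nu> = max (\<bar>real_of_int g\<bar> * a) (\<bar>real_of_int D\<bar> * b)"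
  have "\<nu> > 0" using gD(2) ab unfolding \<nu>_def by (auto simp: less_max_iff_disj)
  have "\<bar>of_int (g' - t * g)\<bar> * a \<le> \<bar>of_int g\<bar> / 2 * a" "\<bar>of_int (D' - t * D)\<bar> * b \<le> \<bar>of_int D\<bar> / 2 * b"
    using 1 ab by (intro mult_right_mono; simp)+
  then have "max (\<bar>of_int (g' - t * g)\<bar> * a) (\<bar>of_int (D' - t * D)\<bar> * b) \<le> \<nu> / 2"
    unfolding \<nu>_def by (auto simp: max_def)
  then have "(g' - t * g, D' - t * D) = (0, 0)"
    using min[OF sub[OF gD(1) par(1)], of t] \<open>\<nu> > 0\<close> unfolding \<nu>_def[symmetric] by linarith
  then show ?thesis by auto
qed

lemma finite_int_box: "finite {(x::int, y::int). \<bar>of_int x\<bar> \<le> (A::real) \<and> \<bar>of_int y\<bar> \<le> (B::real)}"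
proof (rule finite_subset)
  show "{(x::int, y::int). \<bar>of_int x\<bar> \<le> A \<and> \<bar>of_int y\<bar> \<le> B} \<subseteq> {-\<lceil>A\<rceil>..\<lceil>A\<rceil>} \<times> {-\<lceil>B\<rceil>..\<lceil>B\<rceil>}"
    by auto linarith+
qed simp

text \<open>The points \<open>(h\<^sup>2, S)\<close> lie in a coset of a lattice of determinant \<open>r\<close>. They are covered by
  lines parallel to a shortest vector \<open>(g, D)\<close> of that lattice; the number of lines and the number
  of points on a line are both controlled by the length of that vector.\<close>

lemma card_quadratic_points_le:
  fixes Q :: "(int \<times> int) set" and H M :: real and r :: nat and v j :: int
  assumes r: "r > 0" and j: "coprime j (int r)" and M: "1 \<le> M" and Q: "finite Q"
    and hQ: "\<And>h S. (h, S) \<in> Q \<Longrightarrow> h \<noteq> 0 \<and> \<bar>of_int h\<bar> \<le> H \<and> 0 \<le> S \<and> of_int S \<le> 2 * M \<and> gcd v (int r) dvd h"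
    and dQ: "\<And>h S h' S'. (h, S) \<in> Q \<Longrightarrow> (h', S') \<in> Q \<Longrightarrow> int r dvd 2 * (S - S') * v\<^sup>2 - j * (h\<^sup>2 - h'\<^sup>2)"
  defines "w \<equiv> sqpart r v"
  shows "real (card Q) \<le> 2 + 32 * H\<^sup>2 * M / real r \<or>
    (\<exists>g D. g \<noteq> 0 \<and> D \<noteq> 0 \<and> \<bar>of_int g\<bar> * real (w\<^sup>2) \<le> H\<^sup>2 \<and> \<bar>of_int D\<bar> \<le> 2 * M \<and>
      int r dvd 2 * D * v\<^sup>2 - j * (g * int (w\<^sup>2)) \<and>
      real (card Q) \<le> 16 * H\<^sup>2 * M / real r + 8 * M / \<bar>of_int D\<bar> \<and>
      real (card Q) \<le> 16 * H\<^sup>2 * M / real r +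
        (\<Sum>a | a dvd nat \<bar>g\<bar>. 1 + 2 * H / real w * real (gcd a (nat \<bar>g\<bar> div a)) / \<bar>of_int g\<bar>))"
proof (cases "Q = {}")
  case False
  then obtain h0 S0 where p0: "(h0, S0) \<in> Q" by auto
  have H1: "H \<ge> 1" using hQ[OF p0] by linarith
  define E where "E = H\<^sup>2 * M / real r"
  have e: "32 * H\<^sup>2 * M / real r = 32 * E" "16 * H\<^sup>2 * M / real r = 16 * E"
    by (simp_all add: E_def)
  have E0: "E \<ge> 0" using M by (simp add: E_def)
  \<comment> \<open>The lattice is cut to the box containing all differences of points, so that a
    minimum exists. The weights in \<open>\<nu>\<close> give both half-sides of this box the same
    length 2 M H^2.\<close>
  define \<Lambda> where "\<Lambda> = {(g, D). int r dvd 2 * D * v\<^sup>2 - j * g \<and> \<bar>of_int g\<bar> \<le> H\<^sup>2 \<and> \<bar>of_int D\<bar> \<le> 2 * M}"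
  define \<nu> where "\<nu> = (\<lambda>(g::int, D::int). max (\<bar>of_int g\<bar> * (2 * M)) (\<bar>of_int D\<bar> * H\<^sup>2))"
  have finL: "finite \<Lambda>"
    using finite_int_box[of "H\<^sup>2" "2 * M"] by (rule finite_subset[rotated]) (auto simp: \<Lambda>_def)
  have hsq: "0 \<le> real_of_int (h\<^sup>2) \<and> real_of_int (h\<^sup>2) \<le> H\<^sup>2" if "(h, S) \<in> Q" for h S
    using hQ[OF that] power_mono[of "\<bar>of_int h\<bar>" H 2] by simp
  have diff: "(h\<^sup>2 - h'\<^sup>2, S - S') \<in> \<Lambda>" if "(h, S) \<in> Q" "(h', S') \<in> Q" for h S h' S'
  proof -
    have "\<bar>real_of_int (h\<^sup>2 - h'\<^sup>2)\<bar> \<le> H\<^sup>2" "\<bar>real_of_int (S - S')\<bar> \<le> 2 * M"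
      using hsq[OF that(1)] hsq[OF that(2)] hQ[OF that(1)] hQ[OF that(2)] unfolding of_int_diff by linarith+
    then show ?thesis using dQ[OF that] unfolding \<Lambda>_def by auto
  qed
  \<comment> \<open>Eliminating v^2 leaves j times the determinant, and j is a unit modulo
    r.\<close>
  have cross: "int r dvd g * D' - g' * D" if "(g, D) \<in> \<Lambda>" "(g', D') \<in> \<Lambda>" for g D g' D'
  proof -
    have "int r dvd (2 * D' * v\<^sup>2 - j * g') * D - (2 * D * v\<^sup>2 - j * g) * D'"
      by (rule dvd_diff[OF dvd_mult2 dvd_mult2]) (use that in \<open>auto simp: \<Lambda>_def\<close>)
    also have "\<dots> = j * (g * D' - g' * D)" by (simp add: algebra_simps)
    finally show ?thesis using j by (metis coprime_commute coprime_dvd_mult_right_iff)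
  qed
  show ?thesis
  proof (cases "\<Lambda> - {(0, 0)} = {}")
    case True
    have "real (card Q) \<le> 2 * (1 + 0)"
    proof (rule card_line_points_le[of Q 0 1 1])
      fix h S h' S' assume "(h, S) \<in> Q" "(h', S') \<in> Q"
      then have "(h\<^sup>2 - h'\<^sup>2, S - S') = (0, 0)" using diff True by blast
      then show "\<exists>t::int. h\<^sup>2 - h'\<^sup>2 = t * 1 \<and> S - S' = t * 1 \<and> \<bar>real_of_int t\<bar> \<le> 0"
        by (intro exI[of _ 0]) auto
    qed (use Q in auto)
    then have "real (card Q) \<le> 2" by simp
    then have "real (card Q) \<le> 2 + 32 * H\<^sup>2 * M / real r" unfolding e using E0 by linarith
    then show ?thesis ..
  next
    case False
    then obtain u where "is_arg_min \<nu> (\<lambda>x. x \<in> \<Lambda> - {(0, 0)}) u"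
      using ex_is_arg_min_if_finite[of "\<Lambda> - {(0, 0)}" \<nu>] finL by auto
    then obtain g D where gD: "(g, D) \<in> \<Lambda>" "(g, D) \<noteq> (0, 0)"
      and min: "\<And>g' D'. (g', D') \<in> \<Lambda> \<Longrightarrow> (g', D') \<noteq> (0, 0) \<Longrightarrow> \<nu> (g, D) \<le> \<nu> (g', D')"
      unfolding is_arg_min_linorder by (cases u) (metis Diff_iff empty_iff insert_iff)
    define n where "n = \<nu> (g, D)"
    have n: "n = max (\<bar>of_int g\<bar> * (2 * M)) (\<bar>of_int D\<bar> * H\<^sup>2)" by (simp add: n_def \<nu>_def)
    have n0: "n > 0" using gD(2) M H1 unfolding n by (auto simp: less_max_iff_disj)
    have gb: "\<bar>of_int g\<bar> \<le> H\<^sup>2" and Db: "\<bar>of_int D\<bar> \<le> 2 * M" using gD(1) by (auto simp: \<Lambda>_def)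
    have nle: "n \<le> 2 * M * H\<^sup>2"
      using mult_right_mono[OF gb, of "2 * M"] mult_right_mono[OF Db, of "H\<^sup>2"] M
      unfolding n by (simp add: mult_ac)
    have par: "\<exists>t. g' = t * g \<and> D' = t * D" if "(g', D') \<in> \<Lambda>" "g * D' = g' * D" for g' D'
    proof -
      \<comment> \<open>The box is not closed under subtraction, so the full lattice is needed here.
        Vectors outside the box have length at least 2 M H^2, hence at least that of (g, D).\<close>
      let ?L = "{(g, D). int r dvd 2 * D * v\<^sup>2 - j * g}"
      show ?thesis
      proof (rule minimal_vector_generates[where \<Lambda> = ?L and a = "2 * M" and b = "H\<^sup>2"])
        fix g1 D1 g2 D2 t assume "(g1, D1) \<in> ?L" "(g2, D2) \<in> ?L"
        then have "int r dvd (2 * D2 * v\<^sup>2 - j * g2) - t * (2 * D1 * v\<^sup>2 - j * g1)"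
          by (metis (no_types, lifting) case_prodD mem_Collect_eq dvd_diff dvd_mult)
        then show "(g2 - t * g1, D2 - t * D1) \<in> ?L" by (simp add: algebra_simps)
      next
        fix g2 D2 assume L: "(g2, D2) \<in> ?L" "(g2, D2) \<noteq> (0, 0)"
        show "max (\<bar>of_int g\<bar> * (2 * M)) (\<bar>of_int D\<bar> * H\<^sup>2) \<le> max (\<bar>of_int g2\<bar> * (2 * M)) (\<bar>of_int D2\<bar> * H\<^sup>2)"
        proof (cases "(g2, D2) \<in> \<Lambda>")
          case True
          then show ?thesis using min[OF True L(2)] by (simp add: \<nu>_def)
        next
          case False
          then have "H\<^sup>2 < \<bar>of_int g2\<bar> \<or> 2 * M < \<bar>of_int D2\<bar>" using L by (auto simp: \<Lambda>_def)
          then have "2 * M * H\<^sup>2 \<le> max (\<bar>of_int g2\<bar> * (2 * M)) (\<bar>of_int D2\<bar> * H\<^sup>2)"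
            using M H1 by (auto simp: le_max_iff_disj mult_ac)
          then show ?thesis using nle n by linarith
        qed
      qed (use that gD M H1 in \<open>auto simp: \<Lambda>_def\<close>)
    qed
    \<comment> \<open>The level sets of \<open>c\<close> are the lines of direction (g, D) in the
      (h^2, S) plane. By \<open>cross\<close> its values agree modulo r, and they spread over at
      most 2 n, so at most 1 + 2 n / r lines occur.\<close>
    define c where "c = (\<lambda>(h::int, S). g * S - D * h\<^sup>2)"
    define Y where "Y = (\<lambda>x. {p \<in> Q. c p = x})"
    have finY: "finite (Y x)" for x using Q by (simp add: Y_def)
    have on_line: "\<exists>t::int. h\<^sup>2 - h'\<^sup>2 = t * g \<and> S - S' = t * D \<and>
        \<bar>of_int t\<bar> * \<bar>of_int g\<bar> \<le> H\<^sup>2 \<and> \<bar>of_int t\<bar> * \<bar>of_int D\<bar> \<le> 2 * M"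
      if "(h, S) \<in> Y x" "(h', S') \<in> Y x" for h S h' S' x
    proof -
      have QQ: "(h, S) \<in> Q" "(h', S') \<in> Q" and cc: "c (h, S) = c (h', S')"
        using that by (auto simp: Y_def)
      have "g * (S - S') = (h\<^sup>2 - h'\<^sup>2) * D" using cc by (simp add: c_def algebra_simps)
      from par[OF diff[OF QQ] this] obtain t where t: "h\<^sup>2 - h'\<^sup>2 = t * g" "S - S' = t * D" by auto
      have "\<bar>real_of_int (t * g)\<bar> \<le> H\<^sup>2 \<and> \<bar>real_of_int (t * D)\<bar> \<le> 2 * M"
        using diff[OF QQ] unfolding t \<Lambda>_def by simp
      then show ?thesis using t by (auto simp: abs_mult)
    qed
    have line_n: "real (card (Y x)) \<le> 2 * (1 + 2 * M * H\<^sup>2 / n)" for x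
    proof (rule card_line_points_le[OF finY _ gD(2)])
      fix h S h' S' assume "(h, S) \<in> Y x" "(h', S') \<in> Y x"
      from on_line[OF this] obtain t where t: "h\<^sup>2 - h'\<^sup>2 = t * g" "S - S' = t * D"
        "\<bar>of_int t\<bar> * \<bar>of_int g\<bar> \<le> H\<^sup>2" "\<bar>of_int t\<bar> * \<bar>of_int D\<bar> \<le> 2 * M" by auto
      have "\<bar>of_int t\<bar> * n \<le> 2 * M * H\<^sup>2"
        using mult_right_mono[OF t(3), of "2 * M"] mult_right_mono[OF t(4), of "H\<^sup>2"] M
        unfolding n by (auto simp: max_def mult_ac)
      then show "\<exists>t::int. h\<^sup>2 - h'\<^sup>2 = t * g \<and> S - S' = t * D \<and> \<bar>real_of_int t\<bar> \<le> 2 * M * H\<^sup>2 / n"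
        using t n0 by (intro exI[of _ t]) (auto simp: pos_le_divide_eq)
    qed (use n0 M in auto)
    have line_D: "real (card (Y x)) \<le> 8 * M / \<bar>of_int D\<bar>" if "D \<noteq> 0" for x
    proof -
      have "real (card (Y x)) \<le> 2 * (1 + 2 * M / \<bar>of_int D\<bar>)"
      proof (rule card_line_points_le[OF finY _ gD(2)])
        fix h S h' S' assume "(h, S) \<in> Y x" "(h', S') \<in> Y x"
        from on_line[OF this] show "\<exists>t::int. h\<^sup>2 - h'\<^sup>2 = t * g \<and> S - S' = t * D \<and> \<bar>real_of_int t\<bar> \<le> 2 * M / \<bar>of_int D\<bar>"
          using that by (auto simp: pos_le_divide_eq)
      qed (use M in auto)
      moreover have "1 \<le> 2 * M / \<bar>of_int D\<bar>" using Db that by (simp add: pos_le_divide_eq)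
      ultimately have "real (card (Y x)) \<le> 4 * (2 * M / \<bar>of_int D\<bar>)" by argo
      then show ?thesis by simp
    qed
    have line_g: "real (card (Y x)) \<le> 4 * H\<^sup>2 / \<bar>of_int g\<bar>" if "g \<noteq> 0" for x
    proof -
      have "real (card (Y x)) \<le> 2 * (1 + H\<^sup>2 / \<bar>of_int g\<bar>)"
      proof (rule card_line_points_le[OF finY _ gD(2)])
        fix h S h' S' assume "(h, S) \<in> Y x" "(h', S') \<in> Y x"
        from on_line[OF this] show "\<exists>t::int. h\<^sup>2 - h'\<^sup>2 = t * g \<and> S - S' = t * D \<and> \<bar>real_of_int t\<bar> \<le> H\<^sup>2 / \<bar>of_int g\<bar>"
          using that by (auto simp: pos_le_divide_eq)
      qed auto
      moreover have "1 \<le> H\<^sup>2 / \<bar>of_int g\<bar>" using gb that by (simp add: pos_le_divide_eq)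
      ultimately have "real (card (Y x)) \<le> 4 * (H\<^sup>2 / \<bar>of_int g\<bar>)" by argo
      then show ?thesis by simp
    qed
    define C where "C = c ` Q"
    have C: "finite C" "C \<noteq> {}" using Q \<open>Q \<noteq> {}\<close> by (auto simp: C_def)
    have cardC: "real (card C) \<le> 1 + 2 * n / real r"
    proof (rule card_bounded_differences_le[OF C(1)])
      fix x y assume "x \<in> C" "y \<in> C"
      then obtain h S h' S' where p: "(h, S) \<in> Q" "(h', S') \<in> Q" "x = c (h, S)" "y = c (h', S')"
        by (auto simp: C_def)
      have xy: "x - y = g * (S - S') - (h\<^sup>2 - h'\<^sup>2) * D"
        unfolding p by (simp add: c_def algebra_simps)
      show "int r dvd x - y" unfolding xy by (rule cross[OF gD(1) diff[OF p(1,2)]])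
      have "\<bar>real_of_int (S - S')\<bar> \<le> 2 * M" "\<bar>real_of_int (h\<^sup>2 - h'\<^sup>2)\<bar> \<le> H\<^sup>2"
        using diff[OF p(1,2)] by (auto simp: \<Lambda>_def)
      then have "\<bar>of_int g\<bar> * \<bar>real_of_int (S - S')\<bar> \<le> n" "\<bar>real_of_int (h\<^sup>2 - h'\<^sup>2)\<bar> * \<bar>of_int D\<bar> \<le> n"
        unfolding n by (auto simp: le_max_iff_disj mult.commute[of _ "\<bar>of_int D\<bar>"] intro: mult_left_mono)
      then have "\<bar>real_of_int (g * (S - S'))\<bar> \<le> n" "\<bar>real_of_int ((h\<^sup>2 - h'\<^sup>2) * D)\<bar> \<le> n"
        unfolding of_int_mult abs_mult by auto
      then show "real_of_int (x - y) \<le> 2 * n" unfolding xy of_int_diff[of "g * (S - S')"] by linarith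
    qed (use n0 r in auto)
    \<comment> \<open>With X points on the fullest line, the total is at most X + X (2 n / r). Since
      X is O(M H^2 / n), the length n cancels in the second term, and only X itself remains to be
      studied.\<close>
    define X where "X = Max ((\<lambda>x. card (Y x)) ` C)"
    have "X \<in> (\<lambda>x. card (Y x)) ` C" unfolding X_def using C by (intro Max_in) auto
    then obtain x where x: "x \<in> C" "X = card (Y x)" by auto
    have "card Q = (\<Sum>x\<in>C. card (Y x))"
      unfolding Y_def C_def using sum.image_gen[OF Q, of "\<lambda>_. 1::nat" c] by simp
    also have "\<dots> \<le> (\<Sum>x\<in>C. X)" unfolding X_def using C by (intro sum_mono Max_ge) auto
    finally have "real (card Q) \<le> real (card C * X)" by (subst of_nat_le_iff) simp
    also have "\<dots> \<le> (1 + 2 * n / real r) * real X"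
      unfolding of_nat_mult using cardC by (intro mult_right_mono) auto
    also have "\<dots> = real X + real X * (2 * n / real r)" by (simp add: algebra_simps)
    also have "real X * (2 * n / real r) \<le> (8 * M * H\<^sup>2 / n) * (2 * n / real r)"
    proof (rule mult_right_mono)
      have "1 \<le> 2 * M * H\<^sup>2 / n" using nle n0 by (simp add: pos_le_divide_eq)
      then have "real X \<le> 4 * (2 * M * H\<^sup>2 / n)" using line_n[of x] unfolding x by argo
      then show "real X \<le> 8 * M * H\<^sup>2 / n" by simp
    qed (use n0 in auto)
    also have "\<dots> = 16 * H\<^sup>2 * M / real r" using n0 by simp
    finally have QX: "real (card Q) \<le> real X + 16 * H\<^sup>2 * M / real r" by simp
    have wr: "w\<^sup>2 dvd r" "int w dvd v" "w > 0" using sqpart_mem[OF r] by (auto simp: w_def)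
    have rg: "int r dvd 2 * D * v\<^sup>2 - j * g" using gD(1) by (simp add: \<Lambda>_def)
    consider "g = 0" | "D = 0" "g \<noteq> 0" | "g \<noteq> 0" "D \<noteq> 0" by blast
    then show ?thesis
    proof cases
      case 1
      have D0: "D \<noteq> 0" using 1 gD(2) by auto
      \<comment> \<open>For the vector (0, D), squaring a Bezout relation turns r | 2 D v^2 into r |
        2 D d^2. As d divides the nonzero h0, it is at most H, so r <= 2 |D| H^2 and D is large
        enough for a line to carry only O(H^2 M / r) points.\<close>
      define d where "d = gcd v (int r)"
      have "int r dvd 2 * D * v\<^sup>2" using rg 1 by simp
      moreover have "int r dvd 2 * D * (v * int r)" "int r dvd 2 * D * (int r)\<^sup>2"
        by (auto simp: power2_eq_square)
      moreover obtain a b where ab: "a * v + b * int r = d" using bezout_int d_def by metis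
      have "2 * D * d\<^sup>2 = a\<^sup>2 * (2 * D * v\<^sup>2) + 2 * a * b * (2 * D * (v * int r)) + b\<^sup>2 * (2 * D * (int r)\<^sup>2)"
        unfolding ab[symmetric] by (simp add: power2_eq_square algebra_simps)
      ultimately have "int r dvd 2 * D * d\<^sup>2" by (metis dvd_add dvd_mult)
      moreover have d0: "d \<noteq> 0" using r by (simp add: d_def)
      ultimately have "\<bar>int r\<bar> \<le> \<bar>2 * D * d\<^sup>2\<bar>" using D0 by (intro dvd_imp_le_int) auto
      then have "real r \<le> real_of_int \<bar>2 * D * d\<^sup>2\<bar>" by linarith
      then have "real r \<le> 2 * \<bar>of_int D\<bar> * (real_of_int d)\<^sup>2" by (simp add: abs_mult)
      moreover have "d dvd h0" using hQ[OF p0] by (simp add: d_def)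
      then have "\<bar>d\<bar> \<le> \<bar>h0\<bar>" using hQ[OF p0] by (intro dvd_imp_le_int) auto
      then have "\<bar>real_of_int d\<bar> \<le> H" using hQ[OF p0] by linarith
      then have "(real_of_int d)\<^sup>2 \<le> H\<^sup>2" using power_mono[of "\<bar>real_of_int d\<bar>" H 2] by simp
      then have "2 * \<bar>of_int D\<bar> * (real_of_int d)\<^sup>2 \<le> 2 * \<bar>of_int D\<bar> * H\<^sup>2" by (intro mult_left_mono) auto
      ultimately have rD: "real r \<le> 2 * \<bar>of_int D\<bar> * H\<^sup>2" by linarith
      have "8 * M / \<bar>of_int D\<bar> \<le> 16 * H\<^sup>2 * M / real r"
        using mult_left_mono[OF rD, of "8 * M"] M D0 r by (simp add: field_simps)
      then have "real (card Q) \<le> 2 + 32 * H\<^sup>2 * M / real r"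
        using QX line_D[OF D0, of x] unfolding x e by linarith
      then show ?thesis ..
    next
      case 2
      \<comment> \<open>The vector (g, 0) has |g| >= r, so a line carries only O(H^2 / r)
        points.\<close>
      have "int r dvd g" using rg 2 j by (simp add: coprime_commute coprime_dvd_mult_right_iff)
      then have "int r \<le> \<bar>g\<bar>" using 2 by (intro dvd_imp_le_int[of g "int r", simplified]) auto
      then have rg: "real r \<le> \<bar>of_int g\<bar>" by linarith
      have "4 * H\<^sup>2 / \<bar>of_int g\<bar> \<le> 4 * H\<^sup>2 / real r" using rg r by (intro divide_left_mono) auto
      also have "\<dots> \<le> 16 * H\<^sup>2 * M / real r"
      proof (rule divide_right_mono)
        show "4 * H\<^sup>2 \<le> 16 * H\<^sup>2 * M"
          using mult_right_mono[OF M, of "H\<^sup>2"] zero_le_power2[of H] by argo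
      qed simp
      finally have "real (card Q) \<le> 2 + 32 * H\<^sup>2 * M / real r"
        using QX line_g[OF 2(2), of x] unfolding x e by linarith
      then show ?thesis ..
    next
      case 3
      \<comment> \<open>Both w^2 | g and w | h hold, so dividing by w shortens the interval to H/w
        and the modulus to g/w^2. The gain 1/w will pay for the factor w in the number of shifts
        v.\<close>
      have "int (w\<^sup>2) dvd v\<^sup>2" using wr(2) by simp
      moreover have "int (w\<^sup>2) dvd 2 * D * v\<^sup>2 - j * g" using rg wr(1) by (meson dvd_trans of_nat_dvd_iff)
      ultimately have "int (w\<^sup>2) dvd j * g"
        by (metis dvd_diff_right_iff dvd_mult dvd_minus_iff)
      moreover have "coprime (int (w\<^sup>2)) j" using j wr(1) by (meson coprime_commute coprime_divisors dvd_refl of_nat_dvd_iff)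
      ultimately have "int (w\<^sup>2) dvd g" by (simp add: coprime_dvd_mult_right_iff)
      then obtain g1 where g1: "g = g1 * int (w\<^sup>2)" by (metis dvdE mult.commute)
      have g10: "g1 \<noteq> 0" using 3 g1 by auto
      have wh: "int w dvd h" if "(h, S) \<in> Q" for h S
      proof -
        have "int w dvd int r" using wr(1) by (meson dvd_power dvd_trans of_nat_dvd_iff zero_less_numeral)
        then have "int w dvd gcd v (int r)" using wr(2) by simp
        then show ?thesis using hQ[OF that] by (meson dvd_trans)
      qed
      define b where "b = \<lfloor>H / real w\<rfloor>"
      have b0: "b \<ge> 0" using H1 by (simp add: b_def)
      define V where "V = (\<lambda>p. fst p div int w) ` Y x"
      have Ye: "Y x \<noteq> {}" using x(1) by (auto simp: Y_def C_def)
      then obtain h1 S1 where p1: "(h1, S1) \<in> Y x" by auto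
      have YQ: "(h, S) \<in> Q" if "(h, S) \<in> Y x" for h S using that by (auto simp: Y_def)
      have injV: "inj_on (\<lambda>p. fst p div int w) (Y x)"
      proof (rule inj_onI, clarify)
        fix h S h' S' assume p: "(h, S) \<in> Y x" "(h', S') \<in> Y x" "fst (h, S) div int w = fst (h', S') div int w"
        have "h = h'" using p(3) wh[OF YQ[OF p(1)]] wh[OF YQ[OF p(2)]] by (metis dvd_div_mult_self fst_conv)
        moreover obtain t where "h\<^sup>2 - h'\<^sup>2 = t * g" "S - S' = t * D" using on_line[OF p(1,2)] by auto
        ultimately show "h = h' \<and> S = S'" using 3 by auto
      qed
      have "real (card V) \<le> (\<Sum>a | a dvd nat \<bar>g1\<bar> \<and> int (gcd a (nat \<bar>g1\<bar> div a)) dvd 2 * (h1 div int w).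
          1 + real_of_int (b - (- b)) * real (gcd a (nat \<bar>g1\<bar> div a)) / real (nat \<bar>g1\<bar>))"
      proof (rule card_equal_squares_le)
        show "V \<subseteq> {- b..b}"
        proof
          fix y assume "y \<in> V"
          then obtain h S where p: "(h, S) \<in> Y x" "y = h div int w" by (auto simp: V_def)
          have hy: "h = y * int w" using wh[OF YQ[OF p(1)]] p(2) by simp
          have "\<bar>real_of_int h\<bar> \<le> H" using hQ[OF YQ[OF p(1)]] by simp
          then have "\<bar>real_of_int y\<bar> \<le> H / real w" unfolding hy using wr(3)
            by (simp add: abs_mult pos_le_divide_eq)
          then have "real_of_int \<bar>y\<bar> \<le> H / real w" by simp
          then have "\<bar>y\<bar> \<le> b" unfolding b_def by (simp add: le_floor_iff)
          then show "y \<in> {- b..b}" by auto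
        qed
        fix y assume "y \<in> V"
        then obtain h S where p: "(h, S) \<in> Y x" "y = h div int w" by (auto simp: V_def)
        have hy: "h = y * int w" using wh[OF YQ[OF p(1)]] p(2) by simp
        define z where "z = h1 div int w"
        have hz: "h1 = z * int w" using wh[OF YQ[OF p1]] z_def by simp
        obtain t where "h\<^sup>2 - h1\<^sup>2 = t * g" using on_line[OF p(1) p1] by auto
        then have "(y\<^sup>2 - z\<^sup>2) * int (w\<^sup>2) = (t * g1) * int (w\<^sup>2)"
          unfolding hy hz g1 by (simp add: power_mult_distrib algebra_simps)
        then have "y\<^sup>2 - z\<^sup>2 = t * g1" using wr(3) by simp
        then show "int (nat \<bar>g1\<bar>) dvd y\<^sup>2 - (h1 div int w)\<^sup>2" unfolding z_def by simp
      qed (use g10 b0 in auto)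
      \<comment> \<open>The divisibility of 2 z is dropped: the gcds will be controlled on average
        over g instead.\<close>
      also have "\<dots> \<le> (\<Sum>a | a dvd nat \<bar>g1\<bar>. 1 + 2 * H / real w * real (gcd a (nat \<bar>g1\<bar> div a)) / \<bar>of_int g1\<bar>)"
      proof (rule order_trans[OF sum_mono2 sum_mono])
        show "finite {a. a dvd nat \<bar>g1\<bar>}" using g10 by (intro finite_divisors_nat) simp
        fix a
        have le: "real_of_int (b - - b) \<le> 2 * H / real w" unfolding b_def by linarith
        have abs_g: "real (nat \<bar>g1\<bar>) = \<bar>of_int g1\<bar>" by simp
        show "1 + real_of_int (b - - b) * real (gcd a (nat \<bar>g1\<bar> div a)) / real (nat \<bar>g1\<bar>)
          \<le> 1 + 2 * H / real w * real (gcd a (nat \<bar>g1\<bar> div a)) / \<bar>of_int g1\<bar>"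
          unfolding abs_g by (intro add_left_mono divide_right_mono mult_right_mono le) auto
      qed (use g10 b0 in auto)
      finally have "real X \<le> (\<Sum>a | a dvd nat \<bar>g1\<bar>. 1 + 2 * H / real w * real (gcd a (nat \<bar>g1\<bar> div a)) / \<bar>of_int g1\<bar>)"
        unfolding V_def x using card_image[OF injV] by simp
      then have c1: "real (card Q) \<le> 16 * H\<^sup>2 * M / real r +
          (\<Sum>a | a dvd nat \<bar>g1\<bar>. 1 + 2 * H / real w * real (gcd a (nat \<bar>g1\<bar> div a)) / \<bar>of_int g1\<bar>)"
        using QX unfolding e by linarith
      have c2: "real (card Q) \<le> 16 * H\<^sup>2 * M / real r + 8 * M / \<bar>of_int D\<bar>"
        using QX line_D[OF 3(2), of x] unfolding x e by linarith
      have "\<bar>of_int g1\<bar> * real (w\<^sup>2) \<le> H\<^sup>2" using gb unfolding g1 by (simp add: abs_mult)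
      then show ?thesis using c1 c2 g10 3(2) Db rg unfolding g1 by blast
    qed
  qed
qed (use M in simp)

section \<open>Pairs of modular square roots\<close>

text \<open>Put g = a b and then a = d a', b = d b' with d = gcd(a, b). The summand becomes 1 / (d
  a' b'), with all three variables at most N.\<close>

lemma sum_gcd_divisors_le:
  "(\<Sum>g=1..N. (\<Sum>a | a dvd g. real (gcd a (g div a))) / real g) \<le> harm N ^ 3"
proof -
  have "(\<Sum>g=1..N. (\<Sum>a | a dvd g. real (gcd a (g div a))) / real g)
      = (\<Sum>(g, a)\<in>Sigma {1..N} (\<lambda>g. {a. a dvd g}). real (gcd a (g div a)) / real g)"
    by (subst sum.Sigma[symmetric]) (auto simp: sum_divide_distrib)
  also have "\<dots> = (\<Sum>(a, b)\<in>(\<lambda>(g, a). (a, g div a)) ` Sigma {1..N} (\<lambda>g. {a. a dvd g}). real (gcd a b) / (real a * real b))"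
  proof (subst sum.reindex)
    show "inj_on (\<lambda>(g, a). (a, g div a)) (Sigma {1..N} (\<lambda>g. {a. a dvd g}))"
      by (auto simp: inj_on_def)
  qed (auto intro!: sum.cong elim!: dvdE)
  also have "\<dots> \<le> (\<Sum>(a, b)\<in>{1..N} \<times> {1..N}. real (gcd a b) / (real a * real b))"
  proof (rule sum_mono2)
    show "(\<lambda>(g, a). (a, g div a)) ` Sigma {1..N} (\<lambda>g. {a. a dvd g}) \<subseteq> {1..N} \<times> {1..N}"
    proof clarify
      fix g a assume g: "g \<in> {1..N}" "a dvd g"
      have "a \<le> g" "g div a \<le> g" using g dvd_imp_le by auto
      moreover have "a \<noteq> 0" "g div a \<noteq> 0" using g by (auto elim!: dvdE)
      moreover have "g \<le> N" using g by simp
      ultimately have "a \<le> N" "g div a \<le> N" "a \<ge> 1" "g div a \<ge> 1" by linarith+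
      then show "a \<in> {1..N} \<and> g div a \<in> {1..N}" using g by (auto simp del: div_le_dividend)
    qed
  qed auto
  also have "\<dots> = (\<Sum>(d, a, b)\<in>(\<lambda>(a, b). (gcd a b, a div gcd a b, b div gcd a b)) ` ({1..N} \<times> {1..N}). 1 / (real d * real a * real b))"
  proof (subst sum.reindex)
    show "inj_on (\<lambda>(a, b). (gcd a b, a div gcd a b, b div gcd a b)) ({1..N} \<times> {1..N})"
      by (auto simp: inj_on_def) (metis dvd_mult_div_cancel gcd_dvd1, metis dvd_mult_div_cancel gcd_dvd2)
    have "real (gcd a b) / (real a * real b) = 1 / (real (gcd a b) * real (a div gcd a b) * real (b div gcd a b))"
      if "a \<ge> 1" for a b :: nat
    proof -
      define g y z where "g = gcd a b" and "y = a div gcd a b" and "z = b div gcd a b"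
      have "a = g * y" "b = g * z" by (simp_all add: g_def y_def z_def)
      then have "real a = real g * real y" "real b = real g * real z" by (metis of_nat_mult)+
      then have "real g / (real a * real b) = real g / ((real g * real y) * (real g * real z))" by (simp only:)
      moreover have "g > 0" using that by (simp add: g_def)
      ultimately have "real g / (real a * real b) = 1 / (real g * real y * real z)" by simp
      then show ?thesis by (simp only: g_def y_def z_def)
    qed
    then show "(\<Sum>(a, b)\<in>{1..N} \<times> {1..N}. real (gcd a b) / (real a * real b)) =
      sum ((\<lambda>(d, a, b). 1 / (real d * real a * real b)) \<circ> (\<lambda>(a, b). (gcd a b, a div gcd a b, b div gcd a b))) ({1..N} \<times> {1..N})"
      by (intro sum.cong) auto
  qed
  also have "\<dots> \<le> (\<Sum>(d, a, b)\<in>{1..N} \<times> {1..N} \<times> {1..N}. 1 / (real d * real a * real b))"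
  proof (rule sum_mono2)
    have "gcd a b \<le> N" "a div gcd a b \<ge> 1" if "1 \<le> a" "a \<le> N" for a b
      using that by (auto simp: div_greater_zero_iff Suc_le_eq gcd_le1_nat intro: le_trans[OF gcd_le1_nat])
    moreover have "b div gcd a b \<ge> 1" if "1 \<le> b" for a b :: nat
      using that by (auto simp: div_greater_zero_iff Suc_le_eq gcd_le2_nat)
    moreover have "x div y \<le> N" if "x \<le> N" for x y using that div_le_dividend le_trans by blast
    moreover have "gcd a b \<ge> 1" if "1 \<le> a" for a b :: nat using that by (simp add: Suc_le_eq)
    ultimately show "(\<lambda>(a, b). (gcd a b, a div gcd a b, b div gcd a b)) ` ({1..N} \<times> {1..N}) \<subseteq> {1..N} \<times> {1..N} \<times> {1..N}"
      by auto
  qed auto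
  also have "\<dots> = harm N ^ 3"
    unfolding harm_def power3_eq_cube sum_product sum.cartesian_product
    by (intro sum.reindex_bij_witness[of _ "\<lambda>((d, a), b). (d, a, b)" "\<lambda>(d, a, b). ((d, a), b)"])
      (auto simp: inverse_eq_divide)
  finally show ?thesis .
qed

text \<open>The gcd is at most the sum of its divisors e, all of which divide r. For fixed e,
  writing 2 D = e i turns e / D into 2 / i with i <= 2 N.\<close>

lemma sum_gcd_const_le:
  assumes "r > 0"
  shows "(\<Sum>D=1..N. real (gcd (2 * D) r) / real D) \<le> 2 * real (card {e. e dvd r}) * harm (2 * N)"
proof -
  have fin: "finite {e. e dvd r}" using assms by simp
  have "(\<Sum>D=1..N. real (gcd (2 * D) r) / real D) \<le> (\<Sum>D=1..N. \<Sum>e | e dvd r. if e dvd 2 * D then real e / real D else 0)"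
  proof (rule sum_mono)
    fix D :: nat
    have "real (gcd (2 * D) r) / real D = (\<Sum>e\<in>{gcd (2 * D) r}. if e dvd 2 * D then real e / real D else 0)" by simp
    also have "\<dots> \<le> (\<Sum>e | e dvd r. if e dvd 2 * D then real e / real D else 0)"
      using fin by (intro sum_mono2) auto
    finally show "real (gcd (2 * D) r) / real D \<le> \<dots>" .
  qed
  also have "\<dots> = (\<Sum>e | e dvd r. \<Sum>D=1..N. if e dvd 2 * D then real e / real D else 0)" by (rule sum.swap)
  also have "\<dots> \<le> (\<Sum>e | e dvd r. 2 * harm (2 * N))"
  proof (rule sum_mono)
    fix e assume "e \<in> {e. e dvd r}"
    then have e: "e > 0" using assms by (auto intro: Nat.gr0I)
    have "(\<Sum>D=1..N. if e dvd 2 * D then real e / real D else 0) = (\<Sum>D | D \<in> {1..N} \<and> e dvd 2 * D. 2 / real (2 * D div e))"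
      using e by (subst sum.inter_filter[symmetric]) (auto intro!: sum.cong simp: field_simps real_of_nat_div)
    also have "\<dots> = (\<Sum>i\<in>(\<lambda>D. 2 * D div e) ` {D \<in> {1..N}. e dvd 2 * D}. 2 / real i)"
    proof (subst sum.reindex)
      show "inj_on (\<lambda>D. 2 * D div e) {D \<in> {1..N}. e dvd 2 * D}"
        using e by (auto simp: inj_on_def)
    qed auto
    also have "\<dots> \<le> (\<Sum>i=1..2 * N. 2 / real i)"
    proof (rule sum_mono2)
      show "(\<lambda>D. 2 * D div e) ` {D \<in> {1..N}. e dvd 2 * D} \<subseteq> {1..2 * N}"
      proof clarify
        fix D assume D: "D \<in> {1..N}" "e dvd 2 * D"
        have "2 * D div e \<le> 2 * D" by (rule div_le_dividend)
        moreover have "2 * D div e \<noteq> 0" using D e dvd_imp_le[OF D(2)] by (auto simp: div_eq_0_iff)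
        moreover have "D \<le> N" using D by simp
        ultimately have "2 * D div e \<le> 2 * N" "2 * D div e \<ge> 1" by linarith+
        then show "2 * D div e \<in> {1..2 * N}" by simp
      qed
    qed auto
    also have "\<dots> = 2 * harm (2 * N)" by (simp add: harm_def sum_distrib_left inverse_eq_divide)
    finally show "(\<Sum>D=1..N. if e dvd 2 * D then real e / real D else 0) \<le> 2 * harm (2 * N)" .
  qed
  also have "\<dots> = 2 * real (card {e. e dvd r}) * harm (2 * N)" by simp
  finally show ?thesis .
qed

lemma sum_nat_abs:
  fixes f :: "nat \<Rightarrow> real"
  shows "(\<Sum>g\<in>{- int N..int N} - {0}. f (nat \<bar>g\<bar>)) = 2 * (\<Sum>g=1..N. f g)"
proof -
  have "(\<Sum>g\<in>{- int N..int N} - {0}. f (nat \<bar>g\<bar>)) = (\<Sum>g\<in>{1..int N} \<union> {- int N..-1}. f (nat \<bar>g\<bar>))"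
    by (intro sum.cong) auto
  also have "\<dots> = (\<Sum>g=1..int N. f (nat \<bar>g\<bar>)) + (\<Sum>g=- int N..-1. f (nat \<bar>g\<bar>))"
    by (rule sum.union_disjoint) auto
  also have "(\<Sum>g=1..int N. f (nat \<bar>g\<bar>)) = (\<Sum>g=1..N. f g)"
    by (rule sum.reindex_bij_witness[of _ int nat]) auto
  also have "(\<Sum>g=- int N..-1. f (nat \<bar>g\<bar>)) = (\<Sum>g=1..N. f g)"
    by (rule sum.reindex_bij_witness[of _ "\<lambda>n. - int n" "\<lambda>g. nat (- g)"]) auto
  finally show ?thesis by simp
qed

section \<open>Primitive roots, their pairs and shifts\<close>

definition prim_roots :: "nat \<Rightarrow> int \<Rightarrow> real \<Rightarrow> (int \<times> int) set" where
  "prim_roots r j M = {(k, m). 0 \<le> k \<and> k < int r \<and> 1 \<le> m \<and> of_int m \<le> M \<and>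
    int r dvd k\<^sup>2 - j * m \<and> sqpart r k = 1}"

text \<open>Excluding m = m' keeps h = m - m' nonzero for the lattice argument and, when M <= r,
  empties the shift 0.\<close>

definition close_pairs :: "nat \<Rightarrow> int \<Rightarrow> real \<Rightarrow> real \<Rightarrow> ((int \<times> int) \<times> (int \<times> int)) set" where
  "close_pairs r j M H = {((k, m), (k', m')). (k, m) \<in> prim_roots r j M \<and> (k', m') \<in> prim_roots r j M \<and>
    m \<noteq> m' \<and> \<bar>of_int (m - m')\<bar> \<le> H}"

text \<open>Its size is the n(u) of the overview, with the shift represented in 0, ..., r -
  1.\<close>

definition shifted_pairs :: "nat \<Rightarrow> int \<Rightarrow> real \<Rightarrow> real \<Rightarrow> int \<Rightarrow> ((int \<times> int) \<times> (int \<times> int)) set" where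
  "shifted_pairs r j M H v = {p \<in> close_pairs r j M H. (fst (fst p) - fst (snd p)) mod int r = v}"

lemma finite_prim_roots [simp]: "finite (prim_roots r j M)"
proof (rule finite_subset)
  show "prim_roots r j M \<subseteq> {0..int r} \<times> {1..\<lfloor>M\<rfloor>}" by (auto simp: prim_roots_def le_floor_iff)
qed simp

lemma finite_close_pairs [simp]: "finite (close_pairs r j M H)"
  by (rule finite_subset[of _ "prim_roots r j M \<times> prim_roots r j M"]) (auto simp: close_pairs_def)

lemma finite_shifted_pairs [simp]: "finite (shifted_pairs r j M H v)"
  by (simp add: shifted_pairs_def)

lemma card_prim_roots_fiber_le:
  assumes "r > 0"
  shows "card {k. (k, m) \<in> prim_roots r j M} \<le> 3 * card {d. d dvd r}"
proof -
  have "int r dvd x\<^sup>2 - y\<^sup>2" if "(x, m) \<in> prim_roots r j M" "(y, m) \<in> prim_roots r j M" for x y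
  proof -
    have "int r dvd (x\<^sup>2 - j * m) - (y\<^sup>2 - j * m)" by (rule dvd_diff) (use that in \<open>auto simp: prim_roots_def\<close>)
    then show ?thesis by simp
  qed
  then have "card {k. (k, m) \<in> prim_roots r j M} \<le> 3 * 1 * 1 * card {d. d dvd r}"
    using assms by (intro card_equal_squares_sqpart_le) (auto simp: prim_roots_def)
  then show ?thesis by simp
qed

lemma card_le_fibers:
  assumes "finite A" "\<And>y. y \<in> f ` A \<Longrightarrow> card {x \<in> A. f x = y} \<le> K"
  shows "card A \<le> K * card (f ` A)"
proof -
  have "card A = (\<Sum>y\<in>f ` A. card {x \<in> A. f x = y})"
    using sum.image_gen[OF assms(1), of "\<lambda>_. 1::nat" f] by simp
  also have "\<dots> \<le> (\<Sum>y\<in>f ` A. K)" by (intro sum_mono assms)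
  finally show ?thesis by (simp add: mult.commute)
qed

text \<open>18 = 3 * 3 * 2: at most 3 d(r) primitive roots for each of m and m', and two signs of m
  - m'.\<close>

lemma card_close_pairs_le:
  assumes r: "r > 0" and "M \<ge> 0" "H \<ge> 0"
  shows "real (card (close_pairs r j M H)) \<le> 18 * (real (card {d. d dvd r}))\<^sup>2 * (H * M)"
proof -
  define d where "d = card {d. d dvd r}"
  define f :: "(int \<times> int) \<times> (int \<times> int) \<Rightarrow> int \<times> int" where "f = (\<lambda>p. (snd (fst p), snd (snd p)))"
  have "card (close_pairs r j M H) \<le> (3 * d * (3 * d)) * card (f ` close_pairs r j M H)"
  proof (rule card_le_fibers)
    fix y
    define K where "K = (\<lambda>m. {k. (k, m) \<in> prim_roots r j M})"
    have fK: "finite (K m)" for m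
      by (rule finite_subset[of _ "fst ` prim_roots r j M"]) (force simp: K_def)+
    have "card {p \<in> close_pairs r j M H. f p = y} \<le> card (K (fst y) \<times> K (snd y))"
      by (rule card_inj_on_le[where f = "\<lambda>p. (fst (fst p), fst (snd p))"])
        (auto simp: inj_on_def f_def K_def close_pairs_def intro!: finite_cartesian_product fK[unfolded K_def])
    also have "\<dots> \<le> 3 * d * (3 * d)"
      unfolding card_cartesian_product K_def d_def by (intro mult_le_mono card_prim_roots_fiber_le r)
    finally show "card {p \<in> close_pairs r j M H. f p = y} \<le> 3 * d * (3 * d)" .
  qed simp
  also have "card (f ` close_pairs r j M H) \<le> card ({1..\<lfloor>M\<rfloor>} \<times> ({- \<lfloor>H\<rfloor>..\<lfloor>H\<rfloor>} - {0}))"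
  proof (rule card_inj_on_le[where f = "\<lambda>(m, m'). (m, m - m')"])
    show "(\<lambda>(m, m'). (m, m - m')) ` (f ` close_pairs r j M H) \<subseteq> {1..\<lfloor>M\<rfloor>} \<times> ({- \<lfloor>H\<rfloor>..\<lfloor>H\<rfloor>} - {0})"
    proof
      fix z assume "z \<in> (\<lambda>(m, m'). (m, m - m')) ` (f ` close_pairs r j M H)"
      then obtain k m k' m' where p: "((k, m), (k', m')) \<in> close_pairs r j M H" "z = (m, m - m')"
        by (auto simp: f_def)
      then have "1 \<le> m" "of_int m \<le> M" "m \<noteq> m'" "\<bar>of_int (m - m')\<bar> \<le> H"
        by (auto simp: close_pairs_def prim_roots_def)
      then have "m \<le> \<lfloor>M\<rfloor>" "\<bar>m - m'\<bar> \<le> \<lfloor>H\<rfloor>" by (auto simp: le_floor_iff)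
      then show "z \<in> {1..\<lfloor>M\<rfloor>} \<times> ({- \<lfloor>H\<rfloor>..\<lfloor>H\<rfloor>} - {0})"
        using \<open>1 \<le> m\<close> \<open>m \<noteq> m'\<close> p by auto
    qed
  qed (auto simp: inj_on_def split: prod.splits)
  also have "\<dots> = nat \<lfloor>M\<rfloor> * nat (2 * \<lfloor>H\<rfloor>)"
  proof -
    have f: "\<lfloor>H\<rfloor> \<ge> 0" using assms by simp
    then have "card ({- \<lfloor>H\<rfloor>..\<lfloor>H\<rfloor>} - {0}) = card {- \<lfloor>H\<rfloor>..\<lfloor>H\<rfloor>} - 1"
      by (intro card_Diff_singleton) auto
    also have "\<dots> = nat (2 * \<lfloor>H\<rfloor>)" using f unfolding card_atLeastAtMost_int by arith
    finally show ?thesis by (simp add: card_cartesian_product)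
  qed
  finally have "card (close_pairs r j M H) \<le> (3 * d * (3 * d)) * (nat \<lfloor>M\<rfloor> * nat (2 * \<lfloor>H\<rfloor>))" by simp
  then have "real (card (close_pairs r j M H)) \<le> real ((3 * d * (3 * d)) * (nat \<lfloor>M\<rfloor> * nat (2 * \<lfloor>H\<rfloor>)))"
    unfolding of_nat_le_iff .
  also have "\<dots> = 9 * (real d)\<^sup>2 * (real (nat \<lfloor>M\<rfloor>) * real (nat (2 * \<lfloor>H\<rfloor>)))" by (simp add: power2_eq_square)
  also have "\<dots> \<le> 9 * (real d)\<^sup>2 * (M * (2 * H))"
    using assms by (intro mult_left_mono mult_mono) (auto simp: le_nat_iff)
  finally show ?thesis by (simp add: d_def mult_ac)
qed

lemma sum_card_shifted_pairs:
  assumes "r > 0"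
  shows "(\<Sum>v\<in>{0..<int r}. card (shifted_pairs r j M H v)) = card (close_pairs r j M H)"
proof -
  have "(\<Sum>v\<in>{0..<int r}. \<Sum>p | p \<in> close_pairs r j M H \<and> (fst (fst p) - fst (snd p)) mod int r = v. 1::nat)
     = (\<Sum>p\<in>close_pairs r j M H. 1)"
    using assms by (intro sum.group) auto
  then show ?thesis by (simp add: shifted_pairs_def)
qed

definition diff_sum :: "(int \<times> int) \<times> (int \<times> int) \<Rightarrow> int \<times> int" where
  "diff_sum p = (snd (fst p) - snd (snd p), snd (fst p) + snd (snd p))"

text \<open>The point (h, S) fixes m and m'; then k has at most 3 d(r) values, and v fixes k' modulo
  r.\<close>

lemma card_shifted_pairs_le:
  assumes r: "r > 0"
  shows "card (shifted_pairs r j M H v) \<le> 3 * card {d. d dvd r} * card (diff_sum ` shifted_pairs r j M H v)"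
proof (rule card_le_fibers)
  fix y :: "int \<times> int"
  define m where "m = (fst y + snd y) div 2"
  have "card {p \<in> shifted_pairs r j M H v. diff_sum p = y} \<le> card {k. (k, m) \<in> prim_roots r j M}"
  proof (rule card_inj_on_le[where f = "\<lambda>p. fst (fst p)"])
    show "(\<lambda>p. fst (fst p)) ` {p \<in> shifted_pairs r j M H v. diff_sum p = y} \<subseteq> {k. (k, m) \<in> prim_roots r j M}"
      by (auto simp: m_def shifted_pairs_def close_pairs_def diff_sum_def)
    show "finite {k. (k, m) \<in> prim_roots r j M}"
      by (rule finite_subset[of _ "fst ` prim_roots r j M"]) force+
    show "inj_on (\<lambda>p. fst (fst p)) {p \<in> shifted_pairs r j M H v. diff_sum p = y}"
    proof (rule inj_onI)
      fix x z
      assume x: "x \<in> {p \<in> shifted_pairs r j M H v. diff_sum p = y}"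
        and z: "z \<in> {p \<in> shifted_pairs r j M H v. diff_sum p = y}" and k: "fst (fst x) = fst (fst z)"
      have m: "snd (fst x) = snd (fst z)" "snd (snd x) = snd (snd z)"
        using x z by (auto simp: diff_sum_def)
      have "(fst (fst x) - fst (snd x)) mod int r = (fst (fst z) - fst (snd z)) mod int r"
        using x z by (simp add: shifted_pairs_def)
      then have "int r dvd (fst (fst x) - fst (snd x)) - (fst (fst z) - fst (snd z))"
        by (simp only: mod_eq_dvd_iff)
      then have "int r dvd fst (snd z) - fst (snd x)" using k by simp
      moreover have "0 \<le> fst (snd x)" "fst (snd x) < int r" "0 \<le> fst (snd z)" "fst (snd z) < int r"
        using x z by (auto simp: shifted_pairs_def close_pairs_def prim_roots_def)
      ultimately have "fst (snd x) = fst (snd z)" by (metis mod_eq_dvd_iff mod_pos_pos_trivial)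
      then show "x = z" using m k by (simp add: prod_eq_iff)
    qed
  qed
  also have "\<dots> \<le> 3 * card {d. d dvd r}" by (rule card_prim_roots_fiber_le[OF r])
  finally show "card {p \<in> shifted_pairs r j M H v. diff_sum p = y} \<le> 3 * card {d. d dvd r}" .
qed simp

text \<open>The first is the difference of the two root congruences. For the second, (k - k')^2 + (k
  + k')^2 = 2 (k^2 + k'^2) is multiplied by v^2, which lets v (k + k') be replaced without dividing
  by v, possibly a non-unit. Between two points with the same v the term v^4 cancels, leaving the
  lattice congruence.\<close>

lemma shifted_pairs_cong:
  assumes j: "coprime j (int r)" and p: "((k, m), (k', m')) \<in> shifted_pairs r j M H v"
  shows "int r dvd v * (k + k') - j * (m - m')"
    and "int r dvd j * (2 * (m + m') * v\<^sup>2 - j * (m - m')\<^sup>2) - v ^ 4"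
proof -
  have 1: "[k\<^sup>2 = j * m] (mod int r)" "[k'\<^sup>2 = j * m'] (mod int r)"
    using p by (auto simp: shifted_pairs_def close_pairs_def prim_roots_def cong_iff_dvd_diff)
  have 2: "[v = k - k'] (mod int r)"
    using p by (auto simp: shifted_pairs_def cong_def)
  have 3: "[v * (k + k') = j * (m - m')] (mod int r)"
  proof -
    have "[v * (k + k') = (k - k') * (k + k')] (mod int r)" by (intro cong_mult 2 cong_refl)
    also have "(k - k') * (k + k') = k\<^sup>2 - k'\<^sup>2" by (simp add: power2_eq_square algebra_simps)
    also have "[k\<^sup>2 - k'\<^sup>2 = j * m - j * m'] (mod int r)" by (intro cong_diff 1)
    finally show ?thesis by (simp add: algebra_simps)
  qed
  then show "int r dvd v * (k + k') - j * (m - m')" by (simp add: cong_iff_dvd_diff)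
  have "[v\<^sup>2 + (k + k')\<^sup>2 = (k - k')\<^sup>2 + (k + k')\<^sup>2] (mod int r)"
    by (intro cong_add cong_pow 2 cong_refl)
  also have "(k - k')\<^sup>2 + (k + k')\<^sup>2 = 2 * (k\<^sup>2 + k'\<^sup>2)" by (simp add: power2_eq_square algebra_simps)
  also have "[2 * (k\<^sup>2 + k'\<^sup>2) = 2 * (j * m + j * m')] (mod int r)"
    by (intro cong_mult cong_add 1 cong_refl)
  finally have "[v\<^sup>2 * (v\<^sup>2 + (k + k')\<^sup>2) = v\<^sup>2 * (2 * (j * m + j * m'))] (mod int r)"
    by (intro cong_mult cong_refl)
  moreover have "v\<^sup>2 * (v\<^sup>2 + (k + k')\<^sup>2) = v ^ 4 + (v * (k + k'))\<^sup>2"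
    by (simp add: power2_eq_square power4_eq_xxxx algebra_simps)
  moreover have "[v ^ 4 + (v * (k + k'))\<^sup>2 = v ^ 4 + (j * (m - m'))\<^sup>2] (mod int r)"
    by (intro cong_add cong_pow 3 cong_refl)
  ultimately have "[v\<^sup>2 * (2 * (j * m + j * m')) = v ^ 4 + (j * (m - m'))\<^sup>2] (mod int r)"
    by (metis cong_sym cong_trans)
  then show "int r dvd j * (2 * (m + m') * v\<^sup>2 - j * (m - m')\<^sup>2) - v ^ 4"
    by (simp add: cong_iff_dvd_diff power2_eq_square algebra_simps)
qed

section \<open>The energy bound\<close>

text \<open>One number for all losses. Divisor counts are needed up to r^2 because |g| <= H^2 <=
  r^2, and 4 r^2 covers the harmonic sums over g (up to r^2) and over D (up to 4 r).\<close>

definition div_bound :: "nat \<Rightarrow> real \<Rightarrow> bool" where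
  "div_bound r B \<longleftrightarrow> 1 \<le> B \<and> (\<forall>n. 0 < n \<longrightarrow> n \<le> r\<^sup>2 \<longrightarrow> real (card {d. d dvd n}) \<le> B) \<and>
    harm (4 * r\<^sup>2) \<le> B"

text \<open>For a shift \<open>v\<close> admitting many solutions, the shortest vector \<open>(w\<^sup>2 g, D)\<close> of the associated
  lattice is short, and \<open>card_shifts_le\<close> shows that such shifts are rare.\<close>

lemma card_diff_sum_cases:
  fixes v :: int
  assumes r: "r > 0" and j: "coprime j (int r)" and M: "1 \<le> M" "M \<le> real r" and H: "0 < H" "H \<le> M"
    and B: "div_bound r B"
  defines "w \<equiv> sqpart r v"
  defines "q \<equiv> real (card (diff_sum ` shifted_pairs r j M H v))"
  shows "q \<le> 2 * B + 32 * (H\<^sup>2 * M / real r) \<or>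
    (\<exists>g D. g \<in> {- int (r\<^sup>2)..int (r\<^sup>2)} - {0} \<and> D \<in> {- int (2 * r)..int (2 * r)} - {0} \<and>
      int r dvd 2 * D * v\<^sup>2 - j * (g * int (w\<^sup>2)) \<and>
      q\<^sup>2 \<le> 64 * H * M / real w * ((\<Sum>a | a dvd nat \<bar>g\<bar>. real (gcd a (nat \<bar>g\<bar> div a))) / real (nat \<bar>g\<bar>))
        * (1 / real (nat \<bar>D\<bar>)))"
proof -
  let ?Q = "diff_sum ` shifted_pairs r j M H v"
  define E where "E = H\<^sup>2 * M / real r"
  have e: "2 + 32 * H\<^sup>2 * M / real r = 2 + 32 * E" "16 * H\<^sup>2 * M / real r = 16 * E"
    by (simp_all add: E_def)
  have E0: "E \<ge> 0" using M by (simp add: E_def)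
  have B1: "B \<ge> 1" and Bd: "\<And>n. 0 < n \<Longrightarrow> n \<le> r\<^sup>2 \<Longrightarrow> real (card {d. d dvd n}) \<le> B"
    using B by (auto simp: div_bound_def)
  have w0: "w > 0" using sqpart_mem[OF r] by (simp add: w_def)
  have 1: "h \<noteq> 0 \<and> \<bar>of_int h\<bar> \<le> H \<and> 0 \<le> S \<and> of_int S \<le> 2 * M \<and> gcd v (int r) dvd h" if "(h, S) \<in> ?Q" for h S
  proof -
    obtain k m k' m' where p: "((k, m), (k', m')) \<in> shifted_pairs r j M H v" "h = m - m'" "S = m + m'"
      using \<open>(h, S) \<in> ?Q\<close> by (auto simp: diff_sum_def)
    have "gcd v (int r) dvd v * (k + k') - j * h"
      using shifted_pairs_cong(1)[OF j p(1)] p(2) by (meson dvd_trans gcd_dvd2)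
    then have "gcd v (int r) dvd j * h" by (metis dvd_diff_right_iff dvd_mult2 gcd_dvd1)
    moreover have "coprime (gcd v (int r)) j" using j by (meson coprime_commute coprime_divisors dvd_refl gcd_dvd2)
    ultimately have "gcd v (int r) dvd h" by (simp add: coprime_dvd_mult_right_iff)
    then show ?thesis using p by (auto simp: shifted_pairs_def close_pairs_def prim_roots_def)
  qed
  have 2: "int r dvd 2 * (S - S') * v\<^sup>2 - j * (h\<^sup>2 - h'\<^sup>2)" if "(h, S) \<in> ?Q" "(h', S') \<in> ?Q" for h S h' S'
  proof -
    have *: "int r dvd j * (2 * S * v\<^sup>2 - j * h\<^sup>2) - v ^ 4" if "(h, S) \<in> ?Q" for h S
      using that shifted_pairs_cong(2)[OF j] by (auto simp: diff_sum_def)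
    have "int r dvd (j * (2 * S * v\<^sup>2 - j * h\<^sup>2) - v ^ 4) - (j * (2 * S' * v\<^sup>2 - j * h'\<^sup>2) - v ^ 4)"
      using *[OF that(1)] *[OF that(2)] by (rule dvd_diff)
    also have "\<dots> = j * (2 * (S - S') * v\<^sup>2 - j * (h\<^sup>2 - h'\<^sup>2))" by (simp add: algebra_simps)
    finally show ?thesis using j by (metis coprime_commute coprime_dvd_mult_right_iff)
  qed
  have fin: "finite ?Q" by simp
  from card_quadratic_points_le[OF r j M(1) fin 1 2]
  consider "q \<le> 2 + 32 * E" | g D where "g \<noteq> 0" "D \<noteq> 0" "\<bar>of_int g\<bar> * real (w\<^sup>2) \<le> H\<^sup>2" "\<bar>of_int D\<bar> \<le> 2 * M"
      "int r dvd 2 * D * v\<^sup>2 - j * (g * int (w\<^sup>2))" "q \<le> 16 * E + 8 * M / \<bar>of_int D\<bar>"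
      "q \<le> 16 * E + (\<Sum>a | a dvd nat \<bar>g\<bar>. 1 + 2 * H / real w * real (gcd a (nat \<bar>g\<bar> div a)) / \<bar>of_int g\<bar>)"
    unfolding e q_def w_def by blast
  then show ?thesis
  proof cases
    case 1
    then have "q \<le> 2 * B + 32 * E" using B1 by linarith
    then show ?thesis unfolding E_def ..
  next
    case 2
    define n where "n = nat \<bar>g\<bar>"
    have n: "real n = \<bar>of_int g\<bar>" "n > 0" using 2(1) by (auto simp: n_def)
    have "\<bar>of_int g\<bar> * 1 \<le> \<bar>of_int g\<bar> * real (w\<^sup>2)" using w0 by (intro mult_left_mono) (auto simp: Suc_le_eq)
    also have "\<dots> \<le> H\<^sup>2" by (rule 2(3))
    also have "\<dots> \<le> (real r)\<^sup>2" using M H by (intro power_mono) auto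
    finally have "real_of_int \<bar>g\<bar> \<le> real_of_int (int (r\<^sup>2))" by simp
    then have gr: "\<bar>g\<bar> \<le> int (r\<^sup>2)" unfolding of_int_le_iff .
    then have "n \<le> r\<^sup>2" unfolding n_def by linarith
    then have dn: "real (card {a. a dvd n}) \<le> B" using Bd n(2) by blast
    have "real_of_int \<bar>D\<bar> \<le> real_of_int (int (2 * r))" using 2(4) M by simp
    then have Dr: "\<bar>D\<bar> \<le> int (2 * r)" unfolding of_int_le_iff .
    define X where "X = 2 * H / real w * ((\<Sum>a | a dvd n. real (gcd a (n div a))) / real n)"
    define Z where "Z = 8 * M / \<bar>real_of_int D\<bar>"
    have XZ0: "X \<ge> 0" "Z \<ge> 0" unfolding X_def Z_def using H M by (auto intro!: divide_nonneg_nonneg mult_nonneg_nonneg sum_nonneg)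
    have "(\<Sum>a | a dvd nat \<bar>g\<bar>. 1 + 2 * H / real w * real (gcd a (nat \<bar>g\<bar> div a)) / \<bar>of_int g\<bar>) = real (card {a. a dvd n}) + X"
      unfolding X_def n_def[symmetric] n(1)[symmetric] sum.distrib by (simp add: sum_distrib_left sum_divide_distrib)
    then have q1: "q \<le> 16 * E + (B + X)" using 2(7) dn by linarith
    have q2: "q \<le> 16 * E + Z" using 2(6) by (simp add: Z_def)
    show ?thesis
    proof (cases "q \<le> 2 * B + 32 * E")
      case True
      then show ?thesis unfolding E_def ..
    next
      case False
      \<comment> \<open>Here B + 16 E is less than q/2, so each bound survives for q/2. Multiplying
        them gives q^2 <= 4 X Z, a product of a function of g and one of D.\<close>
      then have "q / 2 \<le> X" "q / 2 \<le> Z" using q1 q2 E0 B1 by argo+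
      moreover have "q \<ge> 0" by (simp add: q_def)
      ultimately have "(q / 2) * (q / 2) \<le> X * Z" using XZ0 by (intro mult_mono) auto
      then have "q\<^sup>2 \<le> 4 * (X * Z)" by (simp add: power2_eq_square)
      also have "4 * (X * Z) = 64 * H * M / real w * ((\<Sum>a | a dvd n. real (gcd a (n div a))) / real n) * (1 / real (nat \<bar>D\<bar>))"
        by (simp add: X_def Z_def)
      finally have q: "q\<^sup>2 \<le> 64 * H * M / real w * ((\<Sum>a | a dvd n. real (gcd a (n div a))) / real n) * (1 / real (nat \<bar>D\<bar>))" .
      have "g \<in> {- int (r\<^sup>2)..int (r\<^sup>2)} - {0}" "D \<in> {- int (2 * r)..int (2 * r)} - {0}"
        using gr Dr 2(1,2) by auto
      then show ?thesis using 2(5) q unfolding n_def by blast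
    qed
  qed
qed

text \<open>Two such shifts satisfy r | 2 D (x^2 - y^2), so their squares agree modulo r / gcd(2 D,
  r).\<close>

lemma card_shifts_le:
  assumes r: "r > 0" and w: "w > 0" and D: "D \<noteq> 0"
  shows "card {v \<in> {0..<int r}. sqpart r v = w \<and> int r dvd 2 * D * v\<^sup>2 - c} \<le>
    3 * gcd (2 * nat \<bar>D\<bar>) r * w * card {d. d dvd r}"
proof (rule card_equal_squares_sqpart_le[OF r _ _ w])
  fix x y
  assume xy: "x \<in> {v \<in> {0..<int r}. sqpart r v = w \<and> int r dvd 2 * D * v\<^sup>2 - c}"
    "y \<in> {v \<in> {0..<int r}. sqpart r v = w \<and> int r dvd 2 * D * v\<^sup>2 - c}"
  define e where "e = gcd (2 * nat \<bar>D\<bar>) r"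
  have "int r dvd (2 * D * x\<^sup>2 - c) - (2 * D * y\<^sup>2 - c)"
    by (rule dvd_diff) (use xy in auto)
  then have "int r dvd (2 * D) * (x\<^sup>2 - y\<^sup>2)" by (simp add: algebra_simps)
  moreover have e: "int e = gcd (2 * D) (int r)"
    unfolding e_def gcd_int_int_eq[symmetric] using gcd_abs1_int[of "2 * D" "int r"] by (simp add: abs_mult)
  have e0: "int e \<noteq> 0" using r e by simp
  have "int r = int e * (int r div int e)" "2 * D = int e * (2 * D div int e)"
    unfolding e by simp_all
  ultimately have "int r div int e dvd (2 * D div int e) * (x\<^sup>2 - y\<^sup>2)"
    by (metis (no_types, opaque_lifting) dvd_mult_cancel_left e0 mult.assoc)
  moreover have "coprime (int r div int e) (2 * D div int e)"
    unfolding e using div_gcd_coprime[of "2 * D" "int r"] r by (simp add: coprime_commute)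
  ultimately have "int r div int e dvd x\<^sup>2 - y\<^sup>2" by (simp add: coprime_dvd_mult_right_iff)
  then show "int (r div gcd (2 * nat \<bar>D\<bar>) r) dvd x\<^sup>2 - y\<^sup>2" by (simp add: e_def zdiv_int)
qed auto

text \<open>For shifts with few points, n(v)^2 is at most a uniform bound times n(v), and the n(v)
  add up to the O(H M) close pairs. For the others n(v)^2 is charged to a triple (w, g, D), and the
  triples are averaged.\<close>

lemma energy_bound:
  assumes r: "r > 0" and j: "coprime j (int r)" and M: "1 \<le> M" "M \<le> real r" and H: "0 < H" "H \<le> M"
    and B: "div_bound r B"
  shows "(\<Sum>v\<in>{0..<int r}. (real (card (shifted_pairs r j M H v)))\<^sup>2)
    \<le> 20000 * B ^ 9 * (H * M * (1 + H\<^sup>2 * M / real r))"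
proof -
  define E where "E = H\<^sup>2 * M / real r"
  define d where "d = real (card {d. d dvd r})"
  define n where "n = (\<lambda>v. real (card (shifted_pairs r j M H v)))"
  define q where "q = (\<lambda>v. real (card (diff_sum ` shifted_pairs r j M H v)))"
  define \<tau> where "\<tau> = (\<lambda>g::nat. (\<Sum>a | a dvd g. real (gcd a (g div a))) / real g)"
  define Gs where "Gs = {- int (r\<^sup>2)..int (r\<^sup>2)} - {0}"
  define Ds where "Ds = {- int (2 * r)..int (2 * r)} - {0}"
  define Ws where "Ws = {w. w\<^sup>2 dvd r \<and> w > 0}"
  define V where "V = (\<lambda>w g D. {v \<in> {0..<int r}. sqpart r v = w \<and> int r dvd 2 * D * v\<^sup>2 - j * (g * int (w\<^sup>2))})"
  define T where "T = (\<lambda>w g D. 64 * H * M / real w * \<tau> (nat \<bar>g\<bar>) * (1 / real (nat \<bar>D\<bar>)))"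
  have B1: "B \<ge> 1" and hB: "harm (4 * r\<^sup>2) \<le> B" using B by (auto simp: div_bound_def)
  have "r \<le> r\<^sup>2" by (simp add: power2_eq_square)
  then have dB: "d \<le> B" using B r unfolding d_def div_bound_def by blast
  have d0: "d \<ge> 0" by (simp add: d_def)
  have E0: "E \<ge> 0" using M by (simp add: E_def)
  have HM: "H * M \<ge> 0" using H M by simp
  have \<tau>0: "\<tau> g \<ge> 0" for g unfolding \<tau>_def by (intro divide_nonneg_nonneg sum_nonneg) auto
  have T0: "T w g D \<ge> 0" for w g D unfolding T_def using \<tau>0 H M by auto
  have nq: "n v \<le> 3 * d * q v" for v
  proof -
    have "n v \<le> real (3 * card {d. d dvd r} * card (diff_sum ` shifted_pairs r j M H v))"
      unfolding n_def of_nat_le_iff by (rule card_shifted_pairs_le[OF r])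
    then show ?thesis by (simp add: d_def q_def)
  qed
  have finW: "finite Ws" unfolding Ws_def using finite_square_divisors[OF r, of "\<lambda>w. w > 0"] .
  \<comment> \<open>Summing over all admissible triples, rather than choosing one for each v, allows
    the sum over v to be moved inside.\<close>
  define R where "R = (\<lambda>v. \<Sum>w\<in>Ws. \<Sum>g\<in>Gs. \<Sum>D\<in>Ds. if v \<in> V w g D then T w g D else 0)"
  have R0: "R v \<ge> 0" for v unfolding R_def using T0 by (intro sum_nonneg) auto
  have each: "(n v)\<^sup>2 \<le> 6 * d * (B + 16 * E) * n v + 9 * d\<^sup>2 * R v" if v: "v \<in> {0..<int r}" for v
  proof (cases "q v \<le> 2 * B + 32 * E")
    case True
    have "n v * n v \<le> (3 * d * q v) * n v" by (intro mult_right_mono nq) (simp add: n_def)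
    also have "\<dots> \<le> (3 * d * (2 * B + 32 * E)) * n v"
      using True d0 by (intro mult_right_mono mult_left_mono) (auto simp: n_def)
    also have "\<dots> = 6 * d * (B + 16 * E) * n v" by (simp add: algebra_simps)
    finally have "(n v)\<^sup>2 \<le> 6 * d * (B + 16 * E) * n v" by (simp add: power2_eq_square)
    moreover have "9 * d\<^sup>2 * R v \<ge> 0" using R0 by simp
    ultimately show ?thesis by linarith
  next
    case False
    then obtain g D where gD: "g \<in> Gs" "D \<in> Ds" "int r dvd 2 * D * v\<^sup>2 - j * (g * int ((sqpart r v)\<^sup>2))"
      and qT: "(q v)\<^sup>2 \<le> T (sqpart r v) g D"
      using card_diff_sum_cases[OF r j M H B, of v] unfolding q_def E_def Gs_def Ds_def T_def \<tau>_def by blast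
    define w where "w = sqpart r v"
    have w: "w \<in> Ws" using sqpart_mem[OF r] by (auto simp: w_def Ws_def)
    have vV: "v \<in> V w g D" using gD(3) v by (simp add: V_def w_def)
    have "T w g D = (\<Sum>w\<in>{w}. \<Sum>g\<in>{g}. \<Sum>D\<in>{D}. if v \<in> V w g D then T w g D else 0)" using vV by simp
    also have "\<dots> \<le> (\<Sum>w\<in>{w}. \<Sum>g\<in>{g}. \<Sum>D\<in>Ds. if v \<in> V w g D then T w g D else 0)"
      using gD T0 by (intro sum_mono sum_mono2) (auto simp: Ds_def)
    also have "\<dots> \<le> (\<Sum>w\<in>{w}. \<Sum>g\<in>Gs. \<Sum>D\<in>Ds. if v \<in> V w g D then T w g D else 0)"
      using gD T0 by (intro sum_mono[of "{w}"] sum_mono2[of Gs]) (auto simp: Gs_def intro!: sum_nonneg)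
    also have "\<dots> \<le> R v"
      unfolding R_def using w T0 finW by (intro sum_mono2[of Ws]) (auto intro!: sum_nonneg)
    finally have qR: "(q v)\<^sup>2 \<le> R v" using qT unfolding w_def by linarith
    have "(n v)\<^sup>2 \<le> (3 * d * q v)\<^sup>2" by (intro power_mono nq) (simp add: n_def)
    also have "\<dots> = 9 * d\<^sup>2 * (q v)\<^sup>2" by (simp add: power_mult_distrib)
    also have "\<dots> \<le> 9 * d\<^sup>2 * R v" using qR by (intro mult_left_mono) auto
    finally have "(n v)\<^sup>2 \<le> 9 * d\<^sup>2 * R v" .
    moreover have "6 * d * (B + 16 * E) * n v \<ge> 0" using d0 B1 E0 by (simp add: n_def)
    ultimately show ?thesis by linarith
  qed
  have sumn: "(\<Sum>v\<in>{0..<int r}. n v) \<le> 18 * d\<^sup>2 * (H * M)"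
    using card_close_pairs_le[OF r, of M H j] M H unfolding n_def d_def
    by (simp flip: of_nat_sum add: sum_card_shifted_pairs[OF r])
  have sumR: "(\<Sum>v\<in>{0..<int r}. R v) \<le> 1536 * B ^ 7 * (H * M)"
  proof -
    have "(\<Sum>v\<in>{0..<int r}. R v) = (\<Sum>w\<in>Ws. \<Sum>v\<in>{0..<int r}. \<Sum>g\<in>Gs. \<Sum>D\<in>Ds. if v \<in> V w g D then T w g D else 0)"
      unfolding R_def by (rule sum.swap)
    also have "\<dots> = (\<Sum>w\<in>Ws. \<Sum>g\<in>Gs. \<Sum>v\<in>{0..<int r}. \<Sum>D\<in>Ds. if v \<in> V w g D then T w g D else 0)"
      by (rule sum.cong[OF refl], rule sum.swap)
    also have "\<dots> = (\<Sum>w\<in>Ws. \<Sum>g\<in>Gs. \<Sum>D\<in>Ds. \<Sum>v\<in>{0..<int r}. if v \<in> V w g D then T w g D else 0)"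
      by (rule sum.cong[OF refl], rule sum.cong[OF refl], rule sum.swap)
    also have "\<dots> = (\<Sum>w\<in>Ws. \<Sum>g\<in>Gs. \<Sum>D\<in>Ds. real (card (V w g D)) * T w g D)"
    proof (intro sum.cong refl)
      fix w g D
      have "(\<Sum>v\<in>{0..<int r}. if v \<in> V w g D then T w g D else 0) = (\<Sum>v\<in>{v \<in> {0..<int r}. v \<in> V w g D}. T w g D)"
        by (rule sum.inter_filter[symmetric]) simp
      also have "{v \<in> {0..<int r}. v \<in> V w g D} = V w g D" by (auto simp: V_def)
      finally show "(\<Sum>v\<in>{0..<int r}. if v \<in> V w g D then T w g D else 0) = real (card (V w g D)) * T w g D" by simp
    qed
    \<comment> \<open>The factor w in the number of shifts cancels the 1/w in \<open>T\<close>, and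
      192 = 3 * 64.\<close>
    also have "\<dots> \<le> (\<Sum>w\<in>Ws. \<Sum>g\<in>Gs. \<Sum>D\<in>Ds. 192 * (H * M) * d * (\<tau> (nat \<bar>g\<bar>) * (real (gcd (2 * nat \<bar>D\<bar>) r) / real (nat \<bar>D\<bar>))))"
    proof (intro sum_mono)
      fix w g D assume w: "w \<in> Ws" and D: "D \<in> Ds"
      have w0: "w > 0" using w by (simp add: Ws_def)
      have "card (V w g D) \<le> 3 * gcd (2 * nat \<bar>D\<bar>) r * w * card {d. d dvd r}"
        unfolding V_def using D by (intro card_shifts_le r w0) (simp add: Ds_def)
      then have "real (card (V w g D)) \<le> real (3 * gcd (2 * nat \<bar>D\<bar>) r * w * card {d. d dvd r})" unfolding of_nat_le_iff .
      also have "\<dots> = 3 * real (gcd (2 * nat \<bar>D\<bar>) r) * real w * d" by (simp add: d_def)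
      finally have "real (card (V w g D)) * T w g D \<le> (3 * real (gcd (2 * nat \<bar>D\<bar>) r) * real w * d) * T w g D"
        using T0 by (intro mult_right_mono)
      also have "\<dots> = 192 * (H * M) * d * (\<tau> (nat \<bar>g\<bar>) * (real (gcd (2 * nat \<bar>D\<bar>) r) / real (nat \<bar>D\<bar>)))"
        using w0 by (simp add: T_def)
      finally show "real (card (V w g D)) * T w g D \<le> \<dots>" .
    qed
    also have "\<dots> = 192 * (H * M) * d * real (card Ws) * ((\<Sum>g\<in>Gs. \<tau> (nat \<bar>g\<bar>)) * (\<Sum>D\<in>Ds. real (gcd (2 * nat \<bar>D\<bar>) r) / real (nat \<bar>D\<bar>)))"
    proof -
      have "(\<Sum>g\<in>Gs. \<Sum>D\<in>Ds. 192 * (H * M) * d * (\<tau> (nat \<bar>g\<bar>) * (real (gcd (2 * nat \<bar>D\<bar>) r) / real (nat \<bar>D\<bar>))))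
        = 192 * (H * M) * d * ((\<Sum>g\<in>Gs. \<tau> (nat \<bar>g\<bar>)) * (\<Sum>D\<in>Ds. real (gcd (2 * nat \<bar>D\<bar>) r) / real (nat \<bar>D\<bar>)))"
        by (subst sum_product) (simp only: sum_distrib_left)
      then show ?thesis by (simp only: sum_constant mult_ac)
    qed
    also have "\<dots> \<le> 192 * (H * M) * B * B * ((2 * B ^ 3) * (4 * B * B))"
    proof (intro mult_mono)
      have "card Ws \<le> card {d. d dvd r}"
        using r by (intro card_mono) (auto simp: Ws_def power2_eq_square dest: dvd_mult_left)
      then show "real (card Ws) \<le> B" using dB unfolding d_def by linarith
      have "(\<Sum>g\<in>Gs. \<tau> (nat \<bar>g\<bar>)) = 2 * (\<Sum>g=1..r\<^sup>2. \<tau> g)" unfolding Gs_def by (rule sum_nat_abs)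
      also have "\<dots> \<le> 2 * harm (r\<^sup>2) ^ 3" using sum_gcd_divisors_le[of "r\<^sup>2"] by (simp add: \<tau>_def)
      also have "\<dots> \<le> 2 * B ^ 3"
        using harm_mono[of "r\<^sup>2" "4 * r\<^sup>2", where 'a = real] hB harm_nonneg[where 'a = real] by (intro mult_left_mono power_mono) auto
      finally show "(\<Sum>g\<in>Gs. \<tau> (nat \<bar>g\<bar>)) \<le> 2 * B ^ 3" .
      have "(\<Sum>D\<in>Ds. real (gcd (2 * nat \<bar>D\<bar>) r) / real (nat \<bar>D\<bar>)) = 2 * (\<Sum>D=1..2 * r. real (gcd (2 * D) r) / real D)"
        unfolding Ds_def by (rule sum_nat_abs)
      also have "\<dots> \<le> 2 * (2 * d * harm (2 * (2 * r)))"
        unfolding d_def by (rule mult_left_mono[OF sum_gcd_const_le[OF r]]) simp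
      also have "\<dots> \<le> 2 * (2 * B * B)"
        using harm_mono[of "2 * (2 * r)" "4 * r\<^sup>2", where 'a = real] \<open>r \<le> r\<^sup>2\<close> hB dB d0 B1 harm_nonneg[where 'a = real] by (intro mult_left_mono mult_mono) auto
      finally show "(\<Sum>D\<in>Ds. real (gcd (2 * nat \<bar>D\<bar>) r) / real (nat \<bar>D\<bar>)) \<le> 4 * B * B" by simp
    qed (use H M dB d0 B1 \<tau>0 in \<open>auto intro!: sum_nonneg mult_nonneg_nonneg\<close>)
    also have "\<dots> = 1536 * B ^ 7 * (H * M)" by (simp add: power_numeral_reduce)
    finally show ?thesis .
  qed
  have "(\<Sum>v\<in>{0..<int r}. (n v)\<^sup>2) \<le> (\<Sum>v\<in>{0..<int r}. 6 * d * (B + 16 * E) * n v + 9 * d\<^sup>2 * R v)"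
    using each by (rule sum_mono)
  also have "\<dots> = 6 * d * (B + 16 * E) * (\<Sum>v\<in>{0..<int r}. n v) + 9 * d\<^sup>2 * (\<Sum>v\<in>{0..<int r}. R v)"
    by (simp add: sum.distrib sum_distrib_left)
  also have "\<dots> \<le> 6 * B * (B * (16 * (1 + E))) * (18 * B\<^sup>2 * (H * M)) + 9 * B\<^sup>2 * (1536 * B ^ 7 * (H * M))"
  proof (rule add_mono)
    have "B + 16 * E \<le> 16 * B + 16 * (B * E)"
      using B1 E0 mult_right_mono[OF B1 E0] by linarith
    then have "B + 16 * E \<le> B * (16 * (1 + E))" by (simp add: algebra_simps)
    then have "6 * d * (B + 16 * E) \<le> 6 * B * (B * (16 * (1 + E)))"
      using d0 dB B1 E0 by (intro mult_mono) auto
    moreover have "(\<Sum>v\<in>{0..<int r}. n v) \<le> 18 * B\<^sup>2 * (H * M)"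
      using HM d0 dB by (intro order_trans[OF sumn] mult_right_mono mult_left_mono power_mono) auto
    ultimately show "6 * d * (B + 16 * E) * (\<Sum>v\<in>{0..<int r}. n v) \<le> 6 * B * (B * (16 * (1 + E))) * (18 * B\<^sup>2 * (H * M))"
      by (rule mult_mono) (use B1 E0 in \<open>auto simp: n_def intro: sum_nonneg\<close>)
    show "9 * d\<^sup>2 * (\<Sum>v\<in>{0..<int r}. R v) \<le> 9 * B\<^sup>2 * (1536 * B ^ 7 * (H * M))"
      using sumR d0 dB R0 by (intro mult_mono mult_left_mono power_mono) (auto intro: sum_nonneg)
  qed
  also have "\<dots> = 1728 * (B ^ 4 * (H * M * (1 + E))) + 13824 * (B ^ 9 * (H * M))"
    by (simp add: power_numeral_reduce)
  also have "\<dots> \<le> 1728 * (B ^ 9 * (H * M * (1 + E))) + 13824 * (B ^ 9 * (H * M * (1 + E)))"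
  proof (intro add_mono mult_left_mono mult_right_mono)
    show "B ^ 4 \<le> B ^ 9" using B1 by (intro power_increasing) auto
    have "H * M * 1 \<le> H * M * (1 + E)" using HM E0 by (intro mult_left_mono) auto
    then show "H * M \<le> H * M * (1 + E)" by simp
  qed (use HM E0 B1 in auto)
  also have "\<dots> = 15552 * (B ^ 9 * (H * M * (1 + E)))" by simp
  also have "\<dots> \<le> 20000 * (B ^ 9 * (H * M * (1 + E)))"
    using HM E0 B1 by (intro mult_right_mono) auto
  also have "\<dots> = 20000 * B ^ 9 * (H * M * (1 + E))" by simp
  finally show ?thesis unfolding n_def E_def .
qed

section \<open>Reduction to primitive roots\<close>

definition all_roots :: "nat \<Rightarrow> int \<Rightarrow> real \<Rightarrow> (int \<times> int) set" where
  "all_roots r j M = {(k, m). 0 \<le> k \<and> k < int r \<and> 1 \<le> m \<and> of_int m \<le> M \<and> int r dvd k\<^sup>2 - j * m}"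

lemma finite_all_roots [simp]: "finite (all_roots r j M)"
proof (rule finite_subset)
  show "all_roots r j M \<subseteq> {0..int r} \<times> {1..\<lfloor>M\<rfloor>}" by (auto simp: all_roots_def le_floor_iff)
qed simp

lemma div_bound_mono: "div_bound r B \<Longrightarrow> \<rho> \<le> r \<Longrightarrow> div_bound \<rho> B"
proof -
  assume B: "div_bound r B" and le: "\<rho> \<le> r"
  have "\<rho>\<^sup>2 \<le> r\<^sup>2" using le by (intro power_mono) auto
  moreover from this have "(harm (4 * \<rho>\<^sup>2) :: real) \<le> harm (4 * r\<^sup>2)" by (intro harm_mono) auto
  ultimately show ?thesis using B unfolding div_bound_def by (meson order_trans)
qed

lemma div_boundD:
  assumes "div_bound r B" "r > 0"
  shows "real (card {d. d dvd r}) \<le> B" "B \<ge> 1"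
  using assms power_increasing[of 1 2 r] unfolding div_bound_def by (auto simp: Suc_le_eq)

text \<open>As j is a unit, s^2 divides m and the congruence can be divided by s^2. A nontrivial
  square part t of the reduced root would make s t admissible for k, against the maximality of s.
  Since k1 is only bounded by s \<rho>, a reduced root has up to s lifts.\<close>

lemma all_roots_scale:
  assumes r: "r > 0" and j: "coprime j (int r)" and km: "(k, m) \<in> all_roots r j M"
  defines "s \<equiv> sqpart r k"
  defines "\<rho> \<equiv> r div s\<^sup>2"
  obtains k1 m1 where "k = int s * k1" "m = int (s\<^sup>2) * m1" "0 \<le> k1" "k1 < int s * int \<rho>"
    "(k1 mod int \<rho>, m1) \<in> prim_roots \<rho> j (M / (real s)\<^sup>2)"
proof -
  have s: "s\<^sup>2 dvd r" "int s dvd k" "s > 0" using sqpart_mem[OF r] by (auto simp: s_def)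
  have kr: "0 \<le> k" "k < int r" "1 \<le> m" "of_int m \<le> M" "int r dvd k\<^sup>2 - j * m"
    using km by (auto simp: all_roots_def)
  have rr: "r = s\<^sup>2 * \<rho>" using s by (simp add: \<rho>_def)
  then have \<rho>0: "\<rho> > 0" using r by (metis gr0I mult_0_right)
  obtain k1 where k1: "k = int s * k1" using s(2) by (metis dvdE)
  have s2: "int (s\<^sup>2) dvd k\<^sup>2" unfolding k1 by (simp add: power_mult_distrib)
  have "int (s\<^sup>2) dvd k\<^sup>2 - j * m" using s(1) kr(5) by (meson dvd_trans of_nat_dvd_iff)
  then have "int (s\<^sup>2) dvd j * m" using s2 by (metis dvd_diff_right_iff)
  moreover have "coprime (int (s\<^sup>2)) j" using j s(1) by (meson coprime_commute coprime_divisors dvd_refl of_nat_dvd_iff)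
  ultimately have "int (s\<^sup>2) dvd m" by (simp add: coprime_dvd_mult_right_iff)
  then obtain m1 where m1: "m = int (s\<^sup>2) * m1" by (metis dvdE)
  have k1b: "0 \<le> k1" using kr(1) s(3) unfolding k1 by (simp add: zero_le_mult_iff)
  have "int s * k1 < int s * (int s * int \<rho>)" using kr(2) unfolding k1 rr by (simp add: power2_eq_square)
  then have k1c: "k1 < int s * int \<rho>" using s(3) by simp
  have m1b: "1 \<le> m1" using kr(3) unfolding m1 by (simp add: int_one_le_iff_zero_less zero_less_mult_iff)
  have m1c: "of_int m1 \<le> M / (real s)\<^sup>2"
    using kr(4) s(3) unfolding m1 by (simp add: pos_le_divide_eq mult.commute)
  have "int (s\<^sup>2) * int \<rho> dvd int (s\<^sup>2) * (k1\<^sup>2 - j * m1)"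
    using kr(5) unfolding k1 m1 rr by (simp add: power_mult_distrib algebra_simps)
  then have d1: "int \<rho> dvd k1\<^sup>2 - j * m1" using s(3) by simp
  have "[(k1 mod int \<rho>)\<^sup>2 - j * m1 = k1\<^sup>2 - j * m1] (mod int \<rho>)"
    by (intro cong_diff cong_pow cong_refl) simp
  then have d2: "int \<rho> dvd (k1 mod int \<rho>)\<^sup>2 - j * m1" using d1 cong_dvd_iff by blast
  have "sqpart \<rho> (k1 mod int \<rho>) \<le> 1"
  proof -
    define t where "t = sqpart \<rho> (k1 mod int \<rho>)"
    have t: "t\<^sup>2 dvd \<rho>" "int t dvd k1 mod int \<rho>" "t > 0" using sqpart_mem[OF \<rho>0] by (auto simp: t_def)
    have "int t dvd int \<rho>" using t(1) by (meson dvd_power dvd_trans of_nat_dvd_iff zero_less_numeral)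
    then have "int t dvd k1" using t(2) by (simp add: dvd_mod_iff)
    then have "int (s * t) dvd k" unfolding k1 by simp
    moreover have "(s * t)\<^sup>2 dvd r" unfolding rr using t(1) by (simp add: power_mult_distrib)
    ultimately have "s * t \<le> sqpart r k" by (intro sqpart_ge r)
    then show ?thesis using s(3) unfolding s_def[symmetric] t_def[symmetric] by simp
  qed
  then have "sqpart \<rho> (k1 mod int \<rho>) = 1" using sqpart_mem(3)[OF \<rho>0, of "k1 mod int \<rho>"] by linarith
  then have "(k1 mod int \<rho>, m1) \<in> prim_roots \<rho> j (M / (real s)\<^sup>2)"
    using d2 m1b m1c \<rho>0 by (auto simp: prim_roots_def)
  then show ?thesis using that k1 m1 k1b k1c by blast
qed

text \<open>Equal k force m = m' modulo r, impossible for distinct m, m' in [1, r]. Hence a window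
  |u| <= U counts 2 U shifts rather than 2 U + 1, which is decisive when U = 0.\<close>

lemma shifted_pairs_0:
  assumes j: "coprime j (int r)" and r: "r > 0" and M: "M \<le> real r"
  shows "shifted_pairs r j M H 0 = {}"
proof (rule ccontr)
  assume "shifted_pairs r j M H 0 \<noteq> {}"
  then obtain k m k' m' where p: "((k, m), (k', m')) \<in> shifted_pairs r j M H 0" by fast
  then have kk: "(k - k') mod int r = 0" "0 \<le> k" "k < int r" "0 \<le> k'" "k' < int r"
    and dv: "int r dvd k\<^sup>2 - j * m" "int r dvd k'\<^sup>2 - j * m'" and m: "m \<noteq> m'" "1 \<le> m" "1 \<le> m'" "of_int m \<le> M" "of_int m' \<le> M"
    by (auto simp: shifted_pairs_def close_pairs_def prim_roots_def)
  have "k mod int r = k' mod int r" using kk(1) by (metis mod_eq_dvd_iff dvd_eq_mod_eq_0)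
  then have k: "k = k'" using kk by simp
  have "int r dvd (k\<^sup>2 - j * m) - (k'\<^sup>2 - j * m')" using dv by (rule dvd_diff)
  then have "int r dvd j * (m' - m)" unfolding k by (simp add: algebra_simps)
  then have "int r dvd m' - m" using j by (metis coprime_commute coprime_dvd_mult_right_iff)
  then have "\<bar>int r\<bar> \<le> \<bar>m' - m\<bar>" using m(1) by (intro dvd_imp_le_int) auto
  moreover have "m \<le> int r" "m' \<le> int r" using m M by linarith+
  ultimately show False using m by linarith
qed

lemma sum_windowed_le:
  fixes U :: int
  assumes "\<rho> > 0" "U \<ge> 0" "\<And>v. g v \<ge> (0::real)"
  shows "(\<Sum>u\<in>{- U..U} - {0}. g (u mod int \<rho>)) \<le> (1 + 2 * real_of_int U / real \<rho>) * (\<Sum>v\<in>{0..<int \<rho>}. g v)"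
proof -
  let ?W = "{- U..U} - {0}"
  have "(\<Sum>u\<in>?W. g (u mod int \<rho>)) = (\<Sum>v\<in>{0..<int \<rho>}. \<Sum>u | u \<in> ?W \<and> u mod int \<rho> = v. g (u mod int \<rho>))"
    using assms by (intro sum.group[symmetric]) auto
  also have "\<dots> = (\<Sum>v\<in>{0..<int \<rho>}. real (card {u \<in> ?W. u mod int \<rho> = v}) * g v)"
    by simp
  also have "\<dots> \<le> (\<Sum>v\<in>{0..<int \<rho>}. (1 + 2 * real_of_int U / real \<rho>) * g v)"
  proof (intro sum_mono mult_right_mono assms)
    fix v
    have "real (card {u \<in> ?W. u mod int \<rho> = v}) \<le> 1 + real_of_int (U - - U) / real \<rho>"
      using assms by (intro card_residue_class_le) (auto simp: mod_eq_dvd_iff[symmetric])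
    then show "real (card {u \<in> ?W. u mod int \<rho> = v}) \<le> 1 + 2 * real_of_int U / real \<rho>" by simp
  qed
  finally show ?thesis by (simp add: sum_distrib_left)
qed

text \<open>The integer z makes this the distance on the circle. Of the width 2 r / L, one half will
  come from the bins and one from the variation of f.\<close>

definition near_pairs :: "nat \<Rightarrow> int \<Rightarrow> real \<Rightarrow> real \<Rightarrow> real \<Rightarrow> nat \<Rightarrow> ((int \<times> int) \<times> (int \<times> int)) set" where
  "near_pairs r j L M H s = {((k, m), (k', m')). (k, m) \<in> all_roots r j M \<and> (k', m') \<in> all_roots r j M \<and>
    sqpart r k = s \<and> sqpart r k' = s \<and> \<bar>of_int (m - m')\<bar> \<le> H \<and>
    (\<exists>z::int. \<bar>of_int (k - k' - z * int r)\<bar> \<le> 2 * real r / L)}"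

lemma finite_near_pairs [simp]: "finite (near_pairs r j L M H s)"
  by (rule finite_subset[of _ "all_roots r j M \<times> all_roots r j M"]) (auto simp: near_pairs_def)

text \<open>Only the M / s^2 multiples of s^2 occur as m; each has O(s d(r)) roots, so the s^2 pairs
  of roots make up for the rarity of m.\<close>

lemma card_near_pairs_diag_le:
  assumes r: "r > 0" and j: "coprime j (int r)" and M: "M \<ge> 0" and s: "s\<^sup>2 dvd r" "s > 0" and B: "div_bound r B"
  shows "real (card {p \<in> near_pairs r j L M H s. snd (fst p) = snd (snd p)}) \<le> 9 * B\<^sup>2 * M"
proof -
  define d where "d = card {d. d dvd r}"
  define A where "A = {p \<in> near_pairs r j L M H s. snd (fst p) = snd (snd p)}"
  define K where "K = (\<lambda>m. {k. (k, m) \<in> all_roots r j M \<and> sqpart r k = s})"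
  have fK: "finite (K m)" for m
    by (rule finite_subset[of _ "fst ` all_roots r j M"]) (force simp: K_def)+
  have cK: "card (K m) \<le> 3 * 1 * s * d" for m
    unfolding d_def
  proof (rule card_equal_squares_sqpart_le[OF r _ _ s(2)])
    fix x y assume "x \<in> K m" "y \<in> K m"
    then have "int r dvd x\<^sup>2 - j * m" "int r dvd y\<^sup>2 - j * m" by (auto simp: K_def all_roots_def)
    then have "int r dvd (x\<^sup>2 - j * m) - (y\<^sup>2 - j * m)" by (rule dvd_diff)
    then show "int (r div 1) dvd x\<^sup>2 - y\<^sup>2" by simp
  qed (auto simp: K_def all_roots_def)
  have "card A \<le> (3 * s * d * (3 * s * d)) * card ((\<lambda>p. snd (fst p)) ` A)"
  proof (rule card_le_fibers)
    fix y
    have "card {p \<in> A. snd (fst p) = y} \<le> card (K y \<times> K y)"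
      by (rule card_inj_on_le[where f = "\<lambda>p. (fst (fst p), fst (snd p))"])
        (auto simp: inj_on_def A_def K_def near_pairs_def intro!: finite_cartesian_product fK[unfolded K_def])
    also have "\<dots> \<le> 3 * s * d * (3 * s * d)"
      unfolding card_cartesian_product using cK[of y] by (intro mult_le_mono) auto
    finally show "card {p \<in> A. snd (fst p) = y} \<le> 3 * s * d * (3 * s * d)" .
  qed (simp add: A_def)
  then have "real (card A) \<le> real ((3 * s * d * (3 * s * d)) * card ((\<lambda>p. snd (fst p)) ` A))" unfolding of_nat_le_iff .
  also have "\<dots> = (9 * (real s)\<^sup>2 * (real d)\<^sup>2) * real (card ((\<lambda>p. snd (fst p)) ` A))" by (simp add: power2_eq_square)
  also have "\<dots> \<le> (9 * (real s)\<^sup>2 * B\<^sup>2) * (M / (real s)\<^sup>2)"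
  proof (intro mult_mono power_mono)
    show "real d \<le> B" using div_boundD[OF B r] by (simp add: d_def)
    have "(\<lambda>p. snd (fst p)) ` A \<subseteq> (\<lambda>m1. int (s\<^sup>2) * m1) ` {1..\<lfloor>M / (real s)\<^sup>2\<rfloor>}"
    proof
      fix m assume "m \<in> (\<lambda>p. snd (fst p)) ` A"
      then obtain k where k: "(k, m) \<in> all_roots r j M" "sqpart r k = s" by (auto simp: A_def near_pairs_def)
      from all_roots_scale[OF r j k(1)] k(2) obtain k1 m1 where "m = int (s\<^sup>2) * m1"
        "(k1 mod int (r div s\<^sup>2), m1) \<in> prim_roots (r div s\<^sup>2) j (M / (real s)\<^sup>2)" by metis
      then show "m \<in> (\<lambda>m1. int (s\<^sup>2) * m1) ` {1..\<lfloor>M / (real s)\<^sup>2\<rfloor>}"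
        by (auto simp: prim_roots_def le_floor_iff)
    qed
    then have "card ((\<lambda>p. snd (fst p)) ` A) \<le> card {1..\<lfloor>M / (real s)\<^sup>2\<rfloor>}"
      by (rule surj_card_le[rotated]) simp
    then have "real (card ((\<lambda>p. snd (fst p)) ` A)) \<le> real (nat \<lfloor>M / (real s)\<^sup>2\<rfloor>)" by simp
    also have "\<dots> \<le> M / (real s)\<^sup>2" using M by simp
    finally show "real (card ((\<lambda>p. snd (fst p)) ` A)) \<le> M / (real s)\<^sup>2" .
  qed auto
  also have "\<dots> = 9 * B\<^sup>2 * M" using s by simp
  finally show ?thesis unfolding A_def .
qed

text \<open>Write k = s (t \<rho> + \<kappa>) with t < s, the source of the factor s. The reduced
  roots form a shifted pair for some |u| <= 2 s \<rho> / L. Conversely t and \<kappa> give k, and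
  then u gives k' modulo r.\<close>

lemma card_near_pairs_offdiag_sum:
  assumes r: "r > 0" and j: "coprime j (int r)" and s: "s\<^sup>2 dvd r" "s > 0" and L: "L \<ge> 1"
  defines "\<rho> \<equiv> r div s\<^sup>2"
  defines "U \<equiv> \<lfloor>2 * real s * real \<rho> / L\<rfloor>"
  shows "card {p \<in> near_pairs r j L M H s. snd (fst p) \<noteq> snd (snd p)} \<le>
    s * (\<Sum>u\<in>{- U..U}. card (shifted_pairs \<rho> j (M / (real s)\<^sup>2) (H / (real s)\<^sup>2) (u mod int \<rho>)))"
proof -
  define A where "A = {p \<in> near_pairs r j L M H s. snd (fst p) \<noteq> snd (snd p)}"
  define P where "P = (\<lambda>v. shifted_pairs \<rho> j (M / (real s)\<^sup>2) (H / (real s)\<^sup>2) v)"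
  have rr: "r = s\<^sup>2 * \<rho>" using s by (simp add: \<rho>_def)
  then have \<rho>0: "\<rho> > 0" using r by (metis gr0I mult_0_right)
  have rs: "int r = int s * (int s * int \<rho>)" by (simp add: rr power2_eq_square)
  \<comment> \<open>The relation says that x encodes p. A code for every p (\<open>ex\<close>) and
    at most one p per code (\<open>uniq\<close>) yield an injection.\<close>
  define good where "good = (\<lambda>p x. case (p, x) of (((k, m), (k', m')), (t, u, ((\<kappa>, m1), (\<kappa>'::int, m1')))) \<Rightarrow>
     k = int s * (t * int \<rho> + \<kappa>) \<and> int s * int \<rho> dvd k' div int s - (k div int s - u) \<and>
     int s dvd k' \<and> m = int (s\<^sup>2) * m1 \<and> m' = int (s\<^sup>2) * m1')"
  define T where "T = {0..<int s} \<times> Sigma {- U..U} (\<lambda>u. P (u mod int \<rho>))"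
  have ex: "\<exists>x\<in>T. good p x" if pA: "p \<in> A" for p
  proof -
    obtain k m k' m' where p: "p = ((k, m), (k', m'))" by (metis surj_pair)
    have km: "(k, m) \<in> all_roots r j M" "(k', m') \<in> all_roots r j M" and sq: "sqpart r k = s" "sqpart r k' = s"
      and mm: "\<bar>of_int (m - m')\<bar> \<le> H" "m \<noteq> m'"
      using that unfolding p A_def near_pairs_def by auto
    obtain z :: int where z: "\<bar>of_int (k - k' - z * int r)\<bar> \<le> 2 * real r / L"
      using pA unfolding p A_def near_pairs_def by auto
    from all_roots_scale[OF r j km(1)] sq(1) obtain k1 m1 where 1: "k = int s * k1" "m = int (s\<^sup>2) * m1"
      "0 \<le> k1" "k1 < int s * int \<rho>" "(k1 mod int \<rho>, m1) \<in> prim_roots \<rho> j (M / (real s)\<^sup>2)"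
      unfolding \<rho>_def by metis
    from all_roots_scale[OF r j km(2)] sq(2) obtain k1' m1' where 2: "k' = int s * k1'" "m' = int (s\<^sup>2) * m1'"
      "0 \<le> k1'" "k1' < int s * int \<rho>" "(k1' mod int \<rho>, m1') \<in> prim_roots \<rho> j (M / (real s)\<^sup>2)"
      unfolding \<rho>_def by metis
    define u where "u = k1 - k1' - z * (int s * int \<rho>)"
    have "k - k' - z * int r = int s * u" unfolding 1 2 rs u_def by (simp add: algebra_simps)
    then have "real s * \<bar>of_int u\<bar> \<le> 2 * real r / L" using z by (simp add: abs_mult)
    also have "\<dots> = real s * (2 * real s * real \<rho> / L)" by (simp add: rr power2_eq_square)
    finally have "\<bar>of_int u\<bar> \<le> 2 * real s * real \<rho> / L" by (rule mult_left_le_imp_le) (use s(2) in simp)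
    then have "real_of_int \<bar>u\<bar> \<le> 2 * real s * real \<rho> / L" by simp
    then have "\<bar>u\<bar> \<le> U" unfolding U_def by (simp add: le_floor_iff)
    then have uU: "u \<in> {- U..U}" by auto
    have "int (s\<^sup>2) * (m1 - m1') = m - m'" unfolding 1 2 by (simp add: algebra_simps)
    then have "(real s)\<^sup>2 * \<bar>of_int (m1 - m1')\<bar> \<le> H"
      using mm(1) by (metis abs_mult abs_of_nat of_int_mult of_int_of_nat_eq of_nat_power)
    then have mH: "\<bar>of_int (m1 - m1')\<bar> \<le> H / (real s)\<^sup>2"
      using s(2) by (simp add: pos_le_divide_eq mult.commute)
    have "m1 \<noteq> m1'" using mm(2) 1 2 by auto
    have "(k1 mod int \<rho> - k1' mod int \<rho>) mod int \<rho> = u mod int \<rho>"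
    proof -
      have "(k1 mod int \<rho> - k1' mod int \<rho>) mod int \<rho> = (k1 - k1') mod int \<rho>" by (rule mod_diff_eq)
      also have "\<dots> = (u + (z * int s) * int \<rho>) mod int \<rho>" by (simp add: u_def mult.assoc)
      also have "\<dots> = u mod int \<rho>" by simp
      finally show ?thesis .
    qed
    then have inP: "((k1 mod int \<rho>, m1), (k1' mod int \<rho>, m1')) \<in> P (u mod int \<rho>)"
      unfolding P_def shifted_pairs_def close_pairs_def using 1(5) 2(5) mH \<open>m1 \<noteq> m1'\<close> by simp
    have t: "k1 div int \<rho> \<in> {0..<int s}"
    proof -
      have "(k1 div int \<rho>) * int \<rho> \<le> k1" using \<rho>0 by (metis div_mult_mod_eq le_add_same_cancel1 of_nat_0_less_iff pos_mod_sign)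
      then have "(k1 div int \<rho>) * int \<rho> < int s * int \<rho>" using 1(4) by linarith
      then have "k1 div int \<rho> < int s" using \<rho>0 by simp
      then show ?thesis using 1(3) \<rho>0 by (simp add: pos_imp_zdiv_nonneg_iff)
    qed
    have "k1' - (k1 - u) = (- z) * (int s * int \<rho>)" by (simp add: u_def)
    then have dv: "int s * int \<rho> dvd k1' - (k1 - u)" by (metis dvd_triv_right)
    have "good p (k1 div int \<rho>, u, ((k1 mod int \<rho>, m1), (k1' mod int \<rho>, m1')))"
      unfolding good_def p using 1(1,2) 2(1,2) s(2) dv by simp
    moreover have "(k1 div int \<rho>, u, ((k1 mod int \<rho>, m1), (k1' mod int \<rho>, m1'))) \<in> T"
      unfolding T_def using t uU inP by simp
    ultimately show ?thesis by blast
  qed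
  have uniq: "p = p'" if "p \<in> A" "p' \<in> A" "good p x" "good p' x" for p p' x
  proof -
    obtain k m k' m' where p: "p = ((k, m), (k', m'))" by (metis surj_pair)
    obtain h n h' n' where p': "p' = ((h, n), (h', n'))" by (metis surj_pair)
    obtain t u a b a' b' where x: "x = (t, u, ((a, b), (a', b')))" by (metis surj_pair)
    have g: "k = h" "m = n" "m' = n'" "int s dvd k'" "int s dvd h'"
      "int s * int \<rho> dvd k' div int s - (k div int s - u)" "int s * int \<rho> dvd h' div int s - (h div int s - u)"
      using that(3,4) unfolding good_def p p' x by auto
    have "int s * int \<rho> dvd (k' div int s - (k div int s - u)) - (h' div int s - (h div int s - u))"
      using g(6,7) by (rule dvd_diff)
    then have "int s * int \<rho> dvd k' div int s - h' div int s" using g(1) by simp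
    then have "int s * (int s * int \<rho>) dvd int s * (k' div int s - h' div int s)" by simp
    then have "int r dvd k' - h'" using g(4,5) by (simp add: rs right_diff_distrib)
    moreover have "0 \<le> k'" "k' < int r" "0 \<le> h'" "h' < int r"
      using that(1,2) unfolding p p' A_def near_pairs_def all_roots_def by auto
    ultimately have "k' = h'" by (metis mod_eq_dvd_iff mod_pos_pos_trivial)
    then show ?thesis using g by (simp add: p p')
  qed
  from ex obtain \<phi> where \<phi>: "\<And>p. p \<in> A \<Longrightarrow> \<phi> p \<in> T \<and> good p (\<phi> p)" by metis
  have finT: "finite T" unfolding T_def P_def by simp
  have "card A \<le> card T"
  proof (rule card_inj_on_le[OF _ _ finT])
    show "inj_on \<phi> A" using uniq \<phi> by (metis inj_onI)
    show "\<phi> ` A \<subseteq> T" using \<phi> by auto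
  qed
  also have "card T = s * (\<Sum>u\<in>{- U..U}. card (P (u mod int \<rho>)))"
    unfolding T_def by (simp add: card_cartesian_product card_SigmaI P_def)
  finally show ?thesis unfolding A_def P_def .
qed

text \<open>Cauchy-Schwarz over the shifts. The lifts give s^2, the overlap of the window with
  residues modulo \<rho> gives 1 + 4 s / L <= 5 s, and the number of shifts 4 s \<rho> / L: in all
  20 s^2 r / L, against s^(-4) from the scaled H and M.\<close>

lemma card_near_pairs_offdiag_le:
  assumes r: "r > 0" and j: "coprime j (int r)" and s: "s\<^sup>2 dvd r" "s > 0" and L: "L \<ge> 1"
    and M: "1 \<le> M" "M \<le> real r" and H: "0 < H" "H \<le> M" and B: "div_bound r B"
  shows "(real (card {p \<in> near_pairs r j L M H s. snd (fst p) \<noteq> snd (snd p)}))\<^sup>2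
    \<le> 400000 * B ^ 9 * (real r / L) * (H * M * (1 + H\<^sup>2 * M / real r))"
proof -
  define A where "A = {p \<in> near_pairs r j L M H s. snd (fst p) \<noteq> snd (snd p)}"
  define \<rho> where "\<rho> = r div s\<^sup>2"
  define U where "U = \<lfloor>2 * real s * real \<rho> / L\<rfloor>"
  define M' where "M' = M / (real s)\<^sup>2"
  define H' where "H' = H / (real s)\<^sup>2"
  have B1: "B \<ge> 1" using div_boundD[OF B r] by simp
  have rr: "r = s\<^sup>2 * \<rho>" using s by (simp add: \<rho>_def)
  then have \<rho>0: "\<rho> > 0" using r by (metis gr0I mult_0_right)
  have rs: "real r = (real s)\<^sup>2 * real \<rho>" by (simp add: rr)
  have RHS0: "0 \<le> 400000 * B ^ 9 * (real r / L) * (H * M * (1 + H\<^sup>2 * M / real r))"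
    using B1 L H M by (intro mult_nonneg_nonneg add_nonneg_nonneg divide_nonneg_nonneg) auto
  have s1: "real s \<ge> 1" using s(2) by simp
  show ?thesis
  \<comment> \<open>\<open>energy_bound\<close> needs M' >= 1; below that, no multiple of s^2 is
    available as m.\<close>
  proof (cases "M' < 1")
    case True
    have "A = {}"
    proof (rule ccontr)
      assume "A \<noteq> {}"
      then obtain k m k' m' where "((k, m), (k', m')) \<in> A" by fast
      then have k: "(k, m) \<in> all_roots r j M" "sqpart r k = s" by (auto simp: A_def near_pairs_def)
      from all_roots_scale[OF r j k(1)] k(2) obtain k1 m1 where
        "(k1 mod int \<rho>, m1) \<in> prim_roots \<rho> j (M / (real s)\<^sup>2)" unfolding \<rho>_def by metis
      then have "1 \<le> m1" "of_int m1 \<le> M'" by (auto simp: prim_roots_def M'_def)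
      then show False using True by linarith
    qed
    then show ?thesis using RHS0 unfolding A_def[symmetric] by simp
  next
    case False
    define n where "n = (\<lambda>v. real (card (shifted_pairs \<rho> j M' H' v)))"
    have j\<rho>: "coprime j (int \<rho>)" using j by (auto simp: rr coprime_mult_right_iff)
    have M'\<rho>: "M' \<le> real \<rho>" using M(2) s(2) unfolding M'_def rs by (simp add: pos_divide_le_eq mult.commute)
    have H': "0 < H'" "H' \<le> M'" using H s(2) unfolding H'_def M'_def by (auto intro: divide_right_mono)
    have "\<rho> \<le> r" unfolding \<rho>_def by simp
    then have B': "div_bound \<rho> B" by (rule div_bound_mono[OF B])
    have U0: "U \<ge> 0" unfolding U_def using L by simp
    have Ule: "real_of_int U \<le> 2 * real s * real \<rho> / L" unfolding U_def by simp
    have n0: "n 0 = 0" unfolding n_def using shifted_pairs_0[OF j\<rho> \<rho>0 M'\<rho>] by simp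
    let ?W = "{- U..U} - {0}"
    have "real (card A) \<le> real (s * (\<Sum>u\<in>{- U..U}. card (shifted_pairs \<rho> j M' H' (u mod int \<rho>))))"
      unfolding of_nat_le_iff A_def M'_def H'_def U_def \<rho>_def by (rule card_near_pairs_offdiag_sum[OF r j s L])
    also have "\<dots> = real s * (\<Sum>u\<in>{- U..U}. n (u mod int \<rho>))" by (simp add: n_def)
    also have "(\<Sum>u\<in>{- U..U}. n (u mod int \<rho>)) = (\<Sum>u\<in>?W. n (u mod int \<rho>))"
      using n0 by (intro sum.mono_neutral_right) auto
    finally have "(real (card A))\<^sup>2 \<le> (real s * (\<Sum>u\<in>?W. n (u mod int \<rho>)))\<^sup>2" by (intro power_mono) auto
    also have "\<dots> = (real s)\<^sup>2 * (\<Sum>u\<in>?W. n (u mod int \<rho>) * 1)\<^sup>2" by (simp add: power_mult_distrib)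
    also have "\<dots> \<le> (real s)\<^sup>2 * ((\<Sum>u\<in>?W. (n (u mod int \<rho>))\<^sup>2) * (\<Sum>u\<in>?W. 1\<^sup>2))"
      by (intro mult_left_mono Cauchy_Schwarz_ineq_sum) auto
    also have "(\<Sum>u\<in>?W. 1\<^sup>2) = 2 * real_of_int U"
      using U0 by (simp add: card_Diff_singleton)
    also have "(real s)\<^sup>2 * ((\<Sum>u\<in>?W. (n (u mod int \<rho>))\<^sup>2) * (2 * real_of_int U)) \<le>
        (real s)\<^sup>2 * ((5 * real s * (20000 * B ^ 9 * (H' * M' * (1 + H'\<^sup>2 * M' / real \<rho>)))) * (4 * real s * real \<rho> / L))"
    proof (intro mult_left_mono mult_mono)
      have "(\<Sum>u\<in>?W. (n (u mod int \<rho>))\<^sup>2) \<le> (1 + 2 * real_of_int U / real \<rho>) * (\<Sum>v\<in>{0..<int \<rho>}. (n v)\<^sup>2)"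
        by (rule sum_windowed_le[OF \<rho>0 U0]) simp
      also have "\<dots> \<le> (5 * real s) * (20000 * B ^ 9 * (H' * M' * (1 + H'\<^sup>2 * M' / real \<rho>)))"
      proof (rule mult_mono)
        have "2 * real_of_int U / real \<rho> \<le> 2 * (2 * real s * real \<rho> / L) / real \<rho>"
          using Ule by (intro divide_right_mono mult_left_mono) auto
        also have "\<dots> = 4 * real s / L" using \<rho>0 by simp
        also have "\<dots> \<le> 4 * real s" using L s1 by (simp add: divide_le_eq mult_le_cancel_left1)
        finally show "1 + 2 * real_of_int U / real \<rho> \<le> 5 * real s" using s1 by linarith
        show "(\<Sum>v\<in>{0..<int \<rho>}. (n v)\<^sup>2) \<le> 20000 * B ^ 9 * (H' * M' * (1 + H'\<^sup>2 * M' / real \<rho>))"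
          unfolding n_def using False by (intro energy_bound \<rho>0 j\<rho> M'\<rho> H' B') auto
      qed (auto intro: sum_nonneg)
      finally show "(\<Sum>u\<in>?W. (n (u mod int \<rho>))\<^sup>2) \<le> 5 * real s * (20000 * B ^ 9 * (H' * M' * (1 + H'\<^sup>2 * M' / real \<rho>)))" .
      show "2 * real_of_int U \<le> 4 * real s * real \<rho> / L" using Ule by simp
      show "0 \<le> 5 * real s * (20000 * B ^ 9 * (H' * M' * (1 + H'\<^sup>2 * M' / real \<rho>)))"
        using B1 H' False by (intro mult_nonneg_nonneg add_nonneg_nonneg divide_nonneg_nonneg) auto
    qed (use U0 in auto)
    also have "\<dots> = 400000 * B ^ 9 * (real r / L) * ((real s)\<^sup>2 * (H' * M') * (1 + H'\<^sup>2 * M' / real \<rho>))"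
      by (simp add: rs power2_eq_square mult_ac)
    also have "\<dots> \<le> 400000 * B ^ 9 * (real r / L) * (H * M * (1 + H\<^sup>2 * M / real r))"
    proof (rule mult_left_mono, rule mult_mono)
      have s2: "(real s)\<^sup>2 \<ge> 1" using s1 by simp
      have "(real s)\<^sup>2 * (H' * M') = H * M / (real s)\<^sup>2" using s(2) by (simp add: H'_def M'_def power2_eq_square)
      also have "\<dots> \<le> H * M / 1" using s2 s(2) H M by (intro divide_left_mono) auto
      finally show "(real s)\<^sup>2 * (H' * M') \<le> H * M" by simp
      have "H'\<^sup>2 * M' / real \<rho> = H\<^sup>2 * M / real r / ((real s)\<^sup>2 * (real s)\<^sup>2)"
        using s(2) by (simp add: H'_def M'_def rs power2_eq_square)
      also have "\<dots> \<le> H\<^sup>2 * M / real r / (1 * 1)"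
        using s2 s(2) M by (intro divide_left_mono mult_mono) auto
      finally show "1 + H'\<^sup>2 * M' / real \<rho> \<le> 1 + H\<^sup>2 * M / real r" by simp
    qed (use B1 L H M H' False in auto)
    finally show ?thesis unfolding A_def .
  qed
qed

section \<open>From counting to the bilinear form\<close>

text \<open>The divisor bound is used with exponent \<epsilon>/2 because n reaches r^2; the harmonic
  sum is at most 1 + ln (4 r^2), and ln r <= r^\<epsilon> / \<epsilon>.\<close>

lemma exists_div_bound:
  fixes \<epsilon> :: real
  assumes "\<epsilon> > 0"
  shows "\<exists>C\<ge>1. \<forall>r::nat. r > 0 \<longrightarrow> div_bound r (C * real r powr \<epsilon>)"
proof -
  obtain C where C: "C \<ge> 1" "\<And>n::nat. n > 0 \<Longrightarrow> real (card {d. d dvd n}) \<le> C * real n powr (\<epsilon> / 2)"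
    using divisor_bound[of "\<epsilon> / 2"] assms by auto
  define K where "K = max C (1 + 2 / \<epsilon> + ln 4)"
  have K1: "K \<ge> 1" using C(1) by (simp add: K_def)
  have "div_bound r (K * real r powr \<epsilon>)" if r: "r > 0" for r :: nat
  proof -
    have p1: "real r powr \<epsilon> \<ge> 1" using r assms by (intro ge_one_powr_ge_zero) auto
    have "1 \<le> K * real r powr \<epsilon>" using mult_mono[OF K1 p1] K1 by simp
    moreover have "real (card {d. d dvd n}) \<le> K * real r powr \<epsilon>" if n: "0 < n" "n \<le> r\<^sup>2" for n
    proof -
      have "real n \<le> (real r)\<^sup>2" using n(2) by (metis of_nat_le_iff of_nat_power)
      then have "real n powr (\<epsilon> / 2) \<le> ((real r)\<^sup>2) powr (\<epsilon> / 2)" using assms by (intro powr_mono2) auto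
      also have "\<dots> = real r powr \<epsilon>" using r by (simp add: powr_powr flip: powr_numeral)
      finally have "C * real n powr (\<epsilon> / 2) \<le> K * real r powr \<epsilon>"
        using C(1) by (intro mult_mono) (auto simp: K_def)
      then show ?thesis using C(2)[OF n(1)] by linarith
    qed
    moreover have "harm (4 * r\<^sup>2) \<le> K * real r powr \<epsilon>"
    proof -
      have "harm (4 * r\<^sup>2) \<le> ln (real (4 * r\<^sup>2)) + (1 :: real)"
        using r euler_mascheroni_sequence_decreasing[of 1 "4 * r\<^sup>2"] by (simp add: harm_expand)
      also have "ln (real (4 * r\<^sup>2)) = ln 4 + 2 * ln (real r)"
        using r by (simp add: ln_mult ln_realpow)
      also have "ln (real r) \<le> real r powr \<epsilon> / \<epsilon>"
      proof -
        have "\<epsilon> * ln (real r) \<le> exp (\<epsilon> * ln (real r))"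
          using exp_ge_add_one_self[of "\<epsilon> * ln (real r)"] by linarith
        then show ?thesis using r assms by (simp add: powr_def pos_le_divide_eq mult.commute)
      qed
      finally have "harm (4 * r\<^sup>2) \<le> (1 + ln 4) * 1 + 2 / \<epsilon> * real r powr \<epsilon>" by simp
      also have "\<dots> \<le> (1 + ln 4) * real r powr \<epsilon> + 2 / \<epsilon> * real r powr \<epsilon>"
        using p1 by (intro add_right_mono mult_left_mono) auto
      also have "\<dots> = (1 + 2 / \<epsilon> + ln 4) * real r powr \<epsilon>" by (simp add: algebra_simps)
      also have "\<dots> \<le> K * real r powr \<epsilon>" by (intro mult_right_mono) (auto simp: K_def)
      finally show ?thesis .
    qed
    ultimately show ?thesis unfolding div_bound_def by blast
  qed
  then show ?thesis using K1 by blast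
qed

text \<open>700^2 = 490000 exceeds 400000, and B^9 is raised to B^10 to have an exact square
  root.\<close>

lemma card_near_pairs_le:
  assumes r: "r > 0" and j: "coprime j (int r)" and s: "s\<^sup>2 dvd r" "s > 0" and L: "L \<ge> 1"
    and M: "1 \<le> M" "M \<le> real r" and H: "0 < H" "H \<le> M" and B: "div_bound r B"
  shows "real (card (near_pairs r j L M H s))
    \<le> 700 * B ^ 5 * (M + sqrt (real r * H * M / L) + sqrt (H ^ 3 * M\<^sup>2 / L))"
proof -
  have B1: "B \<ge> 1" using div_boundD[OF B r] by simp
  define D where "D = {p \<in> near_pairs r j L M H s. snd (fst p) = snd (snd p)}"
  define A where "A = {p \<in> near_pairs r j L M H s. snd (fst p) \<noteq> snd (snd p)}"
  have nonneg: "0 \<le> real r * H * M / L" "0 \<le> H ^ 3 * M\<^sup>2 / L" using M H L by auto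
  have "near_pairs r j L M H s = D \<union> A" by (auto simp: D_def A_def)
  then have "card (near_pairs r j L M H s) \<le> card D + card A" by (simp add: card_Un_le)
  then have "real (card (near_pairs r j L M H s)) \<le> real (card D) + real (card A)" by linarith
  also have "real (card D) \<le> 9 * B\<^sup>2 * M"
    unfolding D_def using M by (intro card_near_pairs_diag_le r j s B) auto
  also have "\<dots> \<le> 700 * B ^ 5 * M"
    using B1 M by (intro mult_right_mono mult_mono power_increasing) auto
  also have "real (card A) \<le> 700 * B ^ 5 * (sqrt (real r * H * M / L) + sqrt (H ^ 3 * M\<^sup>2 / L))"
  proof -
    have "(real (card A))\<^sup>2 \<le> 400000 * B ^ 9 * (real r / L) * (H * M * (1 + H\<^sup>2 * M / real r))"
      unfolding A_def by (rule card_near_pairs_offdiag_le[OF r j s L M H B])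
    also have "\<dots> = 400000 * B ^ 9 * (real r * H * M / L + H ^ 3 * M\<^sup>2 / L)"
      using r L by (simp add: field_simps power2_eq_square power3_eq_cube)
    also have "\<dots> \<le> 490000 * B ^ 10 * (real r * H * M / L + H ^ 3 * M\<^sup>2 / L)"
      using B1 nonneg by (intro mult_right_mono mult_mono power_increasing) auto
    also have "\<dots> = (700 * B ^ 5)\<^sup>2 * (real r * H * M / L + H ^ 3 * M\<^sup>2 / L)"
      by (simp add: power_mult_distrib flip: power_mult)
    finally have "sqrt ((real (card A))\<^sup>2) \<le> sqrt ((700 * B ^ 5)\<^sup>2 * (real r * H * M / L + H ^ 3 * M\<^sup>2 / L))"
      by (rule real_sqrt_le_mono)
    also have "\<dots> = 700 * B ^ 5 * sqrt (real r * H * M / L + H ^ 3 * M\<^sup>2 / L)"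
      using B1 unfolding real_sqrt_mult real_sqrt_abs by simp
    also have "\<dots> \<le> 700 * B ^ 5 * (sqrt (real r * H * M / L) + sqrt (H ^ 3 * M\<^sup>2 / L))"
      using B1 nonneg by (intro mult_left_mono sqrt_add_le_add_sqrt) auto
    finally show ?thesis by simp
  qed
  finally show ?thesis by (simp add: algebra_simps)
qed

section \<open>Cauchy-Schwarz over cells of roots\<close>

lemma norm_sum_squared_le:
  fixes f :: "'a \<Rightarrow> complex"
  shows "(cmod (\<Sum>i\<in>I. f i))\<^sup>2 \<le> real (card I) * (\<Sum>i\<in>I. (cmod (f i))\<^sup>2)"
proof -
  have "(cmod (\<Sum>i\<in>I. f i))\<^sup>2 \<le> (\<Sum>i\<in>I. cmod (f i) * 1)\<^sup>2"
    by (intro power_mono) (auto intro: norm_sum)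
  also have "\<dots> \<le> (\<Sum>i\<in>I. (cmod (f i))\<^sup>2) * (\<Sum>i\<in>I. 1\<^sup>2)" by (rule Cauchy_Schwarz_ineq_sum)
  finally show ?thesis by (simp add: mult.commute)
qed

lemma norm_bilinear_le:
  fixes a G :: "int \<Rightarrow> complex"
  shows "(cmod (\<Sum>l\<in>S. a l * G l))\<^sup>2 \<le> (L2_set (\<lambda>l. cmod (a l)) S)\<^sup>2 * (\<Sum>l\<in>S. (cmod (G l))\<^sup>2)"
proof -
  have "(cmod (\<Sum>l\<in>S. a l * G l))\<^sup>2 \<le> (\<Sum>l\<in>S. cmod (a l) * cmod (G l))\<^sup>2"
    by (intro power_mono order_trans[OF norm_sum]) (auto simp: norm_mult)
  also have "\<dots> \<le> (\<Sum>l\<in>S. (cmod (a l))\<^sup>2) * (\<Sum>l\<in>S. (cmod (G l))\<^sup>2)" by (rule Cauchy_Schwarz_ineq_sum)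
  also have "(\<Sum>l\<in>S. (cmod (a l))\<^sup>2) = (L2_set (\<lambda>l. cmod (a l)) S)\<^sup>2"
    by (simp add: L2_set_def sum_nonneg)
  finally show ?thesis .
qed

lemma sum_card_fibers_squared:
  assumes "finite A"
  shows "(\<Sum>c\<in>f ` A. (card {x \<in> A. f x = c})\<^sup>2) = card {p \<in> A \<times> A. f (fst p) = f (snd p)}"
proof -
  have "{p \<in> A \<times> A. f (fst p) = f (snd p)} = (\<Union>c\<in>f ` A. {x \<in> A. f x = c} \<times> {x \<in> A. f x = c})"
    by auto
  also have "card \<dots> = (\<Sum>c\<in>f ` A. card ({x \<in> A. f x = c} \<times> {x \<in> A. f x = c}))"
    using assms by (intro card_UN_disjoint) auto
  finally show ?thesis by (simp add: card_cartesian_product power2_eq_square)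
qed

text \<open>Cauchy-Schwarz over the cells of i, then the large sieve in each cell. The squared bin
  counts add up to the number of pairs sharing both cell and bin.\<close>

lemma sum_cells_le:
  fixes c :: "'a \<Rightarrow> complex" and x :: "'a \<Rightarrow> real" and i :: "'a \<Rightarrow> 'b" and N :: nat
  assumes Z: "finite Z" and c: "\<And>\<xi>. \<xi> \<in> Z \<Longrightarrow> cmod (c \<xi>) \<le> b" and b: "b \<ge> 0"
  defines "n \<equiv> 2 * N + 1"
  shows "(\<Sum>l\<in>{- int N..int N}. (cmod (\<Sum>\<xi>\<in>Z. c \<xi> * efun (of_int l * x \<xi>)))\<^sup>2)
    \<le> real (card (i ` Z)) * (64 * real n * (b\<^sup>2 *
        real (card {p \<in> Z \<times> Z. i (fst p) = i (snd p) \<and> bin n (x (fst p)) = bin n (x (snd p))})))"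
proof -
  define Zi where "Zi = (\<lambda>y. {\<xi> \<in> Z. i \<xi> = y})"
  define g where "g = (\<lambda>\<xi>. (i \<xi>, bin n (x \<xi>)))"
  have n: "n > 0" by (simp add: n_def)
  have "(\<Sum>l\<in>{- int N..int N}. (cmod (\<Sum>\<xi>\<in>Z. c \<xi> * efun (of_int l * x \<xi>)))\<^sup>2)
    \<le> (\<Sum>l\<in>{- int N..int N}. real (card (i ` Z)) * (\<Sum>y\<in>i ` Z. (cmod (\<Sum>\<xi>\<in>Zi y. c \<xi> * efun (of_int l * x \<xi>)))\<^sup>2))"
  proof (rule sum_mono)
    fix l
    have "(\<Sum>\<xi>\<in>Z. c \<xi> * efun (of_int l * x \<xi>)) = (\<Sum>y\<in>i ` Z. \<Sum>\<xi>\<in>Zi y. c \<xi> * efun (of_int l * x \<xi>))"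
      unfolding Zi_def using Z by (rule sum.image_gen)
    then show "(cmod (\<Sum>\<xi>\<in>Z. c \<xi> * efun (of_int l * x \<xi>)))\<^sup>2 \<le>
      real (card (i ` Z)) * (\<Sum>y\<in>i ` Z. (cmod (\<Sum>\<xi>\<in>Zi y. c \<xi> * efun (of_int l * x \<xi>)))\<^sup>2)"
      using norm_sum_squared_le[of "\<lambda>y. \<Sum>\<xi>\<in>Zi y. c \<xi> * efun (of_int l * x \<xi>)" "i ` Z"] by simp
  qed
  also have "\<dots> = real (card (i ` Z)) * (\<Sum>y\<in>i ` Z. \<Sum>l\<in>{- int N..int N}. (cmod (\<Sum>\<xi>\<in>Zi y. c \<xi> * efun (of_int l * x \<xi>)))\<^sup>2)"
    by (subst sum.swap) (simp add: sum_distrib_left)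
  also have "\<dots> \<le> real (card (i ` Z)) * (\<Sum>y\<in>i ` Z. 64 * real n * (\<Sum>a<n. (b * real (card {\<xi> \<in> Z. g \<xi> = (y, a)}))\<^sup>2))"
  proof (intro mult_left_mono sum_mono)
    fix y
    have "(\<Sum>l\<in>{- int N..int N}. (cmod (\<Sum>\<xi>\<in>Zi y. c \<xi> * efun (of_int l * x \<xi>)))\<^sup>2)
      \<le> 64 * real n * (\<Sum>a<n. (\<Sum>\<xi> | \<xi> \<in> Zi y \<and> bin n (x \<xi>) = a. cmod (c \<xi>))\<^sup>2)"
      unfolding n_def using Z by (intro large_sieve_bins) (simp add: Zi_def)
    also have "\<dots> \<le> 64 * real n * (\<Sum>a<n. (b * real (card {\<xi> \<in> Z. g \<xi> = (y, a)}))\<^sup>2)"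
    proof (intro mult_left_mono sum_mono power_mono)
      fix a
      have eq: "{\<xi>. \<xi> \<in> Zi y \<and> bin n (x \<xi>) = a} = {\<xi> \<in> Z. g \<xi> = (y, a)}" by (auto simp: Zi_def g_def)
      have "(\<Sum>\<xi> | \<xi> \<in> Zi y \<and> bin n (x \<xi>) = a. cmod (c \<xi>)) \<le> (\<Sum>\<xi>\<in>{\<xi> \<in> Z. g \<xi> = (y, a)}. b)"
        unfolding eq by (intro sum_mono c) auto
      then show "(\<Sum>\<xi> | \<xi> \<in> Zi y \<and> bin n (x \<xi>) = a. cmod (c \<xi>)) \<le> b * real (card {\<xi> \<in> Z. g \<xi> = (y, a)})"
        by (simp add: mult.commute)
    qed (auto intro: sum_nonneg)
    finally show "(\<Sum>l\<in>{- int N..int N}. (cmod (\<Sum>\<xi>\<in>Zi y. c \<xi> * efun (of_int l * x \<xi>)))\<^sup>2) \<le> \<dots>" .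
  qed auto
  also have "\<dots> = real (card (i ` Z)) * (64 * real n * (b\<^sup>2 * (\<Sum>p\<in>i ` Z \<times> {..<n}. (real (card {\<xi> \<in> Z. g \<xi> = p}))\<^sup>2)))"
  proof -
    have "(\<Sum>p\<in>i ` Z \<times> {..<n}. h p) = (\<Sum>y\<in>i ` Z. \<Sum>a<n. h (y, a))" for h :: "'b \<times> nat \<Rightarrow> real"
      by (simp add: sum.cartesian_product)
    then show ?thesis by (simp add: power_mult_distrib flip: sum_distrib_left)
  qed
  also have "(\<Sum>p\<in>i ` Z \<times> {..<n}. (real (card {\<xi> \<in> Z. g \<xi> = p}))\<^sup>2) = (\<Sum>p\<in>g ` Z. (real (card {\<xi> \<in> Z. g \<xi> = p}))\<^sup>2)"
  proof (rule sum.mono_neutral_right)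
    show "g ` Z \<subseteq> i ` Z \<times> {..<n}" using bin_bounds(3)[OF n] by (auto simp: g_def)
    show "\<forall>p\<in>i ` Z \<times> {..<n} - g ` Z. (real (card {\<xi> \<in> Z. g \<xi> = p}))\<^sup>2 = 0"
    proof
      fix p assume "p \<in> i ` Z \<times> {..<n} - g ` Z"
      then have "p \<notin> g ` Z" by simp
      then have "{\<xi> \<in> Z. g \<xi> = p} = {}" by blast
      then show "(real (card {\<xi> \<in> Z. g \<xi> = p}))\<^sup>2 = 0" by (simp only: card.empty) simp
    qed
  qed (use Z in auto)
  also have "\<dots> = real (\<Sum>p\<in>g ` Z. (card {\<xi> \<in> Z. g \<xi> = p})\<^sup>2)" by simp
  also have "(\<Sum>p\<in>g ` Z. (card {\<xi> \<in> Z. g \<xi> = p})\<^sup>2) = card {p \<in> Z \<times> Z. g (fst p) = g (snd p)}"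
    using Z by (rule sum_card_fibers_squared)
  finally show ?thesis by (simp add: g_def)
qed

lemma bin_eq_imp_close:
  assumes "n > 0" "bin n x = bin n y"
  shows "\<exists>z::int. \<bar>x - y - of_int z\<bar> \<le> 1 / real n"
proof -
  have "\<bar>real n * frac x - real n * frac y\<bar> \<le> 1"
    using bin_bounds[OF assms(1), of x] bin_bounds[OF assms(1), of y] assms(2) by linarith
  then have "real n * \<bar>frac x - frac y\<bar> \<le> 1" by (simp add: abs_mult flip: right_diff_distrib)
  then have "\<bar>frac x - frac y\<bar> \<le> 1 / real n" using assms(1) by (simp add: pos_le_divide_eq mult.commute)
  moreover have "x - y - of_int (\<lfloor>x\<rfloor> - \<lfloor>y\<rfloor>) = frac x - frac y" by (simp add: frac_def)
  ultimately show ?thesis by metis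
qed

lemma l_range_eq:
  assumes "L \<ge> 0"
  shows "l_range L = {- int (nat \<lfloor>L\<rfloor>)..int (nat \<lfloor>L\<rfloor>)}"
proof -
  have "\<bar>real_of_int l\<bar> \<le> L \<longleftrightarrow> l \<in> {- \<lfloor>L\<rfloor>..\<lfloor>L\<rfloor>}" for l :: int
  proof -
    have "\<bar>real_of_int l\<bar> \<le> L \<longleftrightarrow> \<bar>l\<bar> \<le> \<lfloor>L\<rfloor>"
      by (simp only: of_int_abs[symmetric] le_floor_iff)
    then show ?thesis by (simp only: atLeastAtMost_iff abs_le_iff) linarith
  qed
  then have "l_range L = {- \<lfloor>L\<rfloor>..\<lfloor>L\<rfloor>}" unfolding l_range_def by blast
  then show ?thesis using assms by simp
qed

lemma finite_m_range [simp]: "finite (m_range M)"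
  by (rule finite_subset[of _ "{..nat \<lfloor>M\<rfloor>}"]) (auto simp: m_range_def intro: le_nat_floor)

text \<open>The two exponentials merge into a single frequency k/r + f(m), attached to the point (k,
  m).\<close>

lemma Sigma_sum_eq:
  "Sigma_sum r j L M \<alpha> \<beta> f = (\<Sum>l\<in>l_range L. \<alpha> l *
    (\<Sum>p\<in>all_roots r (int j) M. \<beta> (nat (snd p)) *
      efun (of_int l * (of_int (fst p) / real r + f (of_int (snd p))))))"
  unfolding Sigma_sum_def
proof (rule sum.cong[OF refl])
  fix l
  have fin: "finite (modular_sqrts r s)" for s
    by (rule finite_subset[of _ "{..<r}"]) (auto simp: modular_sqrts_def)
  define F where "F = (\<lambda>k m :: nat. \<beta> m * efun (of_int l * (real k / real r + f (real m))))"
  have "(\<Sum>m\<in>m_range M. \<alpha> l * \<beta> m * (\<Sum>k\<in>modular_sqrts r (j * m). emod r (of_int l * real k) * efun (of_int l * f (real m))))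
     = \<alpha> l * (\<Sum>m\<in>m_range M. \<Sum>k\<in>modular_sqrts r (j * m). F k m)"
    by (simp add: F_def emod_def sum_distrib_left distrib_left efun_add mult_ac)
  also have "(\<Sum>m\<in>m_range M. \<Sum>k\<in>modular_sqrts r (j * m). F k m)
     = (\<Sum>(m, k)\<in>Sigma (m_range M) (\<lambda>m. modular_sqrts r (j * m)). F k m)"
    using fin by (intro sum.Sigma) auto
  also have "\<dots> = (\<Sum>p\<in>all_roots r (int j) M. F (nat (fst p)) (nat (snd p)))"
  proof (rule sum.reindex_bij_witness[of _ "\<lambda>p. (nat (snd p), nat (fst p))" "\<lambda>(m, k). (int k, int m)"])
    have iff: "[k\<^sup>2 = j * m] (mod r) \<longleftrightarrow> int r dvd (int k)\<^sup>2 - int j * int m" for k m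
      by (simp flip: cong_int_iff add: cong_iff_dvd_diff)
    show "\<And>a. a \<in> all_roots r (int j) M \<Longrightarrow> (nat (snd a), nat (fst a)) \<in> Sigma (m_range M) (\<lambda>m. modular_sqrts r (j * m))"
      by (auto simp: all_roots_def m_range_def modular_sqrts_def iff)
    show "\<And>a. a \<in> Sigma (m_range M) (\<lambda>m. modular_sqrts r (j * m)) \<Longrightarrow> (case a of (m, k) \<Rightarrow> (int k, int m)) \<in> all_roots r (int j) M"
      by (auto simp: all_roots_def m_range_def modular_sqrts_def iff)
  qed (auto simp: all_roots_def)
  also have "\<dots> = (\<Sum>p\<in>all_roots r (int j) M. \<beta> (nat (snd p)) *
      efun (of_int l * (of_int (fst p) / real r + f (of_int (snd p)))))"
    by (intro sum.cong) (auto simp: F_def all_roots_def)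
  finally show "(\<Sum>m\<in>m_range M. \<alpha> l * \<beta> m * (\<Sum>k\<in>modular_sqrts r (j * m). emod r (of_int l * real k) * efun (of_int l * f (real m))))
    = \<alpha> l * (\<Sum>p\<in>all_roots r (int j) M. \<beta> (nat (snd p)) *
      efun (of_int l * (of_int (fst p) / real r + f (of_int (snd p)))))" .
qed

lemma card_cells_le:
  assumes r: "r > 0" and M: "1 \<le> M" and H: "H > 0" "real H \<le> M" and B: "div_bound r B"
  shows "real (card ((\<lambda>p. (sqpart r (fst p), snd p div int H)) ` all_roots r j M)) \<le> 2 * B * M / real H"
proof -
  define Ws where "Ws = {s. s\<^sup>2 dvd r \<and> s > 0}"
  have finW: "finite Ws" unfolding Ws_def using finite_square_divisors[OF r, of "\<lambda>s. s > 0"] .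
  have "card Ws \<le> card {d. d dvd r}"
    using r by (intro card_mono) (auto simp: Ws_def power2_eq_square dest: dvd_mult_left)
  then have cW: "real (card Ws) \<le> B" using div_boundD[OF B r] by linarith
  have "(\<lambda>p. (sqpart r (fst p), snd p div int H)) ` all_roots r j M \<subseteq> Ws \<times> {0..\<lfloor>M\<rfloor> div int H}"
    using sqpart_mem[OF r] H by (auto simp: all_roots_def Ws_def le_floor_iff pos_imp_zdiv_nonneg_iff intro!: zdiv_mono1)
  then have "card ((\<lambda>p. (sqpart r (fst p), snd p div int H)) ` all_roots r j M) \<le> card (Ws \<times> {0..\<lfloor>M\<rfloor> div int H})"
    using finW by (intro card_mono) auto
  also have "\<dots> = card Ws * nat (\<lfloor>M\<rfloor> div int H + 1)" by (simp add: card_cartesian_product)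
  finally have "real (card ((\<lambda>p. (sqpart r (fst p), snd p div int H)) ` all_roots r j M))
      \<le> real (card Ws * nat (\<lfloor>M\<rfloor> div int H + 1))" unfolding of_nat_le_iff .
  also have "\<dots> = real (card Ws) * real (nat (\<lfloor>M\<rfloor> div int H + 1))" by simp
  also have "\<dots> \<le> B * (2 * M / real H)"
  proof (rule mult_mono[OF cW])
    have "real_of_int (\<lfloor>M\<rfloor> div int H) \<le> real_of_int \<lfloor>M\<rfloor> / real H"
      by (metis of_int_of_nat_eq real_of_int_div4)
    also have "\<dots> \<le> M / real H" by (intro divide_right_mono) auto
    finally have "real_of_int (\<lfloor>M\<rfloor> div int H) \<le> M / real H" .
    moreover have "1 \<le> M / real H" using H by (simp add: pos_le_divide_eq)
    moreover have "0 \<le> \<lfloor>M\<rfloor> div int H" using M H by (simp add: pos_imp_zdiv_nonneg_iff)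
    ultimately show "real (nat (\<lfloor>M\<rfloor> div int H + 1)) \<le> 2 * M / real H" by simp
  qed (use div_boundD[OF B r] in auto)
  finally show ?thesis by (simp add: mult_ac)
qed

text \<open>A common bin puts the frequencies within 1/n <= 1/L of each other modulo 1, and a common
  block moves f by at most 1/L; so k - k' is within 2 r / L of a multiple of r. The sum over s costs
  one more B.\<close>

lemma card_cell_pairs_le:
  assumes r: "r > 0" and j: "coprime j (int r)" and L: "L \<ge> 1"
    and M: "1 \<le> M" "M \<le> real r" and H: "H > 0" "real H \<le> M" and B: "div_bound r B"
    and f: "\<And>x y. x \<in> {1..M} \<Longrightarrow> y \<in> {1..M} \<Longrightarrow> \<bar>x - y\<bar> \<le> real H \<Longrightarrow> \<bar>f x - f y\<bar> \<le> 1 / L"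
    and n: "real n \<ge> L"
  defines "Z \<equiv> all_roots r j M"
  defines "i \<equiv> \<lambda>p. (sqpart r (fst p), snd p div int H)"
  defines "x \<equiv> \<lambda>p. of_int (fst p) / real r + f (of_int (snd p))"
  shows "real (card {p \<in> Z \<times> Z. i (fst p) = i (snd p) \<and> bin n (x (fst p)) = bin n (x (snd p))})
    \<le> 700 * B ^ 6 * (M + sqrt (real r * real H * M / L) + sqrt (real H ^ 3 * M\<^sup>2 / L))"
proof -
  define Ws where "Ws = {s. s\<^sup>2 dvd r \<and> s > 0}"
  define K where "K = 700 * B ^ 5 * (M + sqrt (real r * real H * M / L) + sqrt (real H ^ 3 * M\<^sup>2 / L))"
  have B1: "B \<ge> 1" using div_boundD[OF B r] by simp
  have K0: "K \<ge> 0" unfolding K_def using B1 M L by auto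
  have n0: "n > 0" using n L by (cases n) auto
  have finW: "finite Ws" unfolding Ws_def using finite_square_divisors[OF r, of "\<lambda>s. s > 0"] .
  have "card Ws \<le> card {d. d dvd r}"
    using r by (intro card_mono) (auto simp: Ws_def power2_eq_square dest: dvd_mult_left)
  then have cW: "real (card Ws) \<le> B" using div_boundD[OF B r] by linarith
  have "{p \<in> Z \<times> Z. i (fst p) = i (snd p) \<and> bin n (x (fst p)) = bin n (x (snd p))}
      \<subseteq> (\<Union>s\<in>Ws. near_pairs r j L M (real H) s)"
  proof
    fix p assume "p \<in> {p \<in> Z \<times> Z. i (fst p) = i (snd p) \<and> bin n (x (fst p)) = bin n (x (snd p))}"
    then obtain k m k' m' where p: "p = ((k, m), (k', m'))" and km: "(k, m) \<in> Z" "(k', m') \<in> Z"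
      and sq: "sqpart r k = sqpart r k'" and dv: "m div int H = m' div int H" and bn: "bin n (x (k, m)) = bin n (x (k', m'))"
      by (auto simp: i_def)
    have mm: "of_int m \<in> {1..M}" "of_int m' \<in> {1..M}" using km by (auto simp: Z_def all_roots_def)
    have "m = (m div int H) * int H + m mod int H" "m' = (m div int H) * int H + m' mod int H"
      by simp (simp add: dv)
    moreover have "0 \<le> m mod int H" "m mod int H < int H" "0 \<le> m' mod int H" "m' mod int H < int H"
      using H by auto
    ultimately have "\<bar>m - m'\<bar> \<le> int H" by linarith
    then have mH: "\<bar>real_of_int m - of_int m'\<bar> \<le> real H" by linarith
    obtain z :: int where z: "\<bar>x (k, m) - x (k', m') - of_int z\<bar> \<le> 1 / real n"
      using bin_eq_imp_close[OF n0 bn] by blast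
    have "1 / real n \<le> 1 / L" using n L by (intro divide_left_mono) auto
    then have "\<bar>x (k, m) - x (k', m') - of_int z\<bar> \<le> 1 / L" using z by linarith
    moreover have "\<bar>f (of_int m) - f (of_int m')\<bar> \<le> 1 / L" by (rule f[OF mm mH])
    moreover have "x (k, m) - x (k', m') - of_int z = (of_int k / real r - of_int k' / real r - of_int z) + (f (of_int m) - f (of_int m'))"
      by (simp add: x_def)
    ultimately have "\<bar>of_int k / real r - of_int k' / real r - of_int z\<bar> \<le> 1 / L + 1 / L" by linarith
    then have "real r * \<bar>of_int k / real r - of_int k' / real r - of_int z\<bar> \<le> real r * (1 / L + 1 / L)"
      by (rule mult_left_mono) simp
    moreover have "real r * \<bar>of_int k / real r - of_int k' / real r - of_int z\<bar> = \<bar>real r * (of_int k / real r - of_int k' / real r - of_int z)\<bar>"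
      by (simp add: abs_mult)
    moreover have "real r * (of_int k / real r - of_int k' / real r - of_int z) = real_of_int (k - k' - z * int r)"
      using r by (simp add: right_diff_distrib)
    ultimately have "\<bar>real_of_int (k - k' - z * int r)\<bar> \<le> real r * (1 / L + 1 / L)" by (simp only:)
    also have "\<dots> = 2 * real r / L" by simp
    finally have "\<bar>real_of_int (k - k' - z * int r)\<bar> \<le> 2 * real r / L" .
    then have "p \<in> near_pairs r j L M (real H) (sqpart r k)"
      unfolding near_pairs_def p mem_Collect_eq prod.case
      using km[unfolded Z_def] sq[symmetric] mH[folded of_int_diff] by blast
    moreover have "sqpart r k \<in> Ws" using sqpart_mem[OF r] by (auto simp: Ws_def)
    ultimately show "p \<in> (\<Union>s\<in>Ws. near_pairs r j L M (real H) s)" by blast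
  qed
  then have "card {p \<in> Z \<times> Z. i (fst p) = i (snd p) \<and> bin n (x (fst p)) = bin n (x (snd p))}
      \<le> card (\<Union>s\<in>Ws. near_pairs r j L M (real H) s)"
    using finW by (intro card_mono) auto
  also have "\<dots> \<le> (\<Sum>s\<in>Ws. card (near_pairs r j L M (real H) s))" using finW by (rule card_UN_le)
  finally have "real (card {p \<in> Z \<times> Z. i (fst p) = i (snd p) \<and> bin n (x (fst p)) = bin n (x (snd p))})
      \<le> (\<Sum>s\<in>Ws. real (card (near_pairs r j L M (real H) s)))"
    by (simp only: of_nat_le_iff of_nat_sum[symmetric])
  also have "\<dots> \<le> (\<Sum>s\<in>Ws. K)"
    unfolding K_def using H by (intro sum_mono card_near_pairs_le r j L M B) (auto simp: Ws_def)
  also have "\<dots> = real (card Ws) * K" by simp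
  also have "\<dots> \<le> B * K" using cW K0 by (rule mult_right_mono)
  finally show ?thesis by (simp add: K_def power_numeral_reduce mult_ac)
qed

text \<open>In terms of the fourth roots of H, L, M and r all exponents are integers, and the left
  side is exactly the sum of the squares of the three terms of T.\<close>

lemma bilinear_bound:
  fixes H L M r :: real
  assumes "H > 0" "L > 0" "M > 0" "r > 0"
  defines "T \<equiv> H powr (-1/2) * L powr (1/2) * M + H powr (1/4) * L powr (1/4) * M
             + H powr (-1/4) * L powr (1/4) * M powr (3/4) * r powr (1/4)"
  shows "(M * L / H) * (M + sqrt (r * H * M / L) + sqrt (H ^ 3 * M\<^sup>2 / L)) \<le> T\<^sup>2" and "T \<ge> 0"
proof -
  show "T \<ge> 0" unfolding T_def using assms by auto
  define h l m \<rho> where "h = H powr (1/4)" and "l = L powr (1/4)" and "m = M powr (1/4)" and "\<rho> = r powr (1/4)"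
  have pos: "h > 0" "l > 0" "m > 0" "\<rho> > 0" using assms by (auto simp: h_def l_def m_def \<rho>_def)
  have 4: "H = h ^ 4" "L = l ^ 4" "M = m ^ 4" "r = \<rho> ^ 4"
    using assms by (auto simp: h_def l_def m_def \<rho>_def powr_power)
  have p: "H powr (-1/2) = 1 / h\<^sup>2" "L powr (1/2) = l\<^sup>2" "H powr (-1/4) = 1 / h" "M powr (3/4) = m ^ 3"
    using assms by (auto simp: h_def l_def m_def powr_power powr_minus_divide)
  have T: "T = l\<^sup>2 * m ^ 4 / h\<^sup>2 + h * l * m ^ 4 + l * m ^ 3 * \<rho> / h"
    unfolding T_def p h_def[symmetric] l_def[symmetric] \<rho>_def[symmetric] by (simp add: 4(3))
  have s1: "sqrt (r * H * M / L) = \<rho>\<^sup>2 * h\<^sup>2 * m\<^sup>2 / l\<^sup>2"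
    unfolding 4 using pos by (intro real_sqrt_unique) (auto simp: power_mult_distrib power_divide)
  have s2: "sqrt (H ^ 3 * M\<^sup>2 / L) = h ^ 6 * m ^ 4 / l\<^sup>2"
    unfolding 4 using pos by (intro real_sqrt_unique) (auto simp: power_mult_distrib power_divide simp flip: power_mult)
  have "(M * L / H) * (M + sqrt (r * H * M / L) + sqrt (H ^ 3 * M\<^sup>2 / L))
      = (l\<^sup>2 * m ^ 4 / h\<^sup>2)\<^sup>2 + (h * l * m ^ 4)\<^sup>2 + (l * m ^ 3 * \<rho> / h)\<^sup>2"
    unfolding s1 s2 unfolding 4(1-3) using pos by (simp add: field_simps power2_eq_square power_numeral_reduce)
  also have "\<dots> \<le> T\<^sup>2"
  proof -
    have sq: "x\<^sup>2 + y\<^sup>2 + z\<^sup>2 \<le> (x + y + z)\<^sup>2" if "x \<ge> 0" "y \<ge> 0" "z \<ge> 0" for x y z :: real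
    proof -
      have "(x + y + z)\<^sup>2 = x\<^sup>2 + y\<^sup>2 + z\<^sup>2 + 2 * (x * y + y * z + x * z)" by (simp add: power2_eq_square algebra_simps)
      moreover have "2 * (x * y + y * z + x * z) \<ge> 0" using that by simp
      ultimately show ?thesis by (simp only: le_add_same_cancel1)
    qed
    show ?thesis unfolding T using pos by (intro sq) auto
  qed
  finally show "(M * L / H) * (M + sqrt (r * H * M / L) + sqrt (H ^ 3 * M\<^sup>2 / L)) \<le> T\<^sup>2" .
qed

lemma C1_on_interval_close:
  assumes f: "C1_on_interval 1 M f f'" "\<And>x. x \<in> {1..M} \<Longrightarrow> \<bar>f' x\<bar> \<le> F"
    and xy: "x \<in> {1..M}" "y \<in> {1..M}" "\<bar>x - y\<bar> \<le> h" and h: "h * F \<le> c"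
  shows "\<bar>f x - f y\<bar> \<le> c"
proof -
  have F0: "F \<ge> 0" using f(2)[OF xy(1)] by linarith
  have "norm (f x - f y) \<le> F * norm (x - y)"
    using f xy by (intro field_differentiable_bound[of "{1..M}" f f']) (auto simp: C1_on_interval_def)
  also have "\<dots> \<le> F * h" using xy(3) F0 by (intro mult_left_mono) auto
  finally show ?thesis using h by (simp add: mult.commute)
qed

theorem theorem1p2:
  fixes \<epsilon> :: real
  assumes "\<epsilon> > 0"
  shows "\<exists>C::real. C > 0 \<and>
    (\<forall>(r::nat) (j::nat) (L::real) (M::real) (F::real) (f::real \<Rightarrow> real) (f'::real \<Rightarrow> real)
        (\<alpha>::int \<Rightarrow> complex) (\<beta>::nat \<Rightarrow> complex) (H::nat).
      r > 0 \<longrightarrow> j > 0 \<longrightarrow> gcd r j = 1 \<longrightarrow>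
      1 \<le> L \<longrightarrow> L \<le> real r \<longrightarrow> 1 \<le> M \<longrightarrow> M \<le> real r \<longrightarrow>
      C1_on_interval 1 M f f' \<longrightarrow> (\<forall>x\<in>{1..M}. \<bar>f' x\<bar> \<le> F) \<longrightarrow> F \<le> 1 / L \<longrightarrow>
      1 \<le> H \<longrightarrow> ereal (real H) \<le> min (1 / ereal (L * F)) (ereal M) \<longrightarrow>
      cmod (Sigma_sum r j L M \<alpha> \<beta> f) \<le>
        C * (real H powr (-1/2) * L powr (1/2) * M
             + real H powr (1/4) * L powr (1/4) * M
             + real H powr (-1/4) * L powr (1/4) * M powr (3/4) * real r powr (1/4))
          * norm_two L \<alpha> * norm_max M \<beta> * real r powr \<epsilon>)"
proof -
  \<comment> \<open>The final bound contains B^4, hence the exponent \<epsilon>/4.\<close>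
  obtain C where C1: "C \<ge> 1" and C: "\<And>r::nat. r > 0 \<Longrightarrow> div_bound r (C * real r powr (\<epsilon> / 4))"
    using exists_div_bound[of "\<epsilon> / 4"] assms by auto
  show ?thesis
  proof (intro exI[of _ "519 * C ^ 4"] conjI allI impI)
    show "519 * C ^ 4 > 0" using C1 by simp
    fix r j H :: nat and L M F :: real and f f' :: "real \<Rightarrow> real" and \<alpha> :: "int \<Rightarrow> complex" and \<beta> :: "nat \<Rightarrow> complex"
    assume r: "r > 0" and "j > 0" and gj: "gcd r j = 1" and L: "1 \<le> L" "L \<le> real r" and M: "1 \<le> M" "M \<le> real r"
      and f: "C1_on_interval 1 M f f'" "\<forall>x\<in>{1..M}. \<bar>f' x\<bar> \<le> F" "F \<le> 1 / L"
      and H1: "1 \<le> H" and Hmin: "ereal (real H) \<le> min (1 / ereal (L * F)) (ereal M)"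
    define B where "B = C * real r powr (\<epsilon> / 4)"
    define T where "T = real H powr (-1/2) * L powr (1/2) * M + real H powr (1/4) * L powr (1/4) * M
             + real H powr (-1/4) * L powr (1/4) * M powr (3/4) * real r powr (1/4)"
    define E where "E = M + sqrt (real r * real H * M / L) + sqrt (real H ^ 3 * M\<^sup>2 / L)"
    define a where "a = norm_two L \<alpha>"
    define b where "b = norm_max M \<beta>"
    define N where "N = nat \<lfloor>L\<rfloor>"
    define n where "n = 2 * N + 1"
    define Z where "Z = all_roots r (int j) M"
    define x where "x = (\<lambda>p. of_int (fst p) / real r + f (of_int (snd p)))"
    define G where "G = (\<lambda>l. \<Sum>p\<in>Z. \<beta> (nat (snd p)) * efun (of_int l * x p))"
    \<comment> \<open>The cells record the square part besides the block, so that only pairs with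
      equal square part need counting.\<close>
    define i where "i = (\<lambda>p. (sqpart r (fst p), snd p div int H))"
    define P where "P = {p \<in> Z \<times> Z. i (fst p) = i (snd p) \<and> bin n (x (fst p)) = bin n (x (snd p))}"
    have B: "div_bound r B" unfolding B_def by (rule C[OF r])
    have B1: "B \<ge> 1" using div_boundD[OF B r] by simp
    have j: "coprime (int j) (int r)" using gj by (simp add: coprime_iff_gcd_eq_1 gcd.commute)
    have HM: "real H \<le> M" using Hmin by simp
    have F0: "F \<ge> 0" using f(2) M(1) by (meson abs_ge_zero atLeastAtMost_iff order_refl order_trans)
    \<comment> \<open>For F = 0 the first entry of the minimum is infinite and gives nothing, but
      then H F = 0.\<close>
    have HF: "real H * F \<le> 1 / L"
    proof (cases "F = 0")
      case False
      then have "1 / ereal (L * F) = ereal (1 / (L * F))" using F0 L by (intro inverse_LF_pos) auto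
      then have "real H \<le> 1 / (L * F)" using Hmin by simp
      then show ?thesis using False F0 L by (simp add: field_simps)
    qed (use L in simp)
    have close: "\<bar>f u - f v\<bar> \<le> 1 / L" if "u \<in> {1..M}" "v \<in> {1..M}" "\<bar>u - v\<bar> \<le> real H" for u v
      using f by (intro C1_on_interval_close[OF f(1) _ that HF]) auto
    have NL: "real N \<le> L" "L \<le> real N + 1" unfolding N_def using L by linarith+
    have n: "L \<le> real n" "real n \<le> 3 * L" using NL L unfolding n_def by simp_all
    have bm: "cmod (\<beta> m) \<le> b" if "m \<in> m_range M" for m
      unfolding b_def norm_max_def using that by (intro Max_ge) auto
    have b0: "b \<ge> 0"
      using order_trans[OF norm_ge_zero bm[of 1]] M by (auto simp: m_range_def)
    have a0: "a \<ge> 0" by (simp add: a_def norm_two_def)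
    have E0: "E \<ge> 0" unfolding E_def using M L by auto
    have lr: "l_range L = {- int N..int N}" unfolding N_def using L by (intro l_range_eq) auto
    have "(\<Sum>l\<in>{- int N..int N}. (cmod (G l))\<^sup>2) \<le> real (card (i ` Z)) * (64 * real n * (b\<^sup>2 * real (card P)))"
      unfolding G_def P_def n_def
    proof (rule sum_cells_le[OF _ _ b0])
      show "finite Z" by (simp add: Z_def)
      show "cmod (\<beta> (nat (snd p))) \<le> b" if "p \<in> Z" for p
        using that by (intro bm) (auto simp: Z_def all_roots_def m_range_def)
    qed
    also have "\<dots> \<le> (2 * B * M / real H) * (64 * (3 * L) * (b\<^sup>2 * (700 * B ^ 6 * E)))"
    proof (intro mult_mono mult_left_mono)
      show "real (card (i ` Z)) \<le> 2 * B * M / real H"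
        unfolding i_def Z_def using H1 HM by (intro card_cells_le r M B) auto
      show "real (card P) \<le> 700 * B ^ 6 * E"
        unfolding P_def i_def Z_def x_def E_def using H1 HM close n(1)
        by (intro card_cell_pairs_le r j L M B) auto
    qed (use n B1 M L E0 in auto)
    also have "\<dots> = 268800 * B ^ 7 * b\<^sup>2 * ((M * L / real H) * E)"
      by (simp add: power_numeral_reduce mult_ac)
    \<comment> \<open>Rounding up to a square: 519^2 = 269361 exceeds 268800 = 2 * 64 * 3 * 700, and
      B^7 becomes B^8.\<close>
    also have "\<dots> \<le> 269361 * B ^ 8 * b\<^sup>2 * T\<^sup>2"
    proof (intro order_refl mult_mono power_increasing)
      show "M * L / real H * E \<le> T\<^sup>2"
        unfolding E_def T_def using H1 L M r by (intro bilinear_bound) auto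
    qed (use B1 M L E0 in auto)
    finally have G: "(\<Sum>l\<in>{- int N..int N}. (cmod (G l))\<^sup>2) \<le> 269361 * B ^ 8 * b\<^sup>2 * T\<^sup>2" .
    have "(cmod (Sigma_sum r j L M \<alpha> \<beta> f))\<^sup>2 \<le> a\<^sup>2 * (\<Sum>l\<in>{- int N..int N}. (cmod (G l))\<^sup>2)"
      unfolding Sigma_sum_eq a_def norm_two_def lr G_def Z_def x_def by (rule norm_bilinear_le)
    also have "\<dots> \<le> a\<^sup>2 * (269361 * B ^ 8 * b\<^sup>2 * T\<^sup>2)" using G by (rule mult_left_mono) simp
    also have "\<dots> = (519 * B ^ 4 * T * a * b)\<^sup>2"
      by (simp add: power_mult_distrib mult_ac flip: power_mult)
    finally have "cmod (Sigma_sum r j L M \<alpha> \<beta> f) \<le> 519 * B ^ 4 * T * a * b"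
    proof (rule power2_le_imp_le)
      have "T \<ge> 0" unfolding T_def using H1 L M r by (intro bilinear_bound) auto
      then show "0 \<le> 519 * B ^ 4 * T * a * b" using B1 a0 b0 by simp
    qed
    also have "B ^ 4 = C ^ 4 * real r powr \<epsilon>"
      using r by (simp add: B_def power_mult_distrib powr_power)
    also have "519 * (C ^ 4 * real r powr \<epsilon>) * T * a * b = 519 * C ^ 4 * T * a * b * real r powr \<epsilon>" by simp
    finally show "cmod (Sigma_sum r j L M \<alpha> \<beta> f) \<le> 519 * C ^ 4 * (real H powr (-1/2) * L powr (1/2) * M
             + real H powr (1/4) * L powr (1/4) * M
             + real H powr (-1/4) * L powr (1/4) * M powr (3/4) * real r powr (1/4))
          * norm_two L \<alpha> * norm_max M \<beta> * real r powr \<epsilon>"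
      unfolding T_def a_def b_def .
  qed
qed

end
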